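(* Let $B^0$ be an $n\times n$ exchange matrix of type $\mathrm{A}_n$, let $Q^0=Q(B^0)$, and let $\Phi_+(B^0)$ be the collection of (nonempty) subsets $C\subset[1,n]$ such that the subgraph of $Q^0$ induced by $C$ is a chain. Let $\mathcal{A}$ be a cluster algebra (of geometric type) whose initial exchange matrix at $t_0$ has principal part $B^0$. Then the cluster variables in $\mathcal{A}$ which are not in the initial cluster are in bijective correspondence with the elements of $\Phi_+(B^0)$; more specifically, if a cluster variable corresponds to the set $C\in\Phi_+(B^0)$, then its denominator vector is $\mathbf{e}_C=\sum_{i\in C}\mathbf{e}_i$.
   Context: Notation: $[i,j]=\{k\in\mathbb{Z}: i\le k\le j\}$; $[x]_+=\max(x,0)$; $\mathbf{e}_i$ are standard basis vectors. Mutation of an $m\times n$ integer matrix $\tilde B=(b_{ij})$ ($m\ge n$) in direction $k\in[1,n]$: $b'_{ij}=-b_{ij}$ if $i=k$ or $j=k$, and $b'_{ij}=b_{ij}+\mathrm{sgn}(b_{ik})[b_{ik}b_{kj}]_+$ otherwise. The principal part is the top $n\times n$ submatrix. An $n\times n$ exchange matrix of type $\mathrm{A}_n$ is a matrix obtained by a sequence of matrix mutations from the matrix $(b_{ij})$ with $b_{i,i+1}=1$, $b_{i,i-1}=-1$ and all other entries $0$. For a skew-symmetric integer matrix $B=(b_{ij})$, $Q(B)$ is the quiver on $[1,n]$ with $|b_{ij}|$ arrows from $i$ to $j$ if and only if $b_{ij}<0$. A chain is a path graph: vertices $v_1,\dots,v_p$ ($p\ge1$) distinct, with one edge joining $v_i$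 and $v_{i+1}$ for $i=1,\dots,p-1$ and no other edges among them (orientations disregarded). Cluster algebras: $\mathbb{T}_n$ is the $n$-regular tree with edges labeled by $1,\dots,n$ so that the $n$ edges at each vertex have distinct labels, and $t_0\in\mathbb{T}_n$. A labeled seed is a pair $(\tilde{\mathbf x},\tilde B)$ with $\tilde{\mathbf x}=(x_1,\dots,x_m)$ a free generating set of the ambient field of rational functions in $m$ variables over $\mathbb{Q}$, and $\tilde B$ an $m\times n$ integer matrix with skew-symmetrizable principal part. Seed mutation in direction $k\in[1,n]$ mutates $\tilde B$ and replaces only $x_k$, by $x_k'=x_k^{-1}(\prod_i x_i^{[b_{ik}]_+}+\prod_i x_i^{[-b_{ik}]_+})$. A cluster pattern assigns seeds $((x_{1;t},\dots,x_{m;t}),\tilde B_t)$ to $t\in\mathbb{T}_n$ so that seeds joined by an edge labeled $k$ are related by mutation in direction $k$; the cluster at $t$ is $(x_{1;t},\dots,x_{n;t})$, cluster variables are the $x_{j;t}$, $j\in[1,n]$, and the cluster algebra is the $\mathbb{Z}[x_{n+1}^{\pm1},\dots,x_m^{\pm1}]$-algebra they generate. By the Laurent phenomenon each $x_{j;t}=N(x_1,\dots,x_n)/(x_1^{d_1}\cdots x_n^{d_n})$, where $(x_1,\dots,x_m)$ is the initial extended cluster and $N$ is a polynomial with coefficients in $\mathbb{Z}[x_{n+1}^{\pm1},\dots,x_m^{\pm1}]$ not divisible by any $x_i$, $i\in[1,n]$; the denominator vector of $x_{j;t}$ is $(d_1,\dots,d_n)$. *)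

theory Defs
  imports Complex_Main "HOL-Library.Poly_Mapping" "Graph_Theory.Digraph_Component"
begin

section \<open>Matrix mutation and exchange matrices of type A\<close>

text \<open>
  An \<open>m \<times> n\<close> integer matrix is a function on index pairs of which only the entries with row
  index in \<open>{1..m}\<close> and column index in \<open>{1..n}\<close> are meaningful. All equations between
  matrices are stated on these ranges only.
\<close>

type_synonym int_matrix = "nat \<Rightarrow> nat \<Rightarrow> int"

definition matrix_agree :: "nat \<Rightarrow> nat \<Rightarrow> int_matrix \<Rightarrow> int_matrix \<Rightarrow> bool" where
  "matrix_agree m n B B' \<longleftrightarrow> (\<forall>i\<in>{1..m}. \<forall>j\<in>{1..n}. B i j = B' i j)"

definition mutate_matrix :: "nat \<Rightarrow> int_matrix \<Rightarrow> int_matrix" where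
  "mutate_matrix k B = (\<lambda>i j.
     if i = k \<or> j = k then - B i j
     else B i j + sgn (B i k) * max (B i k * B k j) 0)"

definition linear_A_matrix :: int_matrix where
  "linear_A_matrix = (\<lambda>i j. if j = i + 1 then 1 else if i = j + 1 then - 1 else 0)"

text \<open>
  Mutation in a direction \<open>k \<in> {1..n}\<close> computes the entries with indices in \<open>{1..n}\<close> from such
  entries only, so the unbounded matrix \<^const>\<open>linear_A_matrix\<close> may be mutated before restricting.
\<close>

definition exchange_matrix_type_A :: "nat \<Rightarrow> int_matrix \<Rightarrow> bool" where
  "exchange_matrix_type_A n B \<longleftrightarrow>
     (\<exists>ks. set ks \<subseteq> {1..n} \<and> matrix_agree n n B (fold mutate_matrix ks linear_A_matrix))"

section \<open>Quivers and chains\<close>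

text \<open>The arc \<open>(i, j, l)\<close> is the \<open>l\<close>-th of the parallel arrows from \<open>i\<close> to \<open>j\<close>.\<close>

definition quiver_of :: "nat \<Rightarrow> int_matrix \<Rightarrow> (nat, nat \<times> nat \<times> nat) pre_digraph" where
  "quiver_of n B =
     \<lparr>verts = {1..n},
      arcs = {(i, j, l). i \<in> {1..n} \<and> j \<in> {1..n} \<and> B i j < 0 \<and> l < nat \<bar>B i j\<bar>},
      tail = (\<lambda>(i, j, l). i),
      head = (\<lambda>(i, j, l). j)\<rparr>"

definition edges_between :: "('v, 'e) pre_digraph \<Rightarrow> 'v \<Rightarrow> 'v \<Rightarrow> 'e set" where
  "edges_between G u v = {e \<in> arcs G. {tail G e, head G e} = {u, v}}"

text \<open>For \<open>a = b\<close> the condition below says that there are no loops. Finiteness of the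
  arc set is required because \<^const>\<open>card\<close> is 0 on infinite sets.\<close>

definition is_chain :: "('v, 'e) pre_digraph \<Rightarrow> bool" where
  "is_chain G \<longleftrightarrow>
     (\<exists>vs. vs \<noteq> [] \<and> distinct vs \<and> set vs = verts G \<and> finite (arcs G) \<and>
        (\<forall>a < length vs. \<forall>b < length vs.
           card (edges_between G (vs ! a) (vs ! b)) = (if b = a + 1 \<or> a = b + 1 then 1 else 0)))"

definition Phi_plus :: "nat \<Rightarrow> int_matrix \<Rightarrow> nat set set" where
  "Phi_plus n B = {C. C \<subseteq> {1..n} \<and> C \<noteq> {} \<and> is_chain (induce_subgraph (quiver_of n B) C)}"

section \<open>Subrings, subfields and free generating sets\<close>

definition is_subring :: "'a::field_char_0 set \<Rightarrow> bool" where
  "is_subring R \<longleftrightarrow> 0 \<in> R \<and> 1 \<in> R \<and> (\<forall>a\<in>R. \<forall>b\<in>R. a - b \<in> R \<and> a * b \<in> R)"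

definition is_subfield :: "'a::field_char_0 set \<Rightarrow> bool" where
  "is_subfield K \<longleftrightarrow> is_subring K \<and> (\<forall>a\<in>K. inverse a \<in> K)"

text \<open>
  A polynomial over \<open>\<rat>\<close> is a finitely supported map from exponent vectors, themselves finitely
  supported maps from variable indices, to coefficients.
\<close>

type_synonym rat_mpoly = "(nat \<Rightarrow>\<^sub>0 nat) \<Rightarrow>\<^sub>0 rat"

definition mpoly_vars :: "rat_mpoly \<Rightarrow> nat set" where
  "mpoly_vars p = (\<Union>\<alpha>\<in>Poly_Mapping.keys p. Poly_Mapping.keys \<alpha>)"

definition mpoly_eval :: "(nat \<Rightarrow> 'a::field_char_0) \<Rightarrow> rat_mpoly \<Rightarrow> 'a" where
  "mpoly_eval x p =
     (\<Sum>\<alpha>\<in>Poly_Mapping.keys p.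
        of_rat (Poly_Mapping.lookup p \<alpha>) *
        (\<Prod>i\<in>Poly_Mapping.keys \<alpha>. x i ^ Poly_Mapping.lookup \<alpha> i))"

definition algebraically_independent :: "nat \<Rightarrow> (nat \<Rightarrow> 'a::field_char_0) \<Rightarrow> bool" where
  "algebraically_independent m x \<longleftrightarrow>
     (\<forall>p. mpoly_vars p \<subseteq> {1..m} \<and> mpoly_eval x p = 0 \<longrightarrow> p = 0)"

text \<open>
  A field \<open>F\<close> is a field of rational functions in \<open>m\<close> variables over \<open>\<rat>\<close> iff it possesses a free
  generating set of size \<open>m\<close>.
\<close>

definition free_generating_set :: "'a::field_char_0 set \<Rightarrow> nat \<Rightarrow> (nat \<Rightarrow> 'a) \<Rightarrow> bool" where
  "free_generating_set F m x \<longleftrightarrow>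
     algebraically_independent m x \<and> is_subfield hull (x ` {1..m}) = F"

section \<open>Seeds and cluster patterns\<close>

definition skew_symmetrizable :: "nat \<Rightarrow> int_matrix \<Rightarrow> bool" where
  "skew_symmetrizable n B \<longleftrightarrow>
     (\<exists>d :: nat \<Rightarrow> int. (\<forall>i\<in>{1..n}. d i > 0) \<and>
        (\<forall>i\<in>{1..n}. \<forall>j\<in>{1..n}. d i * B i j = - (d j * B j i)))"

type_synonym 'a seed = "(nat \<Rightarrow> 'a) \<times> int_matrix"

definition labeled_seed :: "'a::field_char_0 set \<Rightarrow> nat \<Rightarrow> nat \<Rightarrow> 'a seed \<Rightarrow> bool" where
  "labeled_seed F n m S \<longleftrightarrow>
     n \<le> m \<and> free_generating_set F m (fst S) \<and> skew_symmetrizable n (snd S)"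

definition exchanged_variable :: "nat \<Rightarrow> nat \<Rightarrow> 'a::field_char_0 seed \<Rightarrow> 'a" where
  "exchanged_variable m k S = (case S of (x, B) \<Rightarrow>
     inverse (x k) *
       ((\<Prod>i\<in>{1..m}. x i ^ nat (max (B i k) 0)) + (\<Prod>i\<in>{1..m}. x i ^ nat (max (- B i k) 0))))"

definition seed_mutation :: "nat \<Rightarrow> nat \<Rightarrow> nat \<Rightarrow> 'a::field_char_0 seed \<Rightarrow> 'a seed \<Rightarrow> bool" where
  "seed_mutation n m k S S' \<longleftrightarrow>
     matrix_agree m n (snd S') (mutate_matrix k (snd S)) \<and>
     (\<forall>i\<in>{1..m}. fst S' i = (if i = k then exchanged_variable m k S else fst S i))"

text \<open>
  The \<open>n\<close>-regular tree is realized on the words over \<open>{1..n}\<close> without two equal adjacent letters,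
  i.e. as the Cayley graph of the free product of \<open>n\<close> groups of order 2: the edge labeled \<open>k\<close>
  at a word prepends \<open>k\<close>, or removes \<open>k\<close> if it is already the first letter.
\<close>

definition tree_verts :: "nat \<Rightarrow> nat list set" where
  "tree_verts n = {t. set t \<subseteq> {1..n} \<and> distinct_adj t}"

definition tree_edge :: "nat \<Rightarrow> nat \<Rightarrow> nat list \<Rightarrow> nat list \<Rightarrow> bool" where
  "tree_edge n k t t' \<longleftrightarrow>
     t \<in> tree_verts n \<and> t' \<in> tree_verts n \<and> (t' = k # t \<or> t = k # t')"

definition cluster_pattern ::
  "'a::field_char_0 set \<Rightarrow> nat \<Rightarrow> nat \<Rightarrow> (nat list \<Rightarrow> 'a seed) \<Rightarrow> bool" where
  "cluster_pattern F n m \<Sigma> \<longleftrightarrow>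
     (\<forall>t\<in>tree_verts n. labeled_seed F n m (\<Sigma> t)) \<and>
     (\<forall>k t t'. tree_edge n k t t' \<longrightarrow> seed_mutation n m k (\<Sigma> t) (\<Sigma> t'))"

definition cluster_at :: "nat \<Rightarrow> (nat list \<Rightarrow> 'a seed) \<Rightarrow> nat list \<Rightarrow> 'a set" where
  "cluster_at n \<Sigma> t = {fst (\<Sigma> t) j | j. j \<in> {1..n}}"

definition cluster_variables :: "nat \<Rightarrow> (nat list \<Rightarrow> 'a seed) \<Rightarrow> 'a set" where
  "cluster_variables n \<Sigma> = (\<Union>t\<in>tree_verts n. cluster_at n \<Sigma> t)"

section \<open>Denominator vectors\<close>

text \<open>The ring \<open>\<int>[x\<^sub>n\<^sub>+\<^sub>1\<^sup>\<plusminus>\<^sup>1, \<dots>, x\<^sub>m\<^sup>\<plusminus>\<^sup>1]\<close>.\<close>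

definition ground_ring :: "nat \<Rightarrow> nat \<Rightarrow> (nat \<Rightarrow> 'a::field_char_0) \<Rightarrow> 'a set" where
  "ground_ring n m x = is_subring hull (x ` {n+1..m} \<union> (\<lambda>i. inverse (x i)) ` {n+1..m})"

text \<open>
  For algebraically independent \<open>x\<^sub>1, \<dots>, x\<^sub>m\<close>, evaluation identifies the polynomials in
  \<open>x\<^sub>1, \<dots>, x\<^sub>n\<close> over the ground ring with the following subring of the ambient field; the
  polynomial \<open>N\<close> and divisibility by \<open>x\<^sub>i\<close> are taken in it.
\<close>

definition polynomial_ring :: "nat \<Rightarrow> nat \<Rightarrow> (nat \<Rightarrow> 'a::field_char_0) \<Rightarrow> 'a set" where
  "polynomial_ring n m x = is_subring hull (ground_ring n m x \<union> x ` {1..n})"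

definition has_denominator_vector ::
  "nat \<Rightarrow> nat \<Rightarrow> (nat \<Rightarrow> 'a::field_char_0) \<Rightarrow> 'a \<Rightarrow> (nat \<Rightarrow> int) \<Rightarrow> bool" where
  "has_denominator_vector n m x z d \<longleftrightarrow>
     (\<exists>N\<in>polynomial_ring n m x.
        (\<forall>i\<in>{1..n}. \<not> (\<exists>M\<in>polynomial_ring n m x. N = x i * M)) \<and>
        z = N / (\<Prod>i\<in>{1..n}. x i powi d i))"

definition basis_vector :: "nat \<Rightarrow> nat \<Rightarrow> int" where
  "basis_vector i = (\<lambda>j. if j = i then 1 else 0)"

end

theory Submission
  imports Defs
begin

text \<open>
  The cluster pattern is modelled on the triangulations of a polygon with vertices \<open>0, \<dots>, n+2\<close>:
  the labels are the diagonals of a triangulation, mutations are flips. For a linear initial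
  quiver the triangulation is a fan, and there one writes down lambda lengths \<open>P\<close> satisfying the
  Ptolemy relations together with a tropical solution \<open>w r\<close> of the Ptolemy relations for every
  coefficient row \<open>r\<close>, such that the rows of the extended exchange matrix are the shear coordinates
  of the \<open>w r\<close>. Both solutions are global functions of the diagonal, so following the flips
  shows that the cluster variable at a diagonal \<open>e\<close> is \<open>P e\<close> divided by a coefficient monomial,
  independently of the seed.

  For a given seed, expanding \<open>P e\<close> by the Ptolemy relation at any crossed diagonal of the
  triangulation yields a subtraction-free Laurent expression whose denominator exponents satisfy
  the tropical Ptolemy relation, hence are the crossing numbers. The sets of diagonals crossed by
  an arc are precisely the chains of the quiver: the arc is recovered by extending a chain
  triangle by triangle.
\<close>

section \<open>Cyclic order and triangulations of a polygon\<close>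

text \<open>The matrix \<open>B0\<close> is known only through a sequence of mutations, so no
  triangulation for it is at hand. Mutation being an involution, the sequence is run backwards in
  the tree to a seed with linear matrix; the model is set up there and flips carry it to
  \<open>t0\<close>. A fan with n diagonals needs n + 3 vertices. Arbitrary frozen rows are one
  obstacle: lambda lengths alone carry no coefficients. Shears of a tropical solution change under a
  flip exactly as matrix entries do under mutation. A principal row fits the same scheme with the
  indicator of its own diagonal as the solution, except that the indicators of the two exchanged
  diagonals violate the tropical relation at that flip; that row is treated by itself. The other
  obstacle is cancellation: the denominator of a sum need not be the maximum of the denominators.
  Positivity of the numerator at \<open>x i = 0\<close> with all other variables 1 excludes this,
  and it yields non-divisibility and uniqueness of the exponents without unique
  factorization.\<close>

definition cyc :: "nat \<Rightarrow> nat \<Rightarrow> nat \<Rightarrow> bool" where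
  "cyc a b c \<longleftrightarrow> a < b \<and> b < c \<or> b < c \<and> c < a \<or> c < a \<and> a < b"

text \<open>Two chords of a convex polygon meeting in their interiors; chords with a common endpoint
  are never separated.\<close>

definition sep :: "nat \<Rightarrow> nat \<Rightarrow> nat \<Rightarrow> nat \<Rightarrow> bool" where
  "sep p q a b \<longleftrightarrow> cyc p a q \<and> cyc q b p \<or> cyc p b q \<and> cyc q a p"

text \<open>Only the relative order of vertices matters, so the positional facts
  \<open>ord_...\<close> about up to eight points become statements of linear real arithmetic,
  decided there by exhausting the possible orders.\<close>

lemma cyc_real:
  "cyc a b c \<longleftrightarrow> real a < real b \<and> real b < real c \<or> real b < real c \<and> real c < real a
    \<or> real c < real a \<and> real a < real b"
  by (simp add: cyc_def)

lemma eq_real: "a = b \<longleftrightarrow> real a = real b"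
  by simp

lemma cyc_rotate: "cyc a b c \<longleftrightarrow> cyc b c a"
  by (auto simp: cyc_def)

lemma cyc_distinct: "cyc a b c \<Longrightarrow> a \<noteq> b \<and> b \<noteq> c \<and> a \<noteq> c"
  by (auto simp: cyc_def)

lemma cyc_asym: "cyc a b c \<Longrightarrow> \<not> cyc c b a"
  by (auto simp: cyc_def)

lemma cyc_cases: "a \<noteq> b \<Longrightarrow> b \<noteq> c \<Longrightarrow> a \<noteq> c \<Longrightarrow> cyc a b c \<or> cyc c b a"
  by (auto simp: cyc_def)

lemma cyc_trans_left: "cyc a b c \<Longrightarrow> cyc b d c \<Longrightarrow> cyc a d c"
  unfolding cyc_real eq_real by (smt (verit))

lemma cyc_opposite: "cyc a b c \<Longrightarrow> cyc c d a \<Longrightarrow> b \<noteq> d"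
  using cyc_asym cyc_rotate by blast

lemma sep_flip: "sep p q b a \<longleftrightarrow> sep p q a b"
  unfolding sep_def cyc_real eq_real by (smt (verit))

lemma sep_flip': "sep q p a b \<longleftrightarrow> sep p q a b"
  unfolding sep_def cyc_real eq_real by (smt (verit))

lemma sep_sym: "sep a b p q \<longleftrightarrow> sep p q a b"
  unfolding sep_def cyc_real eq_real by (smt (verit))

lemma sep_distinct: "sep p q a b \<Longrightarrow> p \<noteq> q \<and> p \<noteq> a \<and> p \<noteq> b \<and> q \<noteq> a \<and> q \<noteq> b \<and> a \<noteq> b"
  unfolding sep_def cyc_real eq_real by (smt (verit))

definition crossing :: "nat set \<Rightarrow> nat set \<Rightarrow> bool" where
  "crossing e f \<longleftrightarrow> (\<exists>p q a b. e = {p,q} \<and> f = {a,b} \<and> sep p q a b)"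

lemma crossing_iff [simp]: "crossing {p,q} {a,b} \<longleftrightarrow> sep p q a b"
  unfolding crossing_def by (auto simp: doubleton_eq_iff sep_flip sep_flip')

lemma sep_cong: "{p,q} = {a,c} \<Longrightarrow> sep p q x y \<longleftrightarrow> sep a c x y"
  unfolding crossing_iff[symmetric] by (simp del: crossing_iff)

definition edges :: "nat \<Rightarrow> nat set set" where
  "edges N = {{p,q} |p q. p \<noteq> q \<and> p \<le> N \<and> q \<le> N}"

lemma edges_iff [simp]: "{p,q} \<in> edges N \<longleftrightarrow> p \<noteq> q \<and> p \<le> N \<and> q \<le> N"
  unfolding edges_def by (auto simp: doubleton_eq_iff)

definition boundary :: "nat \<Rightarrow> nat set set" where
  "boundary N = insert {0,N} ((\<lambda>i. {i, Suc i}) ` {..<N})"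

text \<open>The orientation fixes the sign of the shear. A diagonal determines the tuple up to the
  half turn \<open>c d a b\<close>. The flip replaces \<open>{a,c}\<close> by
  \<open>{b,d}\<close>.\<close>

definition quad :: "nat set set \<Rightarrow> nat \<Rightarrow> nat \<Rightarrow> nat \<Rightarrow> nat \<Rightarrow> bool" where
  "quad E a b c d \<longleftrightarrow> cyc a b c \<and> cyc c d a \<and>
     {a,b} \<in> E \<and> {b,c} \<in> E \<and> {c,d} \<in> E \<and> {d,a} \<in> E \<and> {a,c} \<in> E"

lemma not_boundaryE:
  assumes "e \<in> edges N - boundary N"
  obtains p q x y where "e = {p,q}" "p \<le> N" "q \<le> N" "x \<le> N" "y \<le> N" "cyc p x q" "cyc q y p"
proof -
  obtain p q where e: "e = {p,q}" "p < q" "q \<le> N"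
  proof -
    obtain p q where "e = {p,q}" "p \<noteq> q" "p \<le> N" "q \<le> N"
      using assms unfolding edges_def by auto
    then show thesis using that[of p q] that[of q p] by (cases "p < q") (auto simp: insert_commute)
  qed
  have 1: "Suc p < q"
  proof (rule ccontr)
    assume "\<not> Suc p < q"
    then have "q = Suc p" "p < N" using e by auto
    then show False using assms e by (auto simp: boundary_def)
  qed
  have 2: "q < N \<or> 0 < p"
  proof (rule ccontr)
    assume "\<not> (q < N \<or> 0 < p)"
    then have "q = N" "p = 0" using e by auto
    then show False using assms e by (auto simp: boundary_def)
  qed
  show ?thesis
  proof (cases "q < N")
    case True
    then show ?thesis using that[of p q "Suc p" N] e 1 by (auto simp: cyc_def)
  next
    case False
    then show ?thesis using that[of p q "Suc p" 0] e 1 2 by (auto simp: cyc_def)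
  qed
qed

lemma ord_arc:
  "cyc p y q \<Longrightarrow> cyc y a q \<Longrightarrow> cyc q b y \<Longrightarrow> \<not> sep p q a b \<Longrightarrow> \<not> sep p y a b \<Longrightarrow> b = p \<and> cyc p a q"
  unfolding sep_def cyc_real eq_real by (smt (verit))

lemma ord_tri_unique:
  "cyc p y q \<Longrightarrow> cyc p y' q \<Longrightarrow> \<not> sep p y' y q \<Longrightarrow> \<not> sep p y y' q \<Longrightarrow> y = y'"
  unfolding sep_def cyc_real eq_real by (smt (verit))

lemma ord_flip_max: 
  "cyc a b c \<Longrightarrow> cyc c d a \<Longrightarrow> sep p q a c \<Longrightarrow> \<not> sep p q a b \<Longrightarrow> \<not> sep p q b c \<Longrightarrow> \<not> sep p q c d
   \<Longrightarrow> \<not> sep p q d a \<Longrightarrow> p = b \<and> q = d \<or> p = d \<and> q = b"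
  unfolding sep_def cyc_real eq_real by (smt (verit))

lemma ord_flip_nc:
  "cyc a b c \<Longrightarrow> cyc c d a \<Longrightarrow> \<not> sep p q a b \<Longrightarrow> \<not> sep p q b c \<Longrightarrow> \<not> sep p q c d
   \<Longrightarrow> \<not> sep p q d a \<Longrightarrow> sep p q b d \<Longrightarrow> p = a \<and> q = c \<or> p = c \<and> q = a"
  unfolding sep_def cyc_real eq_real by (smt (verit))

text \<open>Nothing crosses a side of the polygon, so maximality forces the sides into
  \<open>E\<close>. Maximality, rather than a count of the diagonals, is what supplies the missing
  sides of triangles.\<close>

locale triangulation =
  fixes N :: nat and E :: "nat set set"
  assumes edge: "{p,q} \<in> E \<Longrightarrow> p \<noteq> q \<and> p \<le> N \<and> q \<le> N"
    and doubleton: "e \<in> E \<Longrightarrow> \<exists>p q. e = {p,q}"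
    and not_sep: "{p,q} \<in> E \<Longrightarrow> {a,b} \<in> E \<Longrightarrow> \<not> sep p q a b"
    and maximal: "p \<noteq> q \<Longrightarrow> p \<le> N \<Longrightarrow> q \<le> N \<Longrightarrow> (\<And>a b. {a,b} \<in> E \<Longrightarrow> \<not> sep p q a b) \<Longrightarrow> {p,q} \<in> E"
begin

lemma edge_sym: "{p,q} \<in> E \<Longrightarrow> {q,p} \<in> E"
  by (simp add: insert_commute)

lemma edges_subset: "E \<subseteq> edges N"
proof
  fix e assume e: "e \<in> E"
  then obtain p q where "e = {p,q}" using doubleton by blast
  with e edge show "e \<in> edges N" by simp
qed

lemma boundary_subset: "0 < N \<Longrightarrow> boundary N \<subseteq> E"
proof
  fix e assume "0 < N" "e \<in> boundary N"
  then obtain p q where e: "e = {p,q}" "p < q" "q \<le> N" "q = Suc p \<or> p = 0 \<and> q = N"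
    unfolding boundary_def by auto
  show "e \<in> E" unfolding e(1)
  proof (rule maximal)
    fix a b assume "{a,b} \<in> E"
    from edge[OF this] e show "\<not> sep p q a b" unfolding sep_def cyc_def by auto
  qed (use e in auto)
qed

text \<open>Used to find triangles at \<open>p\<close>. The successor of \<open>p\<close> is a
  neighbour, so there is one with the fewest vertices between it and \<open>q\<close>.\<close>

lemma last_neighbour:
  assumes "p \<le> N" "q \<le> N" "cyc p x q" "x \<le> N"
  obtains y where "cyc p y q" "{p,y} \<in> E" "\<And>z. {p,z} \<in> E \<Longrightarrow> cyc p z q \<Longrightarrow> \<not> cyc y z q"
proof -
  define s where "s = (if p = N then 0 else Suc p)"
  have sc: "cyc p s q"
    using assms unfolding s_def cyc_def by auto
  have N: "0 < N" using assms by (auto simp: cyc_def)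
  have sE: "{p,s} \<in> E"
    using boundary_subset[OF N] assms unfolding s_def boundary_def by (auto simp: insert_commute)
  define g where "g y = card {z. z \<le> N \<and> cyc y z q}" for y
  obtain y where y: "cyc p y q" "{p,y} \<in> E" and
    ymin: "\<And>z. cyc p z q \<Longrightarrow> {p,z} \<in> E \<Longrightarrow> g y \<le> g z"
    using ex_has_least_nat[of "\<lambda>y. cyc p y q \<and> {p,y} \<in> E" s g] sc sE by auto
  show ?thesis
  proof (rule that[OF y])
    fix z assume z: "{p,z} \<in> E" "cyc p z q"
    show "\<not> cyc y z q"
    proof
      assume yz: "cyc y z q"
      have "{w. w \<le> N \<and> cyc z w q} \<subset> {w. w \<le> N \<and> cyc y w q}"
        using cyc_trans_left[OF yz] yz edge[OF z(1)] cyc_distinct by blast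
      then have "g z < g y" unfolding g_def by (intro psubset_card_mono) auto
      with ymin[OF z(2,1)] show False by simp
    qed
  qed
qed

text \<open>The apex is the last neighbour \<open>y\<close> of \<open>p\<close> before
  \<open>q\<close>. A chord of \<open>E\<close> crossing \<open>{y,q}\<close> crosses neither
  \<open>{p,q}\<close> nor \<open>{p,y}\<close>, so it ends at \<open>p\<close> and gives a later
  neighbour. Hence maximality puts \<open>{y,q}\<close> into \<open>E\<close>.\<close>

lemma triangle_exists:
  assumes pq: "{p,q} \<in> E" and x: "cyc p x q" "x \<le> N"
  obtains y where "y \<le> N" "cyc p y q" "{p,y} \<in> E" "{y,q} \<in> E"
proof -
  have pN: "p \<le> N" "q \<le> N" using edge[OF pq] by auto
  obtain y where y: "cyc p y q" "{p,y} \<in> E" and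
    last: "\<And>z. {p,z} \<in> E \<Longrightarrow> cyc p z q \<Longrightarrow> \<not> cyc y z q"
    using last_neighbour[OF pN x] by metis
  have yq: "{y,q} \<in> E"
  proof (rule maximal)
    show "y \<noteq> q" "y \<le> N" "q \<le> N" using y edge[OF y(2)] pN cyc_distinct by auto
    fix a b assume ab: "{a,b} \<in> E"
    have *: False if "cyc y a q" "cyc q b y" "{a,b} \<in> E" for a b
      using ord_arc[OF y(1) that(1,2) not_sep[OF pq that(3)] not_sep[OF y(2) that(3)]] last that
      by (auto simp: insert_commute)
    show "\<not> sep y q a b"
      using *[of a b] *[of b a] ab unfolding sep_def by (auto simp: insert_commute)
  qed
  show ?thesis using that[OF _ y yq] edge[OF y(2)] by auto
qed

lemma triangle_unique:
  assumes "{p,y} \<in> E" "{y,q} \<in> E" "{p,y'} \<in> E" "{y',q} \<in> E" "cyc p y q" "cyc p y' q"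
  shows "y = y'"
  using ord_tri_unique[OF assms(5,6) not_sep[OF assms(3,2)] not_sep[OF assms(1,4)]] .

lemma quad_exists:
  assumes "e \<in> E" "e \<notin> boundary N"
  obtains a b c d where "e = {a,c}" "quad E a b c d"
proof -
  have "e \<in> edges N - boundary N" using assms edges_subset by auto
  then obtain p q x y where e: "e = {p,q}" "x \<le> N" "y \<le> N" "cyc p x q" "cyc q y p"
    by (rule not_boundaryE)
  from assms e have pq: "{p,q} \<in> E" by simp
  obtain b where "cyc p b q" "{p,b} \<in> E" "{b,q} \<in> E"
    using triangle_exists[OF pq e(4,2)] by metis
  moreover obtain d where "cyc q d p" "{q,d} \<in> E" "{d,p} \<in> E"
    using triangle_exists[OF edge_sym[OF pq] e(5,3)] by metis
  ultimately show ?thesis using that[of p q b d] e pq by (simp add: quad_def)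
qed

lemma quad_unique:
  assumes "quad E a b c d" "quad E a' b' c' d'" "{a,c} = {a',c'}"
  shows "a' = a \<and> b' = b \<and> c' = c \<and> d' = d \<or> a' = c \<and> b' = d \<and> c' = a \<and> d' = b"
proof -
  have *: "b' = b \<and> d' = d" if "quad E a b c d" "quad E a b' c d'" for a b c d b' d'
    using that triangle_unique[of a b c b'] triangle_unique[of c d a d'] unfolding quad_def by blast
  have r: "quad E a b c d \<Longrightarrow> quad E c d a b" for a b c d
    unfolding quad_def by (auto simp: insert_commute)
  from assms(3) consider "a' = a" "c' = c" | "a' = c" "c' = a"
    by (auto simp: doubleton_eq_iff)
  then show ?thesis
  proof cases
    case 1
    with assms(2) have "quad E a b' c d'" by simp
    from *[OF assms(1) this] 1 show ?thesis by simp
  next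
    case 2
    with assms(2) have "quad E a d' c b'" using r[of c b' a d'] by simp
    from *[OF assms(1) this] 2 show ?thesis by simp
  qed
qed

text \<open>Maximality of the new set: a chord that crosses \<open>{a,c}\<close> but no side of the
  quadrilateral can only be \<open>{b,d}\<close>. A chord that does not cross \<open>{a,c}\<close>
  is in \<open>E\<close> by the old maximality, and it is not \<open>{a,c}\<close>, which crosses
  \<open>{b,d}\<close>.\<close>

lemma flip:
  assumes q: "quad E a b c d"
  shows "triangulation N (insert {b,d} (E - {{a,c}}))"
proof -
  let ?E = "insert {b,d} (E - {{a,c}})"
  have cy: "cyc a b c" "cyc c d a" and
    ed: "{a,b} \<in> E" "{b,c} \<in> E" "{c,d} \<in> E" "{d,a} \<in> E" "{a,c} \<in> E"
    using q unfolding quad_def by simp_all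
  have dist: "a \<noteq> b" "b \<noteq> c" "c \<noteq> d" "d \<noteq> a" "a \<noteq> c" "b \<noteq> d"
    using cyc_distinct[OF cy(1)] cyc_distinct[OF cy(2)] cyc_opposite[OF cy] by auto
  have "{a,b} \<noteq> {a,c}" "{b,c} \<noteq> {a,c}" "{c,d} \<noteq> {a,c}" "{d,a} \<noteq> {a,c}"
    using dist by (simp_all add: doubleton_eq_iff)
  then have ed': "{a,b} \<in> ?E" "{b,c} \<in> ?E" "{c,d} \<in> ?E" "{d,a} \<in> ?E" "{b,d} \<in> ?E"
    using ed by simp_all
  have ns: "\<not> sep p q b d" if pq: "{p,q} \<in> E" "{p,q} \<noteq> {a,c}" for p q
    using ord_flip_nc[OF cy not_sep[OF pq(1) ed(1)] not_sep[OF pq(1) ed(2)] not_sep[OF pq(1) ed(3)] not_sep[OF pq(1) ed(4)]]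
      pq(2) by (auto simp: insert_commute)
  show ?thesis
  proof (rule triangulation.intro)
    fix p q assume "{p,q} \<in> ?E"
    then show "p \<noteq> q \<and> p \<le> N \<and> q \<le> N"
      using edge[of p q] edge[OF ed(1)] edge[OF ed(3)] dist by (auto simp: doubleton_eq_iff)
  next
    fix e assume "e \<in> ?E" then show "\<exists>p q. e = {p,q}" using doubleton by auto
  next
    fix p q a' b' assume "{p,q} \<in> ?E" "{a',b'} \<in> ?E"
    then consider "{p,q} \<in> E" "{a',b'} \<in> E" | "{p,q} \<in> E" "{p,q} \<noteq> {a,c}" "{a',b'} = {b,d}"
      | "{a',b'} \<in> E" "{a',b'} \<noteq> {a,c}" "{p,q} = {b,d}" | "{p,q} = {b,d}" "{a',b'} = {b,d}"
      unfolding insert_iff Diff_iff singleton_iff by metis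
    then have "\<not> crossing {p,q} {a',b'}"
    proof cases
      case 1 then show ?thesis using not_sep by simp
    next
      case 2 then show ?thesis using ns by (simp only: crossing_iff not_False_eq_True)
    next
      case 3 then show ?thesis using ns[of a' b'] sep_sym[of a' b' b d] by (simp only: crossing_iff not_False_eq_True)
    next
      case 4 then show ?thesis using sep_distinct[of b d b d] by (metis crossing_iff)
    qed
    then show "\<not> sep p q a' b'" by simp
  next
    fix p q assume pq: "p \<noteq> q" "p \<le> N" "q \<le> N" and H: "\<And>a b. {a,b} \<in> ?E \<Longrightarrow> \<not> sep p q a b"
    have *: "\<not> sep p q a b" "\<not> sep p q b c" "\<not> sep p q c d" "\<not> sep p q d a" "\<not> sep p q b d"
      using H[OF ed'(1)] H[OF ed'(2)] H[OF ed'(3)] H[OF ed'(4)] H[OF ed'(5)] .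
    show "{p,q} \<in> ?E"
    proof (cases "sep p q a c")
      case True
      from ord_flip_max[OF cy True *(1-4)] have "{p,q} = {b,d}" by blast
      then show ?thesis by simp
    next
      case False
      have "{p,q} \<in> E"
      proof (rule maximal[OF pq])
        fix a' b' assume "{a',b'} \<in> E"
        then consider "{a',b'} \<in> ?E" | "{a',b'} = {a,c}" by blast
        then show "\<not> sep p q a' b'"
        proof cases
          case 1 then show ?thesis by (rule H)
        next
          case 2 then show ?thesis using False crossing_iff[of p q a' b'] crossing_iff[of p q a c] by simp
        qed
      qed
      moreover have "sep a c b d" using cy by (simp add: sep_def)
      then have "{p,q} \<noteq> {a,c}"
        using *(5) sep_cong[of p q a c b d] by blast
      ultimately show ?thesis by simp
    qed
  qed
qed

end

section \<open>Arcs and chains\<close>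

lemma ord_step1: "sep a b p c \<Longrightarrow> sep b c a q \<Longrightarrow> sep a b p q"
  unfolding sep_def cyc_real eq_real by (smt (verit))

lemma ord_step2: "sep a b p c \<Longrightarrow> sep b c a q \<Longrightarrow> sep u v a q \<Longrightarrow> \<not> sep u v a b \<Longrightarrow> \<not> sep u v a p \<Longrightarrow> \<not> sep u v p b \<Longrightarrow> sep u v p q"
  unfolding sep_def cyc_real eq_real by (smt (verit))

lemma ord_step3: "sep a b p c \<Longrightarrow> sep b c a q \<Longrightarrow> sep u v p q \<Longrightarrow> \<not> sep u v a b \<Longrightarrow> \<not> sep u v a p \<Longrightarrow> \<not> sep u v p b
  \<Longrightarrow> \<not> sep u v b c \<Longrightarrow> \<not> sep u v c a \<Longrightarrow> u = a \<and> v = b \<or> u = b \<and> v = a \<or> sep u v a q"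
  unfolding sep_def cyc_real eq_real by (smt (verit))

lemma ord_base: "sep a b p q \<Longrightarrow> sep u v p q \<Longrightarrow> \<not> sep u v a p \<Longrightarrow> \<not> sep u v p b \<Longrightarrow> \<not> sep u v b q \<Longrightarrow> \<not> sep u v q a
  \<Longrightarrow> u = a \<and> v = b \<or> u = b \<and> v = a"
  unfolding sep_def cyc_real eq_real by (smt (verit))

lemma ord_next: "sep a b p q \<Longrightarrow> sep a b p c \<Longrightarrow> c \<noteq> q \<Longrightarrow> sep b c a q \<or> sep a c b q"
  unfolding sep_def cyc_real eq_real by (smt (verit))

lemma ord_first: "cyc p a q \<Longrightarrow> cyc a b p \<Longrightarrow> b \<noteq> q \<Longrightarrow> \<not> cyc a b q \<Longrightarrow> sep a b p q"
  unfolding sep_def cyc_real eq_real by (smt (verit))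

lemma ord_first_unique: "sep u v a q \<Longrightarrow> sep b c a q \<Longrightarrow> \<not> sep a u b c \<Longrightarrow> \<not> sep a v b c \<Longrightarrow> \<not> sep a b u v \<Longrightarrow> \<not> sep a c u v
  \<Longrightarrow> u = b \<and> v = c \<or> u = c \<and> v = b"
  unfolding sep_def cyc_real eq_real by (smt (verit))

lemma ord_inj1: "sep u v p q \<Longrightarrow> sep u v p' q' \<Longrightarrow> sep a b p q \<Longrightarrow> sep a b p' q' \<Longrightarrow> \<not> sep a b p p' \<Longrightarrow> \<not> sep u v a b \<Longrightarrow> sep u v p q'"
  unfolding sep_def cyc_real eq_real by (smt (verit))

lemma ord_inj2: "sep u v p q' \<Longrightarrow> \<not> sep u v p q \<Longrightarrow> \<not> sep u v p' q' \<Longrightarrow> sep a b p q \<Longrightarrow> sep a b p' q' \<Longrightarrow> \<not> sep a b p p' \<Longrightarrow> sep u v a b"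
  unfolding sep_def cyc_real eq_real by (smt (verit))

lemma ord_inj3: "sep a b p q \<Longrightarrow> sep a b p' q' \<Longrightarrow> sep a b p p' \<Longrightarrow> \<not> sep a b p q'"
  unfolding sep_def cyc_real eq_real by (smt (verit))

lemma ord_inj4: "sep u v q q' \<Longrightarrow> p \<noteq> q \<Longrightarrow> p \<noteq> q' \<Longrightarrow> sep u v p q \<noteq> sep u v p q' \<or> p = u \<or> p = v"
  unfolding sep_def cyc_real eq_real by (smt (verit))

lemma ord_inj5: "sep p v q q' \<Longrightarrow> sep a b p q \<Longrightarrow> sep a b p q' \<Longrightarrow> sep p v a b"
  unfolding sep_def cyc_real eq_real by (smt (verit))

lemma ord_inj6: "cyc p q q' \<Longrightarrow> cyc q' r q \<Longrightarrow> r = p \<or> sep r q' p q \<or> sep r q p q'"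
  unfolding sep_def cyc_real eq_real by (smt (verit))

text \<open>An induced path for \<open>A\<close>. Testing all pairs of positions includes symmetry
  and absence of loops along the list.\<close>

definition chain_list :: "('b \<Rightarrow> 'b \<Rightarrow> bool) \<Rightarrow> 'b list \<Rightarrow> bool" where
  "chain_list A vs \<longleftrightarrow> distinct vs \<and>
     (\<forall>i<length vs. \<forall>j<length vs. A (vs ! i) (vs ! j) \<longleftrightarrow> j = i + 1 \<or> i = j + 1)"

lemma chain_list_single: "\<not> A e e \<Longrightarrow> chain_list A [e]"
  by (simp add: chain_list_def)

lemma chain_list_Cons:
  assumes "chain_list A (f # es)" "e \<notin> set (f # es)" "\<not> A e e" "A e f" "A f e"
    "\<And>g. g \<in> set es \<Longrightarrow> \<not> A e g \<and> \<not> A g e"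
  shows "chain_list A (e # f # es)"
  unfolding chain_list_def
proof (intro conjI allI impI)
  show "distinct (e # f # es)" using assms(1,2) by (simp add: chain_list_def)
  fix i j assume ij: "i < length (e # f # es)" "j < length (e # f # es)"
  have *: "A e ((f # es) ! k) \<longleftrightarrow> k = 0" "A ((f # es) ! k) e \<longleftrightarrow> k = 0" if "k < length (f # es)" for k
    using that assms(4-6) by (cases k; simp)+
  show "A ((e # f # es) ! i) ((e # f # es) ! j) \<longleftrightarrow> j = i + 1 \<or> i = j + 1"
  proof (cases i)
    case 0
    then show ?thesis using *(1)[of "j - 1"] ij assms(3) by (cases j) auto
  next
    case i: (Suc i')
    show ?thesis
    proof (cases j)
      case 0
      then show ?thesis using *(2)[of i'] ij i by auto
    next
      case (Suc j')
      then show ?thesis using assms(1) ij i unfolding chain_list_def by auto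
    qed
  qed
qed

lemma chain_list_ConsD:
  assumes "chain_list A (e # es)"
  shows "chain_list A es" "e \<notin> set es" "es = f # gs \<Longrightarrow> A e f" "es = f # gs \<Longrightarrow> g \<in> set gs \<Longrightarrow> \<not> A e g"
proof -
  have A: "A ((e # es) ! i) ((e # es) ! j) \<longleftrightarrow> j = i + 1 \<or> i = j + 1" if "i < length (e # es)" "j < length (e # es)" for i j
    using assms that unfolding chain_list_def by blast
  show "e \<notin> set es" using assms by (simp add: chain_list_def)
  show "chain_list A es" unfolding chain_list_def
  proof (intro conjI allI impI)
    show "distinct es" using assms by (simp add: chain_list_def)
    fix i j assume "i < length es" "j < length es"
    then show "A (es ! i) (es ! j) \<longleftrightarrow> j = i + 1 \<or> i = j + 1" using A[of "Suc i" "Suc j"] by simp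
  qed
  show "es = f # gs \<Longrightarrow> A e f" using A[of 0 1] by simp
  assume es: "es = f # gs" and "g \<in> set gs"
  then obtain k where "k < length gs" "gs ! k = g" by (auto simp: in_set_conv_nth)
  then show "\<not> A e g" using A[of 0 "Suc (Suc k)"] es by simp
qed

section \<open>The diagonals crossed by an arc, in order\<close>

context triangulation
begin

definition crossed :: "nat \<Rightarrow> nat \<Rightarrow> nat set set" where
  "crossed p q = {e \<in> E. crossing e {p,q}}"

lemma crossed_iff: "{u,v} \<in> crossed p q \<longleftrightarrow> {u,v} \<in> E \<and> sep u v p q"
  by (simp add: crossed_def)

lemma crossed_sym: "crossed q p = crossed p q"
  by (simp add: crossed_def insert_commute)

lemma crossed_eqI:
  assumes "\<And>u v. {u,v} \<in> E \<Longrightarrow> sep u v p q \<longleftrightarrow> sep u v p' q'"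
  shows "crossed p q = crossed p' q'"
  unfolding crossed_def using assms doubleton crossing_iff by (metis (no_types, lifting) Collect_cong)

lemma finite_E: "finite E"
  using edges_subset
proof (rule finite_subset)
  have "edges N \<subseteq> Pow {..N}" unfolding edges_def by auto
  then show "finite (edges N)" by (rule finite_subset) simp
qed

lemma finite_crossed: "finite (crossed p q)"
  using finite_E by (simp add: crossed_def)

text \<open>Two sides of a common triangle. This is the geometric form of a nonzero entry of the
  exchange matrix.\<close>

definition adj :: "nat set \<Rightarrow> nat set \<Rightarrow> bool" where
  "adj e f \<longleftrightarrow> e \<in> E \<and> f \<in> E \<and> (\<exists>a b c. e = {a,b} \<and> f = {b,c} \<and> {a,c} \<in> E)"

lemma adj_sym: "adj e f \<Longrightarrow> adj f e"
  unfolding adj_def by (metis insert_commute)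

lemma adj_irrefl: "\<not> adj e e"
  unfolding adj_def using edge by (metis doubleton_eq_iff)

text \<open>The two triangles at \<open>{a,b}\<close>, as in \<open>quad\<close> but unoriented: an
  arc may cross the diagonal in either direction.\<close>

definition wings :: "nat \<Rightarrow> nat \<Rightarrow> nat \<Rightarrow> nat \<Rightarrow> bool" where
  "wings a b p c \<longleftrightarrow> {a,b} \<in> E \<and> {a,p} \<in> E \<and> {p,b} \<in> E \<and> {b,c} \<in> E \<and> {c,a} \<in> E \<and> sep a b p c"

lemma wings_sym: "wings a b p c \<Longrightarrow> wings a b c p"
  unfolding wings_def by (simp add: insert_commute sep_flip)

lemma wings_flip: "wings a b p c \<Longrightarrow> wings b a p c"
  unfolding wings_def by (simp add: insert_commute sep_flip')

lemma quad_wings: "quad E a b c d \<Longrightarrow> wings a c b d"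
  unfolding wings_def quad_def by (simp add: insert_commute sep_def)

text \<open>Three pairwise joined vertices always bound a triangle of the triangulation, and there
  is only one on each side of \<open>{a,b}\<close>.\<close>

lemma wings_apex:
  assumes w: "wings a b p c" and z: "{a,z} \<in> E" "{z,b} \<in> E"
  shows "z = p \<or> z = c"
proof -
  have *: "z = p \<or> z = c" if "wings a b p c" "{a,z} \<in> E" "{z,b} \<in> E" "cyc a z b" for a b
  proof -
    have "{a,p} \<in> E" "{p,b} \<in> E" "{a,c} \<in> E" "{c,b} \<in> E" "cyc a p b \<or> cyc a c b"
      using that(1) unfolding wings_def by (simp_all add: insert_commute sep_def) blast
    then show ?thesis using triangle_unique[of a z b p] triangle_unique[of a z b c] that(2-4) by blast
  qed
  have "a \<noteq> z" "z \<noteq> b" "a \<noteq> b" using z edge w unfolding wings_def by blast+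
  then have "cyc a z b \<or> cyc b z a" using cyc_cases by blast
  then show ?thesis
    using *[OF w z] *[OF wings_flip[OF w] edge_sym[OF z(2)] edge_sym[OF z(1)]] by blast
qed

text \<open>\<open>dpath p q es\<close>: the arc from \<open>p\<close> to \<open>q\<close> crosses the diagonals \<open>es\<close> in this order. The step rule
  moves the start of the arc from \<open>a\<close> to the apex \<open>p\<close> beyond the diagonal \<open>{a,b}\<close>.\<close>

inductive dpath :: "nat \<Rightarrow> nat \<Rightarrow> nat set list \<Rightarrow> bool" where
  base: "wings a b p q \<Longrightarrow> dpath p q [{a,b}]"
| step: "dpath a q ({b,c} # es) \<Longrightarrow> wings a b p c \<Longrightarrow> dpath p q ({a,b} # {b,c} # es)"

lemma crossed_base:
  assumes w: "wings a b p q"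
  shows "crossed p q = {{a,b}}"
proof -
  have "e = {a,b}" if "e \<in> crossed p q" for e
  proof -
    have "e \<in> E" using that by (simp add: crossed_def)
    then obtain u v where e: "e = {u,v}" using doubleton by blast
    with that have uv: "{u,v} \<in> E" "sep u v p q" by (auto simp: crossed_iff)
    show ?thesis
      using ord_base[of a b p q u v] w uv not_sep[OF uv(1)] e unfolding wings_def by auto
  qed
  moreover have "{a,b} \<in> crossed p q" using w by (simp add: crossed_iff wings_def)
  ultimately show ?thesis by blast
qed

text \<open>The start of the arc moves from \<open>a\<close> to \<open>p\<close>. No edge of
  \<open>E\<close> enters the triangles \<open>a b p\<close> and \<open>a b c\<close>, so the only
  change is that \<open>{a,b}\<close> becomes crossed.\<close>

lemma crossed_step:
  assumes w: "wings a b p c" and s: "sep b c a q"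
  shows "crossed p q = insert {a,b} (crossed a q)" "{a,b} \<notin> crossed a q"
proof -
  show "{a,b} \<notin> crossed a q" unfolding crossed_iff using sep_distinct by blast
  have ab: "{a,b} \<in> crossed p q"
    using w s ord_step1 unfolding crossed_iff wings_def by blast
  have "e \<in> crossed p q \<longleftrightarrow> e \<in> insert {a,b} (crossed a q)" for e
  proof (cases "e \<in> E")
    case True
    then obtain u v where e: "e = {u,v}" using doubleton by blast
    with True have uv: "{u,v} \<in> E" by simp
    have ns: "\<not> sep u v a b" "\<not> sep u v a p" "\<not> sep u v p b" "\<not> sep u v b c" "\<not> sep u v c a"
      using w not_sep[OF uv] unfolding wings_def by blast+
    have sw: "sep a b p c" using w by (simp add: wings_def)
    have 1: "sep u v a q \<Longrightarrow> sep u v p q" using ord_step2[OF sw s _ ns(1-3)] .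
    have 2: "sep u v p q \<Longrightarrow> {u,v} = {a,b} \<or> sep u v a q" using ord_step3[OF sw s _ ns] by blast
    show ?thesis using 1 2 ab uv sep_cong[of u v a b p q] unfolding e insert_iff crossed_iff by blast
  next
    case False
    then show ?thesis using ab by (auto simp: crossed_def)
  qed
  then show "crossed p q = insert {a,b} (crossed a q)" by blast
qed

lemma dpath_crossed: "dpath p q vs \<Longrightarrow> set vs = crossed p q"
proof (induction rule: dpath.induct)
  case (base a b p q)
  then show ?case using crossed_base by simp
next
  case (step a q b c es p)
  then have "sep b c a q" using crossed_iff by (metis list.set_intros(1))
  from crossed_step(1)[OF step(2) this] step(3) show ?case by simp
qed

lemma dpath_chain: "dpath p q vs \<Longrightarrow> chain_list adj vs"
proof (induction rule: dpath.induct)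
  case (base a b p q)
  show ?case by (intro chain_list_single adj_irrefl)
next
  case (step a q b c es p)
  note set = dpath_crossed[OF step(1)]
  have s: "sep b c a q" using set crossed_iff by (metis list.set_intros(1))
  note cr = crossed_step[OF step(2) s]
  have ab: "adj {a,b} {b,c}" using step(2) unfolding adj_def wings_def by (metis insert_commute)
  \<comment> \<open>An edge adjacent to \<open>{a,b}\<close> is a side of one of its two triangles.
    A side at \<open>a\<close> is not crossed by the arc from \<open>a\<close>, and
    \<open>{b,p}\<close> is not crossed by the arc from \<open>p\<close>; this leaves
    \<open>{b,c}\<close>.\<close>
  have na: "\<not> adj {a,b} g" if "g \<in> set es" for g
  proof
    assume "adj {a,b} g"
    then obtain x y z where xyz: "{a,b} = {x,y}" "g = {y,z}" "{x,z} \<in> E" "{y,z} \<in> E" "{x,y} \<in> E"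
      unfolding adj_def by (elim conjE exE) simp
    have ga: "g \<in> crossed a q" using set that by auto
    then have gp: "g \<in> crossed p q" using cr by blast
    have "g \<noteq> {b,c}" using step(3) that by (auto simp: chain_list_def)
    have na: "{a,w} \<notin> crossed a q" "{p,w} \<notin> crossed p q" for w
      unfolding crossed_iff using sep_distinct by blast+
    from xyz(1) consider "x = a" "y = b" | "x = b" "y = a" by (auto simp: doubleton_eq_iff)
    then have z: "{a,z} \<in> E \<and> {z,b} \<in> E \<and> (g = {a,z} \<or> g = {b,z})"
    proof cases
      case 1
      then show ?thesis using xyz(2-4) edge_sym by blast
    next
      case 2
      then show ?thesis using xyz(2-4) edge_sym by blast
    qed
    then have "z = p \<or> z = c" using wings_apex[OF step(2)] by blast
    moreover have "g = {a,z} \<or> g = {b,z}" using z by blast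
    moreover have "g \<noteq> {a,z}" using na(1)[of z] ga by blast
    moreover have "g \<noteq> {b,p}" using na(2)[of b] gp by (auto simp: insert_commute)
    ultimately show False using \<open>g \<noteq> {b,c}\<close> by blast
  qed
  show ?case
    using step(3) set cr(2) ab adj_sym[OF ab] na adj_sym adj_irrefl by (intro chain_list_Cons) auto
qed

lemma dpath_Cons: "dpath p q vs \<Longrightarrow> \<exists>u v es. vs = {u,v} # es \<and> {p,u} \<in> E \<and> {p,v} \<in> E \<and> sep u v p q"
proof (induction rule: dpath.induct)
  case (base a b p q)
  then show ?case unfolding wings_def by (metis insert_commute)
next
  case (step a q b c es p)
  have "{a,b} \<in> crossed p q"
    using dpath_crossed[OF dpath.step[OF step(1,2)]] by (metis list.set_intros(1))
  then show ?case using step(2) unfolding wings_def crossed_iff by (metis insert_commute)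
qed

text \<open>The arc leaves its first triangle through the side opposite to \<open>p\<close>, whose
  ends are consecutive neighbours of \<open>p\<close> on either side of \<open>q\<close>: the last
  one before \<open>q\<close>, and the apex of the next triangle on it.\<close>

lemma first_triangle:
  assumes "p \<noteq> q" "p \<le> N" "q \<le> N" "{p,q} \<notin> E"
  obtains a b c where "sep a b p q" "wings a b p c"
proof -
  have "{p,q} \<in> edges N - boundary N"
    using assms boundary_subset by (cases "N = 0") auto
  then obtain x where x: "cyc p x q" "x \<le> N"
  proof (rule not_boundaryE)
    fix p' q' x y assume "{p,q} = {p',q'}" "x \<le> N" "y \<le> N" "cyc p' x q'" "cyc q' y p'"
    then show thesis using that[of x] that[of y] by (auto simp: doubleton_eq_iff)
  qed
  obtain a where a: "cyc p a q" "{p,a} \<in> E" and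
    last: "\<And>z. {p,z} \<in> E \<Longrightarrow> cyc p z q \<Longrightarrow> \<not> cyc a z q"
    using last_neighbour[OF assms(2,3) x] by metis
  have "cyc a q p" using a(1) cyc_rotate by blast
  then obtain b where b: "cyc a b p" "{a,b} \<in> E" "{b,p} \<in> E"
    using triangle_exists[OF edge_sym[OF a(2)] _ assms(3)] by metis
  have "b \<noteq> q" using b(3) assms(4) by (auto simp: insert_commute)
  moreover have "\<not> cyc a b q"
  proof
    assume "cyc a b q"
    then have "cyc p b q" using a(1) b(1) cyc_trans_left by blast
    with last[OF edge_sym[OF b(3)]] \<open>cyc a b q\<close> show False by blast
  qed
  ultimately have s: "sep a b p q" 
    using ord_first[OF a(1) b(1)] by blast
  \<comment> \<open>The ends are renamed so that \<open>q\<close> lies on the arc from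
    \<open>a'\<close> to \<open>b'\<close>, the side on which the further apex is wanted.\<close>
  then obtain a' b' where ab': "{a',b'} = {a,b}" "cyc a' q b'" 
    unfolding sep_def by (metis insert_commute)
  then obtain c where c: "cyc a' c b'" "{a',c} \<in> E" "{c,b'} \<in> E"
    using triangle_exists[of a' b' q] b(2) assms(3) by metis
  have "sep a' b' p q" using s sep_cong[OF ab'(1)] by blast
  then have "cyc b' p a'" using ab'(2) cyc_asym unfolding sep_def by (metis cyc_rotate)
  then have "wings a' b' p c"
    unfolding wings_def using c ab'(1) a(2) b(2,3) by (auto simp: sep_def doubleton_eq_iff insert_commute)
  with \<open>sep a' b' p q\<close> show ?thesis by (rule that)
qed

lemma dpath_exists:
  assumes "p \<noteq> q" "p \<le> N" "q \<le> N" "{p,q} \<notin> E"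
  shows "\<exists>vs. dpath p q vs"
  using assms
proof (induction "card (crossed p q)" arbitrary: p rule: less_induct)
  case less
  obtain a b c where s: "sep a b p q" and w: "wings a b p c"
    using first_triangle[OF less(2-5)] by metis
  have *: ?case if w: "wings a b p c" and s: "sep b c a q" for a b
  proof -
    have aq: "a \<noteq> q" "a \<le> N" "{a,q} \<notin> E"
      using sep_distinct[OF s] edge w s not_sep unfolding wings_def by blast+
    have "card (crossed a q) < card (crossed p q)"
      using crossed_step[OF w s] finite_crossed by simp
    from less(1)[OF this aq(1,2) less(4) aq(3)] obtain vs where vs: "dpath a q vs" by blast
    then obtain u v es where uv: "vs = {u,v} # es" "{a,u} \<in> E" "{a,v} \<in> E" "sep u v a q"
      using dpath_Cons by blast
    have uvE: "{u,v} \<in> E" using dpath_crossed[OF vs] uv(1) by (auto simp: crossed_def)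
    have wE: "{a,b} \<in> E" "{a,c} \<in> E" "{b,c} \<in> E" using w unfolding wings_def by (auto simp: insert_commute)
    \<comment> \<open>Both chords are opposite to \<open>a\<close> in a triangle and separate
      \<open>a\<close> from \<open>q\<close>; two different ones would force a crossing inside
      \<open>E\<close>.\<close>
    have "{u,v} = {b,c}"
      using ord_first_unique[OF uv(4) s] not_sep uv(2,3) uvE wE by blast
    with vs uv(1) have "dpath a q ({b,c} # es)" by simp
    from dpath.step[OF this w] show ?thesis by blast
  qed
  show ?case
  proof (cases "c = q")
    case True
    then show ?thesis using dpath.base w by blast
  next
    case False
    with ord_next[OF s] w have "sep b c a q \<or> sep a c b q" unfolding wings_def by blast
    then show ?thesis using *[OF w] *[OF wings_flip[OF w]] by blast
  qed
qed

text \<open>Being a diagonal, \<open>{a,y}\<close> has a second triangle beyond it, whose apex is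
  the new start of the arc.\<close>

lemma dpath_extend:
  assumes d: "dpath a q ({y,z} # es)" and E: "{a,y} \<in> E" "{a,z} \<in> E" "{a,y} \<notin> boundary N"
  shows "\<exists>p. dpath p q ({a,y} # {y,z} # es)"
proof -
  have yz: "{y,z} \<in> E" using dpath_crossed[OF d] by (auto simp: crossed_def)
  obtain a' s y' t where "{a,y} = {a',y'}" "quad E a' s y' t"
    using quad_exists[OF E(1,3)] by metis
  then have w: "wings a y s t" using quad_wings wings_flip by (metis doubleton_eq_iff)
  then have "z = s \<or> z = t" using wings_apex[OF _ E(2) edge_sym[OF yz]] by blast
  then obtain p where "wings a y p z" using w wings_sym by blast
  then show ?thesis using dpath.step d by blast
qed

text \<open>The arc of the tail is prolonged across \<open>e1\<close>. For this the common triangle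
  of \<open>e1\<close> and \<open>e2\<close> must lie on the side of \<open>e2\<close> where the arc
  starts. If the tail is a single diagonal, the arc may be reversed. Otherwise the triangle on the
  far side contains the third diagonal, and \<open>e1\<close> would equal it or be adjacent to
  it.\<close>

lemma dpath_of_chain:
  assumes "chain_list adj vs" "vs \<noteq> []" "set vs \<subseteq> E - boundary N"
  shows "\<exists>p q. dpath p q vs"
  using assms
proof (induction vs)
  case (Cons e1 vs)
  show ?case
  proof (cases vs)
    case Nil
    have "e1 \<in> E" "e1 \<notin> boundary N" using Cons(4) by auto
    then obtain a b c d where "e1 = {a,c}" "quad E a b c d" by (rule quad_exists)
    then show ?thesis using Nil quad_wings dpath.base by blast
  next
    case vs: (Cons e2 es)
    obtain a q where d: "dpath a q (e2 # es)"
      using Cons(1) chain_list_ConsD(1)[OF Cons(2)] Cons(4) vs by auto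
    have "adj e1 e2" using chain_list_ConsD(3)[OF Cons(2) vs] .
    then obtain x y z where xyz: "e1 = {x,y}" "e2 = {y,z}" "{x,y} \<in> E" "{y,z} \<in> E" "{x,z} \<in> E"
      unfolding adj_def by blast
    have nb: "{x,y} \<notin> boundary N" using Cons(4) xyz by auto
    have ext: ?thesis if "dpath x q' (e2 # es)" for q'
      using dpath_extend[of x q' y z es] that xyz nb unfolding vs by blast
    from d show ?thesis
    proof cases
      case (base a' b')
      then have w: "wings a' b' a q" and e: "{a',b'} = {y,z}" using xyz by auto
      then have "wings y z a q" using wings_flip by (metis doubleton_eq_iff)
      then have "x = a \<or> x = q" and w: "wings y z q a"
        using wings_apex wings_sym xyz by (metis insert_commute)+
      moreover have "dpath q a (e2 # es)" using dpath.base[OF w] base xyz by simp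
      ultimately show ?thesis using ext d by blast
    next
      case (step a' b' c' es')
      then have e: "e2 = {a',b'}" "es = {b',c'} # es'" and w: "wings a' b' a c'" by auto
      have "wings y z a c'" using w e xyz wings_flip by (metis doubleton_eq_iff)
      then have "x = a \<or> x = c'" using wings_apex xyz by (metis insert_commute)
      moreover have "x \<noteq> c'"
      proof
        assume x: "x = c'"
        have "e1 \<noteq> {b',c'}" using chain_list_ConsD(2)[OF Cons(2)] vs e by auto
        with x xyz e have "e1 = {a',c'}" by (auto simp: doubleton_eq_iff insert_commute)
        moreover have "\<not> adj e1 {b',c'}" using chain_list_ConsD(4)[OF Cons(2) vs] e by simp
        ultimately show False using w xyz unfolding adj_def wings_def by (metis insert_commute)
      qed
      ultimately show ?thesis using ext d by blast
    qed
  qed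
qed simp

text \<open>If \<open>q\<close> and \<open>q'\<close> differ, then \<open>{q,q'}\<close> lies in
  \<open>E\<close>: a chord separating them crosses just one of the two arcs or ends at
  \<open>p\<close>, and in the latter case it also crosses \<open>{a,b}\<close>. The triangle on
  \<open>{q,q'}\<close> towards \<open>p\<close> has its apex away from \<open>p\<close>, since the
  arcs are not edges. One of its other sides then crosses one arc while sharing an endpoint with the
  other.\<close>

lemma crossed_inj1:
  assumes eq: "crossed p q = crossed p q'" and ab: "{a,b} \<in> crossed p q" and N: "q \<le> N" "q' \<le> N" "p \<le> N"
  shows "q = q'"
proof (rule ccontr)
  assume ne: "q \<noteq> q'"
  have ab2: "sep a b p q" "sep a b p q'" "{a,b} \<in> E" using ab eq crossed_iff by blast+
  then have dist: "p \<noteq> q" "p \<noteq> q'" using sep_distinct by blast+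
  have qq: "{q,q'} \<in> E"
  proof (rule maximal[OF ne N(1,2)])
    fix u v assume uv: "{u,v} \<in> E"
    have *: "\<not> sep p w q q'" if "{p,w} \<in> E" for w
      using ord_inj5 ab2 not_sep[OF that ab2(3)] by blast
    show "\<not> sep q q' u v"
    proof
      assume "sep q q' u v"
      then have s: "sep u v q q'" using sep_sym by blast
      have "sep u v p q \<longleftrightarrow> sep u v p q'" using eq uv crossed_iff by blast
      with ord_inj4[OF s dist] consider "p = u" | "p = v" by blast
      then show False
      proof cases
        case 1
        with s uv * show False by blast
      next
        case 2
        with s have "sep p u q q'" using sep_flip' by blast
        with 2 uv * edge_sym show False by blast
      qed
    qed
  qed
  have *: False if c: "cyc p q q'" and eq: "crossed p q = crossed p q'" and ab: "{a,b} \<in> E" "sep a b p q" "sep a b p q'"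
    and qq: "{q,q'} \<in> E" for q q'
  proof -
    have "cyc q' p q" using c cyc_rotate by blast
    then obtain r where r: "cyc q' r q" "{q',r} \<in> E" "{r,q} \<in> E"
      using triangle_exists[OF edge_sym[OF qq] _ N(3)] by metis
    have "r \<noteq> p" using r not_sep ab by blast
    with ord_inj6[OF c r(1)] consider "sep r q' p q" | "sep r q p q'" by blast
    then show False
    proof cases
      case 1
      then have "{r,q'} \<in> crossed p q'" using eq r crossed_iff edge_sym by blast
      then show False using crossed_iff sep_distinct by blast
    next
      case 2
      then have "{r,q} \<in> crossed p q" using eq r crossed_iff edge_sym by blast
      then show False using crossed_iff sep_distinct by blast
    qed
  qed
  have "cyc p q q' \<or> cyc p q' q" using cyc_cases[of p q q'] dist ne cyc_rotate by blast
  then show False using *[of q q'] *[of q' q] eq ab2 qq edge_sym by metis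
qed

text \<open>Relative to a common crossed edge \<open>{a,b}\<close>, the ends of the second arc can
  be named so that \<open>p\<close> and \<open>p'\<close> are not separated by it. An edge that does
  not cross \<open>{a,b}\<close> then cannot distinguish \<open>{p,q}\<close> from
  \<open>{p,q'}\<close>, and the case of a common endpoint applies twice.\<close>

lemma crossed_inj:
  assumes eq: "crossed p q = crossed p' q'" and ne: "crossed p q \<noteq> {}"
    and N: "p \<le> N" "q \<le> N" "p' \<le> N" "q' \<le> N"
  shows "{p,q} = {p',q'}"
proof -
  obtain e where "e \<in> crossed p q" using ne by blast
  then obtain a b where ab: "{a,b} \<in> crossed p q" using doubleton by (metis (no_types, lifting) crossed_def mem_Collect_eq)
  then have s: "{a,b} \<in> E" "sep a b p q" "sep a b p' q'" using eq crossed_iff by blast+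
  have *: "{p,q} = {p',q'}" if eq: "crossed p q = crossed p' q'" and s: "sep a b p q" "sep a b p' q'" "\<not> sep a b p p'"
    and N: "p' \<le> N" "q' \<le> N" for p' q'
  proof -
    have "crossed p q = crossed p q'"
    proof (rule crossed_eqI)
      fix u v assume uv: "{u,v} \<in> E"
      have "sep u v p q \<longleftrightarrow> sep u v p' q'" using uv eq crossed_iff by blast
      moreover have "\<not> sep u v a b" using uv \<open>{a,b} \<in> E\<close> not_sep by blast
      ultimately show "sep u v p q \<longleftrightarrow> sep u v p q'"
        using ord_inj1[OF _ _ s] ord_inj2[OF _ _ _ s] by blast
    qed
    then have "q = q'" using crossed_inj1[OF _ ab] N \<open>q \<le> N\<close> \<open>p \<le> N\<close> by blast
    with eq have "crossed q p = crossed q p'" by (simp add: crossed_sym)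
    then have "p = p'" using crossed_inj1[of q p p' a b] ab N \<open>q \<le> N\<close> \<open>p \<le> N\<close> by (simp add: crossed_sym)
    with \<open>q = q'\<close> show ?thesis by simp
  qed
  show ?thesis
  proof (cases "sep a b p p'")
    case False
    then show ?thesis using * eq s N by blast
  next
    case True
    have "\<not> sep a b p q'" using ord_inj3[OF s(2,3) True] .
    moreover have "sep a b q' p'" using s(3) sep_flip by blast
    moreover have "crossed p q = crossed q' p'" using eq crossed_sym by simp
    ultimately have "{p,q} = {q',p'}" using * s N by blast
    then show ?thesis by (simp add: insert_commute)
  qed
qed

end

section \<open>Polynomials and denominators\<close>

lemma mpoly_eval_add: "mpoly_eval x (p + q) = mpoly_eval x p + mpoly_eval x q"
  unfolding mpoly_eval_def
  by (rule setsum_keys_plus_distrib[where f = "\<lambda>\<alpha> c. of_rat c * (\<Prod>i\<in>Poly_Mapping.keys \<alpha>. x i ^ Poly_Mapping.lookup \<alpha> i)"]) (auto simp: of_rat_add algebra_simps)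

lemma mpoly_eval_zero [simp]: "mpoly_eval x 0 = 0"
  by (simp add: mpoly_eval_def)

lemma mpoly_eval_diff: "mpoly_eval x (p - q) = mpoly_eval x p - mpoly_eval x q"
  using mpoly_eval_add[of x "p - q" q] by simp

lemma mpoly_eval_sum: "mpoly_eval x (\<Sum>i\<in>A. f i) = (\<Sum>i\<in>A. mpoly_eval x (f i))"
  by (induction A rule: infinite_finite_induct) (auto simp: mpoly_eval_add)

lemma mpoly_eval_single:
  "mpoly_eval x (Poly_Mapping.single \<alpha> c) =
     of_rat c * (\<Prod>i\<in>Poly_Mapping.keys \<alpha>. x i ^ Poly_Mapping.lookup \<alpha> i)"
  by (simp add: mpoly_eval_def)

lemma monomial_eval_superset:
  assumes "finite K" "Poly_Mapping.keys \<alpha> \<subseteq> K"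
  shows "(\<Prod>i\<in>Poly_Mapping.keys \<alpha>. x i ^ Poly_Mapping.lookup \<alpha> i) = (\<Prod>i\<in>K. (x i :: 'a::field_char_0) ^ Poly_Mapping.lookup \<alpha> i)"
  using assms by (intro prod.mono_neutral_left) (auto simp: in_keys_iff)

lemma monomial_eval_add:
  "(\<Prod>i\<in>Poly_Mapping.keys (\<alpha> + \<beta>). x i ^ Poly_Mapping.lookup (\<alpha> + \<beta>) i) =
    (\<Prod>i\<in>Poly_Mapping.keys \<alpha>. (x i :: 'a::field_char_0) ^ Poly_Mapping.lookup \<alpha> i) *
    (\<Prod>i\<in>Poly_Mapping.keys \<beta>. x i ^ Poly_Mapping.lookup \<beta> i)"
proof -
  let ?K = "Poly_Mapping.keys \<alpha> \<union> Poly_Mapping.keys \<beta>"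
  show ?thesis
    unfolding monomial_eval_superset[of ?K \<alpha> x, simplified] monomial_eval_superset[of ?K \<beta> x, simplified]
      monomial_eval_superset[of ?K "\<alpha> + \<beta>" x, simplified, OF keys_add]
    by (simp add: lookup_add power_add prod.distrib)
qed

lemma poly_mapping_sum_single:
  "(\<Sum>\<alpha>\<in>Poly_Mapping.keys p. Poly_Mapping.single \<alpha> (Poly_Mapping.lookup p \<alpha>)) = p"
  by (rule poly_mapping_eqI) (auto simp: lookup_sum lookup_single when_def in_keys_iff)

lemma mpoly_eval_mult: "mpoly_eval x (p * q) = mpoly_eval x p * mpoly_eval x q"
proof -
  have "mpoly_eval x (Poly_Mapping.single \<alpha> a * Poly_Mapping.single \<beta> b) =
      mpoly_eval x (Poly_Mapping.single \<alpha> a) * mpoly_eval x (Poly_Mapping.single \<beta> b)" for \<alpha> \<beta> a b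
    by (simp add: mult_single mpoly_eval_single monomial_eval_add of_rat_mult)
  then have "mpoly_eval x ((\<Sum>\<alpha>\<in>A. Poly_Mapping.single \<alpha> (f \<alpha>)) * (\<Sum>\<beta>\<in>B. Poly_Mapping.single \<beta> (g \<beta>))) =
      mpoly_eval x (\<Sum>\<alpha>\<in>A. Poly_Mapping.single \<alpha> (f \<alpha>)) * mpoly_eval x (\<Sum>\<beta>\<in>B. Poly_Mapping.single \<beta> (g \<beta>))"
    for A f B g
    by (simp add: sum_product mpoly_eval_sum)
  from this[of "Poly_Mapping.lookup p" "Poly_Mapping.keys p" "Poly_Mapping.lookup q" "Poly_Mapping.keys q"]
  show ?thesis by (simp only: poly_mapping_sum_single)
qed

lemma mpoly_eval_one [simp]: "mpoly_eval x 1 = 1"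
  by (simp add: mpoly_eval_def)

lemma mpoly_eval_prod: "mpoly_eval x (\<Prod>i\<in>A. f i) = (\<Prod>i\<in>A. mpoly_eval x (f i))"
  by (induction A rule: infinite_finite_induct) (auto simp: mpoly_eval_mult)

lemma mpoly_vars_mult: "mpoly_vars (p * q) \<subseteq> mpoly_vars p \<union> mpoly_vars q"
proof
  fix i assume "i \<in> mpoly_vars (p * q)"
  then obtain \<alpha> \<beta> where "\<alpha> \<in> Poly_Mapping.keys p" "\<beta> \<in> Poly_Mapping.keys q" "i \<in> Poly_Mapping.keys (\<alpha> + \<beta>)"
    unfolding mpoly_vars_def using keys_mult[of p q] by auto
  then show "i \<in> mpoly_vars p \<union> mpoly_vars q"
    using keys_add[of \<alpha> \<beta>] unfolding mpoly_vars_def by auto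
qed

lemma mpoly_vars_diff: "mpoly_vars (p - q) \<subseteq> mpoly_vars p \<union> mpoly_vars q"
proof -
  have "Poly_Mapping.keys (p - q) \<subseteq> Poly_Mapping.keys p \<union> Poly_Mapping.keys q"
    by (auto simp: in_keys_iff lookup_minus)
  then show ?thesis unfolding mpoly_vars_def by blast
qed

lemma mpoly_vars_one [simp]: "mpoly_vars 1 = {}"
  by (simp add: mpoly_vars_def)

lemma mpoly_vars_prod: "mpoly_vars (\<Prod>i\<in>A. f i) \<subseteq> (\<Union>i\<in>A. mpoly_vars (f i))"
proof (induction A rule: infinite_finite_induct)
  case (insert a A)
  then show ?case using mpoly_vars_mult[of "f a" "prod f A"] by auto
qed auto

definition mpoly_var_power :: "nat \<Rightarrow> nat \<Rightarrow> rat_mpoly" where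
  "mpoly_var_power i k = Poly_Mapping.single (Poly_Mapping.single i k) 1"

lemma mpoly_eval_var_power [simp]: "mpoly_eval x (mpoly_var_power i k) = x i ^ k"
  by (simp add: mpoly_var_power_def mpoly_eval_single)

lemma mpoly_vars_var_power: "mpoly_vars (mpoly_var_power i k) \<subseteq> {i}"
  by (auto simp: mpoly_vars_def mpoly_var_power_def split: if_splits)

lemma subring_hull: "is_subring (is_subring hull S)"
  by (rule hull_in) (auto simp: is_subring_def)

section \<open>Specialization of the polynomial ring and positive numerators\<close>

locale free_variables =
  fixes n m :: nat and x :: "nat \<Rightarrow> 'a::field_char_0"
  assumes le: "n \<le> m" and indep: "algebraically_independent m x"
begin

lemma eval_inj:
  assumes "mpoly_vars p \<subseteq> {1..m}" "mpoly_vars q \<subseteq> {1..m}" "mpoly_eval x p = mpoly_eval x q"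
  shows "p = q"
proof -
  have "mpoly_vars (p - q) \<subseteq> {1..m}" using mpoly_vars_diff[of p q] assms by blast
  moreover have "mpoly_eval x (p - q) = 0" using assms by (simp add: mpoly_eval_diff)
  ultimately have "p - q = 0" using indep unfolding algebraically_independent_def by blast
  then show ?thesis by simp
qed

lemma x_nonzero: "i \<in> {1..m} \<Longrightarrow> x i \<noteq> 0"
proof
  assume i: "i \<in> {1..m}" "x i = 0"
  have "mpoly_vars (mpoly_var_power i 1) \<subseteq> {1..m}"
    using i mpoly_vars_var_power[of i 1] by blast
  then have "mpoly_var_power i 1 = 0"
    using i indep unfolding algebraically_independent_def by force
  then show False by (metis mpoly_eval_var_power mpoly_eval_zero one_neq_zero power_one)
qed

text \<open>Used to clear the denominators in frozen variables. Only variables with index at most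
  \<open>n\<close> are ever set to 0, so these monomials specialize to 1.\<close>

definition frozen_monomial :: "(nat \<Rightarrow> nat) \<Rightarrow> rat_mpoly" where
  "frozen_monomial \<mu> = (\<Prod>r\<in>{n+1..m}. mpoly_var_power r (\<mu> r))"

lemma eval_frozen_monomial: "mpoly_eval y (frozen_monomial \<mu>) = (\<Prod>r\<in>{n+1..m}. y r ^ \<mu> r)"
  by (simp add: frozen_monomial_def mpoly_eval_prod)

lemma eval_frozen_monomial_add:
  "mpoly_eval y (frozen_monomial (\<lambda>r. \<mu> r + \<nu> r)) = mpoly_eval y (frozen_monomial \<mu>) * mpoly_eval y (frozen_monomial \<nu>)"
  by (simp add: eval_frozen_monomial power_add prod.distrib)

lemma vars_frozen_monomial: "mpoly_vars (frozen_monomial \<mu>) \<subseteq> {1..m}"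
proof -
  have "(\<Union>r\<in>{n+1..m}. mpoly_vars (mpoly_var_power r (\<mu> r))) \<subseteq> (\<Union>r\<in>{n+1..m}. {r})"
    using mpoly_vars_var_power by (intro UN_mono) auto
  then show ?thesis
    using mpoly_vars_prod[of "\<lambda>r. mpoly_var_power r (\<mu> r)" "{n+1..m}"]
    unfolding frozen_monomial_def by force
qed

text \<open>\<open>c\<close> is the value of \<open>z\<close> at \<open>x i = 0\<close> and \<open>x j = 1\<close> for \<open>j \<noteq> i\<close>. An element of the polynomial
  ring whose specialization is positive is not divisible by \<open>x i\<close>, and positivity survives sums.\<close>

definition specializes :: "nat \<Rightarrow> 'a \<Rightarrow> rat \<Rightarrow> bool" where
  "specializes i z c \<longleftrightarrow> (\<exists>p \<mu>. mpoly_vars p \<subseteq> {1..m} \<and>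
     z * mpoly_eval x (frozen_monomial \<mu>) = mpoly_eval x p \<and> c = mpoly_eval (\<lambda>j. if j = i then 0 else 1) p)"

lemma eval_frozen_monomial_spec:
  "i \<le> n \<Longrightarrow> mpoly_eval (\<lambda>j. if j = i then 0 else 1) (frozen_monomial \<mu>) = 1"
  by (simp add: eval_frozen_monomial)

lemma specializes_unique:
  assumes "i \<le> n" "specializes i z c" "specializes i z c'"
  shows "c = c'"
proof -
  let ?\<rho> = "\<lambda>j. if j = i then 0 else 1 :: rat"
  obtain p \<mu> where p: "mpoly_vars p \<subseteq> {1..m}" "z * mpoly_eval x (frozen_monomial \<mu>) = mpoly_eval x p"
    "c = mpoly_eval ?\<rho> p" using assms(2) unfolding specializes_def by blast
  obtain q \<nu> where q: "mpoly_vars q \<subseteq> {1..m}" "z * mpoly_eval x (frozen_monomial \<nu>) = mpoly_eval x q"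
    "c' = mpoly_eval ?\<rho> q" using assms(3) unfolding specializes_def by blast
  have "p * frozen_monomial \<nu> = q * frozen_monomial \<mu>"
  proof (rule eval_inj)
    show "mpoly_vars (p * frozen_monomial \<nu>) \<subseteq> {1..m}" "mpoly_vars (q * frozen_monomial \<mu>) \<subseteq> {1..m}"
      using mpoly_vars_mult p(1) q(1) vars_frozen_monomial by blast+
    show "mpoly_eval x (p * frozen_monomial \<nu>) = mpoly_eval x (q * frozen_monomial \<mu>)"
      by (simp add: mpoly_eval_mult flip: p(2) q(2))
  qed
  then have "mpoly_eval ?\<rho> (p * frozen_monomial \<nu>) = mpoly_eval ?\<rho> (q * frozen_monomial \<mu>)" by simp
  then show ?thesis using assms(1) p(3) q(3) by (simp add: mpoly_eval_mult eval_frozen_monomial_spec)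
qed

lemma specializes_diff:
  assumes "i \<le> n" "specializes i z c" "specializes i z' c'"
  shows "specializes i (z - z') (c - c')"
proof -
  let ?\<rho> = "\<lambda>j. if j = i then 0 else 1 :: rat"
  obtain p \<mu> where p: "mpoly_vars p \<subseteq> {1..m}" "z * mpoly_eval x (frozen_monomial \<mu>) = mpoly_eval x p"
    "c = mpoly_eval ?\<rho> p" using assms(2) unfolding specializes_def by blast
  obtain q \<nu> where q: "mpoly_vars q \<subseteq> {1..m}" "z' * mpoly_eval x (frozen_monomial \<nu>) = mpoly_eval x q"
    "c' = mpoly_eval ?\<rho> q" using assms(3) unfolding specializes_def by blast
  let ?s = "p * frozen_monomial \<nu> - q * frozen_monomial \<mu>"
  have "mpoly_vars ?s \<subseteq> {1..m}"
    using mpoly_vars_diff[of "p * frozen_monomial \<nu>" "q * frozen_monomial \<mu>"]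
      mpoly_vars_mult[of p "frozen_monomial \<nu>"] mpoly_vars_mult[of q "frozen_monomial \<mu>"]
      p(1) q(1) vars_frozen_monomial by blast
  moreover have "(z - z') * mpoly_eval x (frozen_monomial (\<lambda>r. \<mu> r + \<nu> r)) = mpoly_eval x ?s"
    by (simp add: mpoly_eval_mult mpoly_eval_diff eval_frozen_monomial_add algebra_simps flip: p(2) q(2))
  moreover have "c - c' = mpoly_eval ?\<rho> ?s"
    using p(3) q(3) assms(1) by (simp add: mpoly_eval_mult mpoly_eval_diff eval_frozen_monomial_spec)
  ultimately show ?thesis unfolding specializes_def by blast
qed

lemma specializes_mult:
  assumes "i \<le> n" "specializes i z c" "specializes i z' c'"
  shows "specializes i (z * z') (c * c')"
proof -
  let ?\<rho> = "\<lambda>j. if j = i then 0 else 1 :: rat"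
  obtain p \<mu> where p: "mpoly_vars p \<subseteq> {1..m}" "z * mpoly_eval x (frozen_monomial \<mu>) = mpoly_eval x p"
    "c = mpoly_eval ?\<rho> p" using assms(2) unfolding specializes_def by blast
  obtain q \<nu> where q: "mpoly_vars q \<subseteq> {1..m}" "z' * mpoly_eval x (frozen_monomial \<nu>) = mpoly_eval x q"
    "c' = mpoly_eval ?\<rho> q" using assms(3) unfolding specializes_def by blast
  have "mpoly_vars (p * q) \<subseteq> {1..m}"
    using mpoly_vars_mult[of p q] p(1) q(1) by blast
  moreover have "(z * z') * mpoly_eval x (frozen_monomial (\<lambda>r. \<mu> r + \<nu> r)) = mpoly_eval x (p * q)"
    by (simp add: mpoly_eval_mult eval_frozen_monomial_add algebra_simps flip: p(2) q(2))
  moreover have "c * c' = mpoly_eval ?\<rho> (p * q)"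
    using p(3) q(3) by (simp add: mpoly_eval_mult)
  ultimately show ?thesis unfolding specializes_def by blast
qed

lemma specializes_one: "specializes i 1 1"
  unfolding specializes_def
  by (rule exI[of _ 1], rule exI[of _ "\<lambda>_. 0"]) (simp add: eval_frozen_monomial)

lemma specializes_zero: "specializes i 0 0"
  unfolding specializes_def
  by (rule exI[of _ 0], rule exI[of _ "\<lambda>_. 0"]) (simp add: eval_frozen_monomial mpoly_vars_def)

lemma specializes_x:
  assumes "j \<in> {1..m}"
  shows "specializes i (x j) (if j = i then 0 else 1)"
proof -
  have "mpoly_vars (mpoly_var_power j 1) \<subseteq> {1..m}"
    using assms mpoly_vars_var_power[of j 1] by blast
  then show ?thesis unfolding specializes_def
    by (intro exI[of _ "mpoly_var_power j 1"] exI[of _ "\<lambda>_. 0"]) (simp add: eval_frozen_monomial)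
qed

lemma specializes_inverse_x:
  assumes "r \<in> {n+1..m}"
  shows "specializes i (inverse (x r)) 1"
proof -
  have "x r \<noteq> 0" using assms by (intro x_nonzero) auto
  moreover have "(\<Prod>s\<in>{n+1..m}. x s ^ (if s = r then 1 else 0)) = (\<Prod>s\<in>{n+1..m}. if s = r then x r else 1)"
    by (intro prod.cong) auto
  then have "(\<Prod>s\<in>{n+1..m}. x s ^ (if s = r then 1 else 0)) = x r"
    using assms by simp
  ultimately show ?thesis unfolding specializes_def
    by (intro exI[of _ 1] exI[of _ "\<lambda>s. if s = r then 1 else 0"]) (simp add: eval_frozen_monomial)
qed

abbreviation R :: "'a set" where "R \<equiv> polynomial_ring n m x"

lemma R_subring: "is_subring R"
  unfolding polynomial_ring_def by (rule subring_hull)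

text \<open>The elements possessing a specialization form a subring that contains the generators of
  both hulls.\<close>

lemma R_specializes: "i \<le> n \<Longrightarrow> z \<in> R \<Longrightarrow> \<exists>c. specializes i z c"
proof -
  assume i: "i \<le> n"
  let ?S = "{z. \<exists>c. specializes i z c}"
  have S: "is_subring ?S"
    unfolding is_subring_def using specializes_diff[OF i] specializes_mult[OF i] specializes_one specializes_zero by blast
  have xS: "x j \<in> ?S" if "j \<in> {1..m}" for j
    using specializes_x[OF that, of i] by blast
  have "ground_ring n m x \<subseteq> ?S"
    unfolding ground_ring_def
  proof (rule hull_minimal)
    have "x ` {n+1..m} \<subseteq> ?S" using xS by auto
    moreover have "(\<lambda>i. inverse (x i)) ` {n+1..m} \<subseteq> ?S" using specializes_inverse_x[of _ i] by blast
    ultimately show "x ` {n+1..m} \<union> (\<lambda>i. inverse (x i)) ` {n+1..m} \<subseteq> ?S" by (rule Un_least)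
    show "is_subring ?S" by (rule S)
  qed
  moreover have "R \<subseteq> ?S" if g: "ground_ring n m x \<subseteq> ?S"
    unfolding polynomial_ring_def
  proof (rule hull_minimal)
    have "x ` {1..n} \<subseteq> ?S" using xS le by auto
    with g show "ground_ring n m x \<union> x ` {1..n} \<subseteq> ?S" by (rule Un_least)
    show "is_subring ?S" by (rule S)
  qed
  ultimately show "z \<in> R \<Longrightarrow> \<exists>c. specializes i z c" by blast
qed

definition spec :: "nat \<Rightarrow> 'a \<Rightarrow> rat" where
  "spec i z = (THE c. specializes i z c)"

lemma spec_eq: "i \<le> n \<Longrightarrow> specializes i z c \<Longrightarrow> spec i z = c"
  unfolding spec_def using specializes_unique by blast

lemma specializes_spec: "i \<le> n \<Longrightarrow> z \<in> R \<Longrightarrow> specializes i z (spec i z)"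
  using R_specializes spec_eq by blast

lemma R_zero: "0 \<in> R" and R_one: "1 \<in> R" and R_diff: "a \<in> R \<Longrightarrow> b \<in> R \<Longrightarrow> a - b \<in> R"
  and R_mult: "a \<in> R \<Longrightarrow> b \<in> R \<Longrightarrow> a * b \<in> R"
  using R_subring unfolding is_subring_def by auto

lemma R_add: "a \<in> R \<Longrightarrow> b \<in> R \<Longrightarrow> a + b \<in> R"
  using R_diff[of a "0 - b"] R_diff[OF R_zero] by simp

lemma ground_subset_R: "ground_ring n m x \<subseteq> R"
  unfolding polynomial_ring_def by (meson hull_subset le_sup_iff)

lemma R_x: "j \<in> {1..m} \<Longrightarrow> x j \<in> R"
proof (cases "j \<le> n")
  case True
  assume "j \<in> {1..m}"
  with True show ?thesis unfolding polynomial_ring_def by (intro hull_inc) auto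
next
  case False
  assume "j \<in> {1..m}"
  with False have "x j \<in> ground_ring n m x" unfolding ground_ring_def by (intro hull_inc) auto
  then show ?thesis using ground_subset_R by blast
qed

lemma R_inverse_x: "r \<in> {n+1..m} \<Longrightarrow> inverse (x r) \<in> R"
proof -
  assume "r \<in> {n+1..m}"
  then have "inverse (x r) \<in> ground_ring n m x" unfolding ground_ring_def by (intro hull_inc) auto
  then show ?thesis using ground_subset_R by blast
qed

lemma R_power: "a \<in> R \<Longrightarrow> a ^ k \<in> R"
  by (induction k) (auto intro: R_one R_mult)

lemma R_prod: "(\<And>i. i \<in> A \<Longrightarrow> f i \<in> R) \<Longrightarrow> (\<Prod>i\<in>A. f i) \<in> R"
  by (induction A rule: infinite_finite_induct) (auto intro: R_one R_mult)

lemma spec_one: "i \<le> n \<Longrightarrow> spec i 1 = 1"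
  by (rule spec_eq[OF _ specializes_one])

lemma spec_diff: "i \<le> n \<Longrightarrow> a \<in> R \<Longrightarrow> b \<in> R \<Longrightarrow> spec i (a - b) = spec i a - spec i b"
  by (intro spec_eq specializes_diff specializes_spec)

lemma spec_add: "i \<le> n \<Longrightarrow> a \<in> R \<Longrightarrow> b \<in> R \<Longrightarrow> spec i (a + b) = spec i a + spec i b"
  using spec_diff[of i "a + b" b] R_add[of a b] by simp

lemma spec_mult: "i \<le> n \<Longrightarrow> a \<in> R \<Longrightarrow> b \<in> R \<Longrightarrow> spec i (a * b) = spec i a * spec i b"
  by (intro spec_eq specializes_mult specializes_spec)

lemma spec_x: "i \<le> n \<Longrightarrow> j \<in> {1..m} \<Longrightarrow> spec i (x j) = (if j = i then 0 else 1)"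
  by (intro spec_eq specializes_x)

lemma spec_inverse_x: "i \<le> n \<Longrightarrow> r \<in> {n+1..m} \<Longrightarrow> spec i (inverse (x r)) = 1"
  by (intro spec_eq specializes_inverse_x)

lemma spec_power: "i \<le> n \<Longrightarrow> a \<in> R \<Longrightarrow> spec i (a ^ k) = spec i a ^ k"
  by (induction k) (auto simp: spec_one spec_mult R_power)

lemma spec_prod:
  assumes "i \<le> n"
  shows "(\<And>j. j \<in> A \<Longrightarrow> f j \<in> R) \<Longrightarrow> spec i (\<Prod>j\<in>A. f j) = (\<Prod>j\<in>A. spec i (f j))"
  by (induction A rule: infinite_finite_induct) (auto simp: spec_one spec_mult R_prod assms)

lemma x_power_prod:
  shows "(\<Prod>j\<in>{1..n}. x j ^ k j) \<in> R"
    and "i \<in> {1..n} \<Longrightarrow> spec i (\<Prod>j\<in>{1..n}. x j ^ k j) = (if k i = 0 then 1 else 0)"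
proof -
  have xR: "j \<in> {1..n} \<Longrightarrow> x j \<in> R" for j using R_x le by auto
  show "(\<Prod>j\<in>{1..n}. x j ^ k j) \<in> R" by (intro R_prod R_power xR)
  assume i: "i \<in> {1..n}"
  then have "spec i (\<Prod>j\<in>{1..n}. x j ^ k j) = (\<Prod>j\<in>{1..n}. (if j = i then 0 else 1) ^ k j)"
    using le by (subst spec_prod) (auto simp: spec_power spec_x xR R_power intro!: prod.cong)
  also have "\<dots> = (\<Prod>j\<in>{1..n}. if j = i then 0 ^ k i else 1)"
    by (intro prod.cong) auto
  also have "\<dots> = (if k i = 0 then 1 else 0)" using i by simp
  finally show "spec i (\<Prod>j\<in>{1..n}. x j ^ k j) = (if k i = 0 then 1 else 0)" .
qed

text \<open>A form of \<open>has_denominator_vector\<close> that can be carried through an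
  induction: non-divisibility by \<open>x i\<close> may be lost in a sum, while positivity of the
  specialized numerator is kept.\<close>

definition positive_denominator :: "'a \<Rightarrow> (nat \<Rightarrow> int) \<Rightarrow> bool" where
  "positive_denominator z d \<longleftrightarrow> (\<exists>a\<in>R. (\<forall>i\<in>{1..n}. spec i a > 0) \<and> z = a / (\<Prod>i\<in>{1..n}. x i powi d i))"

lemma powi_prod_nonzero: "(\<Prod>i\<in>{1..n}. x i powi d i) \<noteq> 0"
  using x_nonzero le by auto

lemma powi_prod_add:
  "(\<Prod>i\<in>{1..n}. x i powi (d i + d' i)) = (\<Prod>i\<in>{1..n}. x i powi d i) * (\<Prod>i\<in>{1..n}. x i powi d' i)"
  unfolding prod.distrib[symmetric] using x_nonzero le by (intro prod.cong power_int_add) auto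

lemma powi_prod_nat:
  assumes "\<And>i. i \<in> {1..n} \<Longrightarrow> d i \<ge> 0"
  shows "(\<Prod>i\<in>{1..n}. x i powi d i) = (\<Prod>i\<in>{1..n}. x i ^ nat (d i))"
  using assms by (intro prod.cong) (auto simp: power_int_def)

lemma positive_denominator_cong:
  assumes "positive_denominator z d" "\<And>i. i \<in> {1..n} \<Longrightarrow> d i = d' i"
  shows "positive_denominator z d'"
proof -
  have "(\<Prod>i\<in>{1..n}. x i powi d i) = (\<Prod>i\<in>{1..n}. x i powi d' i)"
    using assms(2) by (intro prod.cong) auto
  with assms(1) show ?thesis unfolding positive_denominator_def by simp
qed

lemma positive_denominator_mult:
  assumes "positive_denominator z d" "positive_denominator z' d'"
  shows "positive_denominator (z * z') (\<lambda>i. d i + d' i)"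
proof -
  obtain a where a: "a \<in> R" "\<forall>i\<in>{1..n}. spec i a > 0" "z = a / (\<Prod>i\<in>{1..n}. x i powi d i)"
    using assms(1) unfolding positive_denominator_def by blast
  obtain b where b: "b \<in> R" "\<forall>i\<in>{1..n}. spec i b > 0" "z' = b / (\<Prod>i\<in>{1..n}. x i powi d' i)"
    using assms(2) unfolding positive_denominator_def by blast
  show ?thesis unfolding positive_denominator_def powi_prod_add
    using a b by (intro bexI[of _ "a * b"]) (auto simp: spec_mult R_mult)
qed

text \<open>Over the common denominator the numerators acquire monomial factors \<open>u\<close> and
  \<open>v\<close>. For every \<open>i\<close> at least one of these does not contain
  \<open>x i\<close>, so one summand specializes to a positive number and the other to a nonnegative
  one.\<close>

lemma positive_denominator_add:
  assumes "positive_denominator z d" "positive_denominator z' d'"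
  shows "positive_denominator (z + z') (\<lambda>i. max (d i) (d' i))"
proof -
  obtain a where a: "a \<in> R" "\<forall>i\<in>{1..n}. spec i a > 0" "z = a / (\<Prod>i\<in>{1..n}. x i powi d i)"
    using assms(1) unfolding positive_denominator_def by blast
  obtain b where b: "b \<in> R" "\<forall>i\<in>{1..n}. spec i b > 0" "z' = b / (\<Prod>i\<in>{1..n}. x i powi d' i)"
    using assms(2) unfolding positive_denominator_def by blast
  define u where "u = (\<Prod>i\<in>{1..n}. x i ^ nat (max (d i) (d' i) - d i))"
  define v where "v = (\<Prod>i\<in>{1..n}. x i ^ nat (max (d i) (d' i) - d' i))"
  have D: "(\<Prod>i\<in>{1..n}. x i powi max (d i) (d' i)) = (\<Prod>i\<in>{1..n}. x i powi d i) * u"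
    "(\<Prod>i\<in>{1..n}. x i powi max (d i) (d' i)) = (\<Prod>i\<in>{1..n}. x i powi d' i) * v"
    using powi_prod_add[of d "\<lambda>i. max (d i) (d' i) - d i"] powi_prod_nat[of "\<lambda>i. max (d i) (d' i) - d i"]
      powi_prod_add[of d' "\<lambda>i. max (d i) (d' i) - d' i"] powi_prod_nat[of "\<lambda>i. max (d i) (d' i) - d' i"]
    unfolding u_def v_def by simp_all
  have uv: "u \<in> R" "v \<in> R" unfolding u_def v_def by (rule x_power_prod)+
  have nz: "u \<noteq> 0" "v \<noteq> 0" using x_nonzero le unfolding u_def v_def by auto
  have "a / (\<Prod>i\<in>{1..n}. x i powi d i) = a * u / (\<Prod>i\<in>{1..n}. x i powi max (d i) (d' i))"
    unfolding D(1) using nz by simp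
  moreover have "b / (\<Prod>i\<in>{1..n}. x i powi d' i) = b * v / (\<Prod>i\<in>{1..n}. x i powi max (d i) (d' i))"
    unfolding D(2) using nz by simp
  ultimately have "z + z' = (a * u + b * v) / (\<Prod>i\<in>{1..n}. x i powi max (d i) (d' i))"
    unfolding a b by (simp add: add_divide_distrib)
  moreover have "spec i (a * u + b * v) > 0" if i: "i \<in> {1..n}" for i
  proof -
    have "spec i (a * u + b * v) = spec i a * spec i u + spec i b * spec i v"
      using i a b uv by (simp add: spec_add spec_mult R_mult)
    moreover have "spec i a > 0" "spec i b > 0" using a b i by auto
    ultimately show ?thesis
      using x_power_prod(2)[OF i, of "\<lambda>i. nat (max (d i) (d' i) - d i)"]
        x_power_prod(2)[OF i, of "\<lambda>i. nat (max (d i) (d' i) - d' i)"]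
      unfolding u_def[symmetric] v_def[symmetric] by auto
  qed
  ultimately show ?thesis unfolding positive_denominator_def
    using a b uv by (intro bexI[of _ "a * u + b * v"]) (auto simp: R_mult R_add)
qed

lemma positive_denominator_x:
  assumes l: "l \<in> {1..n}"
  shows "positive_denominator (x l) (\<lambda>i. if i = l then - 1 else 0)"
proof -
  have "(\<Prod>i\<in>{1..n}. x i powi (if i = l then - 1 else 0)) = (\<Prod>i\<in>{1..n}. if i = l then inverse (x l) else 1)"
    by (intro prod.cong) auto
  also have "\<dots> = inverse (x l)" using l by simp
  finally show ?thesis unfolding positive_denominator_def
    using l by (intro bexI[of _ 1]) (auto simp: R_one spec_one field_simps)
qed

lemma positive_denominator_divide_x:
  assumes l: "l \<in> {1..n}" and z: "positive_denominator z d"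
  shows "positive_denominator (z / x l) (\<lambda>i. d i + (if i = l then 1 else 0))"
proof -
  have "(\<Prod>i\<in>{1..n}. x i powi (if i = l then 1 else 0)) = (\<Prod>i\<in>{1..n}. if i = l then x l else 1)"
    by (intro prod.cong) auto
  also have "\<dots> = x l" using l by simp
  finally show ?thesis using z unfolding positive_denominator_def powi_prod_add
    by (auto simp: field_simps)
qed

lemma positive_denominator_frozen:
  "positive_denominator (\<Prod>r\<in>{n+1..m}. x r powi w r) (\<lambda>_. 0)"
proof -
  have p: "x r powi k \<in> R \<and> (\<forall>i\<in>{1..n}. spec i (x r powi k) = 1)" if r: "r \<in> {n+1..m}" for r k
  proof -
    have "x r \<in> R" using r by (intro R_x) auto
    moreover have "i \<in> {1..n} \<Longrightarrow> spec i (x r) = 1" for i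
      using r spec_x[of i r] by auto
    ultimately show ?thesis using r
      by (auto simp: power_int_def R_power R_inverse_x spec_power spec_inverse_x)
  qed
  have "i \<in> {1..n} \<Longrightarrow> spec i (\<Prod>r\<in>{n+1..m}. x r powi w r) = 1" for i
    using p by (subst spec_prod) auto
  then show ?thesis unfolding positive_denominator_def
    using p by (intro bexI[of _ "\<Prod>r\<in>{n+1..m}. x r powi w r"] R_prod) auto
qed

text \<open>If the exponents of \<open>x i\<close> differ, clearing denominators leaves a factor
  \<open>x i\<close> on one side only; specializing at \<open>x i = 0\<close> gives 0 there and a
  positive number on the other side.\<close>

lemma positive_denominator_unique:
  assumes "positive_denominator z d" "positive_denominator z d'" "i \<in> {1..n}"
  shows "d i = d' i"
proof -
  have False if z: "positive_denominator z d" "positive_denominator z d'" and lt: "d i < d' i" for d d'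
  proof -
    obtain a where a: "a \<in> R" "\<forall>i\<in>{1..n}. spec i a > 0" "z = a / (\<Prod>i\<in>{1..n}. x i powi d i)"
      using z(1) unfolding positive_denominator_def by blast
    obtain b where b: "b \<in> R" "\<forall>i\<in>{1..n}. spec i b > 0" "z = b / (\<Prod>i\<in>{1..n}. x i powi d' i)"
      using z(2) unfolding positive_denominator_def by blast
    define u where "u = (\<Prod>i\<in>{1..n}. x i ^ nat (max (d i) (d' i) - d i))"
    define v where "v = (\<Prod>i\<in>{1..n}. x i ^ nat (max (d i) (d' i) - d' i))"
    have D: "(\<Prod>i\<in>{1..n}. x i powi max (d i) (d' i)) = (\<Prod>i\<in>{1..n}. x i powi d i) * u"
      "(\<Prod>i\<in>{1..n}. x i powi max (d i) (d' i)) = (\<Prod>i\<in>{1..n}. x i powi d' i) * v"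
      using powi_prod_add[of d "\<lambda>i. max (d i) (d' i) - d i"] powi_prod_nat[of "\<lambda>i. max (d i) (d' i) - d i"]
        powi_prod_add[of d' "\<lambda>i. max (d i) (d' i) - d' i"] powi_prod_nat[of "\<lambda>i. max (d i) (d' i) - d' i"]
      unfolding u_def v_def by simp_all
    have uv: "u \<in> R" "v \<in> R" unfolding u_def v_def by (rule x_power_prod)+
    have "a * u = z * (\<Prod>i\<in>{1..n}. x i powi max (d i) (d' i))"
      using a(3) powi_prod_nonzero[of d] unfolding D(1) by (simp add: field_simps)
    also have "\<dots> = b * v"
      using b(3) powi_prod_nonzero[of d'] unfolding D(2) by (simp add: field_simps)
    finally have "spec i a * spec i u = spec i b * spec i v"
      using assms(3) a(1) b(1) uv spec_mult[of i a u] spec_mult[of i b v] by simp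
    moreover have "spec i u = 0" "spec i v = 1"
      using x_power_prod(2)[OF assms(3), of "\<lambda>i. nat (max (d i) (d' i) - d i)"]
        x_power_prod(2)[OF assms(3), of "\<lambda>i. nat (max (d i) (d' i) - d' i)"] lt
      unfolding u_def[symmetric] v_def[symmetric] by auto
    ultimately show False using b(2) assms(3) by force
  qed
  from this[of d d'] this[of d' d] assms show ?thesis by (meson linorder_neqE_linordered_idom)
qed

lemma positive_denominator_has_denominator_vector:
  assumes "positive_denominator z d"
  shows "has_denominator_vector n m x z d"
proof -
  obtain a where a: "a \<in> R" "\<forall>i\<in>{1..n}. spec i a > 0" "z = a / (\<Prod>i\<in>{1..n}. x i powi d i)"
    using assms unfolding positive_denominator_def by blast
  have "a \<noteq> x i * b" if "i \<in> {1..n}" "b \<in> R" for i b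
    using a(2) that spec_mult[of i "x i" b] R_x[of i] spec_x[of i i] le by force
  then show ?thesis unfolding has_denominator_vector_def using a by blast
qed

end

section \<open>Shear coordinates under a flip\<close>

definition ind :: "nat set \<Rightarrow> nat set \<Rightarrow> int" where
  "ind e f = (if e = f then 1 else 0)"

text \<open>The tropical cross-ratio of the quadrilateral around \<open>{a,c}\<close>. For
  \<open>w = ind e\<close> it is the signed adjacency of \<open>e\<close> and \<open>{a,c}\<close>,
  with \<open>e\<close> as the row and \<open>{a,c}\<close> as the column.\<close>

definition shear :: "(nat set \<Rightarrow> int) \<Rightarrow> nat \<Rightarrow> nat \<Rightarrow> nat \<Rightarrow> nat \<Rightarrow> int" where
  "shear w a b c d = w {a,b} + w {c,d} - w {b,c} - w {d,a}"

definition tropical_ptolemy :: "(nat set \<Rightarrow> int) \<Rightarrow> nat \<Rightarrow> nat \<Rightarrow> nat \<Rightarrow> nat \<Rightarrow> bool" where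
  "tropical_ptolemy w a b c d \<longleftrightarrow>
     w {a,c} + w {b,d} = min (w {a,b} + w {c,d}) (w {b,c} + w {d,a})"

lemma shear_rotate: "shear w c d a b = shear w a b c d"
  by (simp add: shear_def insert_commute)

lemma tropical_ptolemy_rotate: "tropical_ptolemy w c d a b \<longleftrightarrow> tropical_ptolemy w a b c d"
  by (simp add: tropical_ptolemy_def insert_commute add.commute)

lemma quad_rotate: "quad E a b c d \<Longrightarrow> quad E c d a b"
  unfolding quad_def by (simp add: insert_commute)

lemma quadD:
  assumes "quad E a b c d"
  shows "cyc a b c" "cyc c d a" "{a,b} \<in> E" "{b,c} \<in> E" "{c,d} \<in> E" "{d,a} \<in> E" "{a,c} \<in> E"
  using assms unfolding quad_def by simp_all

lemma quad_distinct:
  assumes "quad E a b c d"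
  shows "a \<noteq> b" "b \<noteq> c" "c \<noteq> d" "d \<noteq> a" "a \<noteq> c" "b \<noteq> d"
  using assms cyc_distinct cyc_opposite unfolding quad_def by blast+

lemma ord_quad: "cyc a b c \<Longrightarrow> cyc c d a \<Longrightarrow> cyc b c d \<and> cyc d a b"
  unfolding cyc_real eq_real by (smt (verit))

text \<open>The relation between the shears of an arc \<open>{u,v}\<close> before and after the flip of \<open>{a,c}\<close>;
  \<open>\<sigma>\<close> is the corresponding entry of the exchange matrix.\<close>

definition shear_transfer ::
  "nat set set \<Rightarrow> nat \<Rightarrow> nat \<Rightarrow> nat \<Rightarrow> nat \<Rightarrow> nat \<Rightarrow> nat \<Rightarrow> nat \<Rightarrow> nat \<Rightarrow> bool" where
  "shear_transfer E a b c d u s v t \<longleftrightarrow> (\<exists>u' s' v' t' \<sigma>. quad E u' s' v' t' \<and> {u',v'} = {u,v} \<and>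
     shear (ind {a,c}) u' s' v' t' = \<sigma> \<and> shear (ind {b,d}) u s v t = - \<sigma> \<and>
     (\<forall>w. tropical_ptolemy w a b c d \<longrightarrow> shear w u s v t = shear w u' s' v' t' +
        sgn (shear w a b c d) * max (shear w a b c d * \<sigma>) 0))"

lemma shear_transfer_rotate: "shear_transfer E c d a b u s v t \<Longrightarrow> shear_transfer E a b c d u s v t"
  unfolding shear_transfer_def
  by (simp only: shear_rotate[of _ c d a b] tropical_ptolemy_rotate[of _ c d a b] insert_commute[of c a] insert_commute[of d b])

lemma shear_transfer_rotate': "shear_transfer E a b c d v t u s \<Longrightarrow> shear_transfer E a b c d u s v t"
  unfolding shear_transfer_def
  by (simp only: shear_rotate[of _ v t u s] insert_commute[of v u])

context triangulation
begin

lemma flip_edge_iff: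
  "e \<in> insert {b,d} (E - {{a,c}}) \<longleftrightarrow> e = {b,d} \<or> e \<in> E \<and> e \<noteq> {a,c}"
  by blast

lemma flip_quad:
  assumes q: "quad E a b c d"
  shows "quad (insert {b,d} (E - {{a,c}})) b c d a"
proof -
  note dq = quad_distinct[OF q]
  have cy: "cyc a b c" "cyc c d a" using q by (simp_all add: quad_def)
  have c: "cyc b c d" "cyc d a b" using ord_quad[OF cy] by blast+
  have "{a,b} \<noteq> {a,c}" "{b,c} \<noteq> {a,c}" "{c,d} \<noteq> {a,c}" "{d,a} \<noteq> {a,c}"
    using dq by (simp_all add: doubleton_eq_iff)
  then show ?thesis using q c unfolding quad_def by simp
qed

text \<open>Here the new diagonal is the side from \<open>u\<close> to \<open>s\<close>. The flipped
  triangulation has the triangle \<open>a b d\<close> there, so \<open>v = a\<close>. Before the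
  flip the apex on that side was \<open>c\<close> instead of \<open>d\<close>, and the tropical
  relation, split by the sign of the shear at \<open>{a,c}\<close>, compares the two shears.\<close>

lemma shear_transfer_side1:
  assumes q: "quad E a b c d" and q': "quad (insert {b,d} (E - {{a,c}})) b d v t"
  shows "shear_transfer E a b c d b d v t"
proof -
  interpret E': triangulation N "insert {b,d} (E - {{a,c}})" by (rule flip[OF q])
  note dq = quad_distinct[OF q] and dq' = quad_distinct[OF q']
  have cy: "cyc a b c" "cyc c d a" "cyc b d v" "cyc v t b" using q q' by (simp_all add: quad_def)
  have cd: "cyc d a b" using ord_quad[OF cy(1,2)] by (rule conjunct2)
  have cd': "cyc d v b" using cy(3) cyc_rotate by blast
  have v: "v = a"
    using E'.triangle_unique[OF quadD(4)[OF q'] E'.edge_sym[OF quadD(7)[OF q']] quadD(5,6)[OF flip_quad[OF q]] cd' cd] .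
  have t: "t \<noteq> c" "t \<noteq> d" using cy unfolding v cyc_def by linarith+
  have E: "{a,t} \<in> E" "{t,b} \<in> E"
    using q' dq dq' t unfolding quad_def flip_edge_iff v by (simp_all add: doubleton_eq_iff)
  have qn: "quad E b c a t"
    using q cy cyc_rotate[of a b c] E unfolding quad_def v by (simp add: insert_commute)
  have 1: "shear (ind {a,c}) b c a t = - 1" "shear (ind {b,d}) b d v t = - (- 1)"
    unfolding v shear_def ind_def using dq dq' t v by (simp_all add: doubleton_eq_iff)
  have 2: "shear w b d v t = shear w b c a t + sgn (shear w a b c d) * max (shear w a b c d * - 1) 0"
    if "tropical_ptolemy w a b c d" for w
    using that unfolding v shear_def tropical_ptolemy_def
    by (cases "shear w a b c d < 0") (simp_all add: shear_def insert_commute min_def max_def sgn_if split: if_splits)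
  show ?thesis unfolding shear_transfer_def
    using qn 1 2 v by (intro exI[of _ b] exI[of _ c] exI[of _ a] exI[of _ t] exI[of _ "- 1"]) simp
qed

lemma shear_transfer_side2:
  assumes q: "quad E a b c d" and q': "quad (insert {b,d} (E - {{a,c}})) u b d t"
  shows "shear_transfer E a b c d u b d t"
proof -
  interpret E': triangulation N "insert {b,d} (E - {{a,c}})" by (rule flip[OF q])
  note dq = quad_distinct[OF q] and dq' = quad_distinct[OF q']
  have cy: "cyc a b c" "cyc c d a" "cyc u b d" "cyc d t u" using q q' by (simp_all add: quad_def)
  have cd: "cyc d a b" using ord_quad[OF cy(1,2)] by (rule conjunct2)
  have cd': "cyc d u b" using cy(3) cyc_rotate by blast
  have u: "u = a"
    using E'.triangle_unique[OF E'.edge_sym[OF quadD(7)[OF q']] quadD(3)[OF q'] quadD(5,6)[OF flip_quad[OF q]] cd' cd] .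
  have t: "t \<noteq> c" "t \<noteq> b" using cy unfolding u cyc_def by linarith+
  have E: "{d,t} \<in> E" "{t,a} \<in> E"
    using q' dq dq' t unfolding quad_def flip_edge_iff u by (simp_all add: doubleton_eq_iff)
  have qn: "quad E a c d t"
    using q cy E unfolding quad_def u by (simp add: insert_commute cyc_rotate[of a c d])
  have 1: "shear (ind {a,c}) a c d t = 1" "shear (ind {b,d}) u b d t = - 1"
    unfolding u shear_def ind_def using dq dq' t u by (simp_all add: doubleton_eq_iff)
  have 2: "shear w u b d t = shear w a c d t + sgn (shear w a b c d) * max (shear w a b c d * 1) 0"
    if "tropical_ptolemy w a b c d" for w
    using that unfolding u shear_def tropical_ptolemy_def
    by (cases "shear w a b c d < 0") (simp_all add: shear_def insert_commute min_def max_def sgn_if split: if_splits)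
  show ?thesis unfolding shear_transfer_def
    using qn 1 2 u by (intro exI[of _ a] exI[of _ c] exI[of _ d] exI[of _ t] exI[of _ 1]) simp
qed

text \<open>Half turns of either quadrilateral reduce the four sides at which \<open>{b,d}\<close>
  may occur to two. If it occurs at none, the quadrilateral of \<open>{u,v}\<close> is unchanged and
  \<sigma> is 0.\<close>

lemma shear_transfer:
  assumes q: "quad E a b c d" and q': "quad (insert {b,d} (E - {{a,c}})) u s v t" and ne: "{u,v} \<noteq> {b,d}"
  shows "shear_transfer E a b c d u s v t"
proof -
  have comm: "insert {d,b} (E - {{c,a}}) = insert {b,d} (E - {{a,c}})" by (simp add: insert_commute)
  have A: "shear_transfer E a b c d u s v t"
    if "{u,s} = {b,d}" "quad (insert {b,d} (E - {{a,c}})) u s v t" for u s v t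
  proof -
    from that(1) consider "u = b" "s = d" | "u = d" "s = b" by (auto simp: doubleton_eq_iff)
    then show ?thesis
    proof cases
      case 1 then show ?thesis using shear_transfer_side1[OF q] that(2) by simp
    next
      case 2 then show ?thesis
        using shear_transfer_rotate[OF triangulation.shear_transfer_side1[OF triangulation_axioms quad_rotate[OF q]]] that(2) comm
        by simp
    qed
  qed
  have B: "shear_transfer E a b c d u s v t"
    if "{s,v} = {b,d}" "quad (insert {b,d} (E - {{a,c}})) u s v t" for u s v t
  proof -
    from that(1) consider "s = b" "v = d" | "s = d" "v = b" by (auto simp: doubleton_eq_iff)
    then show ?thesis
    proof cases
      case 1 then show ?thesis using shear_transfer_side2[OF q] that(2) by simp
    next
      case 2 then show ?thesis
        using shear_transfer_rotate[OF triangulation.shear_transfer_side2[OF triangulation_axioms quad_rotate[OF q]]] that(2) comm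
        by simp
    qed
  qed
  consider "{u,s} = {b,d}" | "{s,v} = {b,d}" | "{v,t} = {b,d}" | "{t,u} = {b,d}"
    | "{u,s} \<noteq> {b,d}" "{s,v} \<noteq> {b,d}" "{v,t} \<noteq> {b,d}" "{t,u} \<noteq> {b,d}" by blast
  then show ?thesis
  proof cases
    case 1 then show ?thesis using A q' by blast
  next
    case 2 then show ?thesis using B q' by blast
  next
    case 3 then show ?thesis using A[OF _ quad_rotate[OF q']] shear_transfer_rotate' by blast
  next
    case 4 then show ?thesis using B[OF _ quad_rotate[OF q']] shear_transfer_rotate' by blast
  next
    case 5
    have *: "e \<in> E \<and> e \<noteq> {a,c}" if "e \<in> insert {b,d} (E - {{a,c}})" "e \<noteq> {b,d}" for e
      using that by simp
    have qn: "quad E u s v t" and ac: "{u,s} \<noteq> {a,c}" "{s,v} \<noteq> {a,c}" "{v,t} \<noteq> {a,c}" "{t,u} \<noteq> {a,c}"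
      using *[OF quadD(3)[OF q'] 5(1)] *[OF quadD(4)[OF q'] 5(2)] *[OF quadD(5)[OF q'] 5(3)]
        *[OF quadD(6)[OF q'] 5(4)] *[OF quadD(7)[OF q'] ne] quadD(1,2)[OF q'] unfolding quad_def by simp_all
    have "shear (ind {a,c}) u s v t = 0" "shear (ind {b,d}) u s v t = - 0"
      unfolding shear_def ind_def using ac[THEN not_sym] 5[THEN not_sym] by simp_all
    then show ?thesis unfolding shear_transfer_def
      using qn by (intro exI[of _ u] exI[of _ s] exI[of _ v] exI[of _ t] exI[of _ 0]) simp
  qed
qed

end

text \<open>An edge is at most one of the four sides, so one of the two sums is 0 and the minimum
  vanishes. This lets principal rows be mutated like coefficient rows.\<close>

lemma tropical_ptolemy_ind:
  assumes q: "quad E a b c d" and "e \<noteq> {a,c}" "e \<noteq> {b,d}"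
  shows "tropical_ptolemy (ind e) a b c d"
proof -
  have "{a,b} \<noteq> {b,c}" "{a,b} \<noteq> {c,d}" "{a,b} \<noteq> {d,a}" "{b,c} \<noteq> {c,d}" "{b,c} \<noteq> {d,a}" "{c,d} \<noteq> {d,a}"
    using quad_distinct[OF q] by (simp_all add: doubleton_eq_iff)
  then show ?thesis
    unfolding tropical_ptolemy_def ind_def using assms(2,3) by (simp split: if_split)
qed

section \<open>The polygon model of a cluster pattern\<close>

text \<open>One formula for all rows. For \<open>r \<le> n\<close> the function depends on the
  current labeling \<open>D\<close>, whereas \<open>w r\<close> is the same in every seed.\<close>

definition row :: "nat \<Rightarrow> (nat \<Rightarrow> nat set) \<Rightarrow> (nat \<Rightarrow> nat set \<Rightarrow> int) \<Rightarrow> nat \<Rightarrow> nat set \<Rightarrow> int" where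
  "row n D w r = (if r \<le> n then ind (D r) else w r)"

text \<open>Geometric model of the pattern: \<open>D j\<close> is the diagonal labeled \<open>j\<close>, and \<open>P\<close>, \<open>w r\<close> are
  lambda lengths and the (negated) tropical lambda lengths of the coefficient row \<open>r\<close>.\<close>

lemma fun_upd_image_inj: "inj_on f A \<Longrightarrow> k \<in> A \<Longrightarrow> f(k := e) ` A = insert e (f ` A - {f k})"
  by (auto simp: inj_on_def)

lemma insert_Diff_disjoint: "A \<inter> B = {} \<Longrightarrow> e \<notin> B \<Longrightarrow> insert e (A - C) \<inter> B = {}"
  by blast

locale polygon_model =
  fixes n m N :: nat and F :: "'a::field_char_0 set" and \<Sigma> :: "nat list \<Rightarrow> 'a seed"
    and w :: "nat \<Rightarrow> nat set \<Rightarrow> int" and P :: "nat set \<Rightarrow> 'a" and fr :: "nat \<Rightarrow> 'a"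
  assumes le: "n \<le> m" and N: "0 < N"
    and pattern: "cluster_pattern F n m \<Sigma>"
    and trop: "r \<in> {n+1..m} \<Longrightarrow> cyc a b c \<Longrightarrow> cyc c d a \<Longrightarrow> a \<le> N \<Longrightarrow> b \<le> N \<Longrightarrow> c \<le> N \<Longrightarrow> d \<le> N \<Longrightarrow>
      tropical_ptolemy (w r) a b c d"
    and ptolemy: "cyc a b c \<Longrightarrow> cyc c d a \<Longrightarrow> a \<le> N \<Longrightarrow> b \<le> N \<Longrightarrow> c \<le> N \<Longrightarrow> d \<le> N \<Longrightarrow>
      P {a,c} * P {b,d} = P {a,b} * P {c,d} + P {b,c} * P {d,a}"
    and fr_nonzero: "r \<in> {n+1..m} \<Longrightarrow> fr r \<noteq> 0"
    and P_boundary: "e \<in> boundary N \<Longrightarrow> P e = (\<Prod>r\<in>{n+1..m}. fr r powi w r e)"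
begin

text \<open>The coefficient monomial by which the lambda length has to be divided. On a side of the
  polygon it equals \<open>P e\<close>, so that sides contribute the trivial variable 1.\<close>

definition W :: "nat set \<Rightarrow> 'a" where
  "W e = (\<Prod>r\<in>{n+1..m}. fr r powi w r e)"

lemma W_nonzero: "W e \<noteq> 0"
  unfolding W_def using fr_nonzero by auto

text \<open>Quantifying over all \<open>quad\<close> tuples imposes one condition for each column,
  because the shear is invariant under the half turn. The equation for the variables involves the
  diagonal only, which makes their values independent of the seed.\<close>

definition models :: "nat list \<Rightarrow> (nat \<Rightarrow> nat set) \<Rightarrow> bool" where
  "models t D \<longleftrightarrow> inj_on D {1..n} \<and> D ` {1..n} \<inter> boundary N = {} \<and>
     triangulation N (D ` {1..n} \<union> boundary N) \<and>
     (\<forall>j\<in>{1..n}. \<forall>a b c d. quad (D ` {1..n} \<union> boundary N) a b c d \<and> D j = {a,c} \<longrightarrow>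
        (\<forall>r\<in>{1..m}. snd (\<Sigma> t) r j = shear (row n D w r) a b c d)) \<and>
     (\<forall>j\<in>{1..n}. fst (\<Sigma> t) j * W (D j) = P (D j)) \<and> (\<forall>r\<in>{n+1..m}. fst (\<Sigma> t) r = fr r)"

text \<open>For x and y the sums over the two pairs of opposite sides,
  \<open>max (x - y) 0 + min x y = x\<close>, where the minimum is the sum over the diagonals by the
  tropical relation.\<close>

lemma frozen_coefficient:
  assumes "cyc a b c" "cyc c d a" "a \<le> N" "b \<le> N" "c \<le> N" "d \<le> N"
  shows "(\<Prod>r\<in>{n+1..m}. fr r ^ nat (max (shear (w r) a b c d) 0)) * (W {a,c} * W {b,d}) = W {a,b} * W {c,d}"
    and "(\<Prod>r\<in>{n+1..m}. fr r ^ nat (max (- shear (w r) a b c d) 0)) * (W {a,c} * W {b,d}) = W {b,c} * W {d,a}"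
proof -
  have pw: "x ^ nat (max k 0) = x powi max k 0" for x :: 'a and k
    by (simp add: power_int_def)
  have e: "max (shear (w r) a b c d) 0 + w r {a,c} + w r {b,d} = w r {a,b} + w r {c,d}"
    "max (- shear (w r) a b c d) 0 + w r {a,c} + w r {b,d} = w r {b,c} + w r {d,a}" if "r \<in> {n+1..m}" for r
    using trop[OF that assms] unfolding tropical_ptolemy_def shear_def by linarith+
  show "(\<Prod>r\<in>{n+1..m}. fr r ^ nat (max (shear (w r) a b c d) 0)) * (W {a,c} * W {b,d}) = W {a,b} * W {c,d}"
    unfolding W_def prod.distrib[symmetric] pw
    using e(1) fr_nonzero by (intro prod.cong) (simp_all flip: power_int_add add: mult.assoc add.assoc)
  show "(\<Prod>r\<in>{n+1..m}. fr r ^ nat (max (- shear (w r) a b c d) 0)) * (W {a,c} * W {b,d}) = W {b,c} * W {d,a}"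
    unfolding W_def prod.distrib[symmetric] pw
    using e(2) fr_nonzero by (intro prod.cong) (simp_all flip: power_int_add add: mult.assoc add.assoc)
qed

lemma mutable_part:
  assumes q: "quad E a b c d"
  shows "(\<Prod>i\<in>{1..n}. x i ^ nat (max (shear (ind (D i)) a b c d) 0)) =
      (\<Prod>i\<in>{1..n}. if D i = {a,b} then x i else 1) * (\<Prod>i\<in>{1..n}. if D i = {c,d} then x i else (1::'a))"
    and "(\<Prod>i\<in>{1..n}. x i ^ nat (max (- shear (ind (D i)) a b c d) 0)) =
      (\<Prod>i\<in>{1..n}. if D i = {b,c} then x i else 1) * (\<Prod>i\<in>{1..n}. if D i = {d,a} then x i else (1::'a))"
proof -
  have ne: "{a,b} \<noteq> {b,c}" "{a,b} \<noteq> {c,d}" "{a,b} \<noteq> {d,a}" "{b,c} \<noteq> {c,d}" "{b,c} \<noteq> {d,a}" "{c,d} \<noteq> {d,a}"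
    using quad_distinct[OF q] by (simp_all add: doubleton_eq_iff)
  show "(\<Prod>i\<in>{1..n}. x i ^ nat (max (shear (ind (D i)) a b c d) 0)) =
      (\<Prod>i\<in>{1..n}. if D i = {a,b} then x i else 1) * (\<Prod>i\<in>{1..n}. if D i = {c,d} then x i else (1::'a))"
    unfolding prod.distrib[symmetric] using ne
    by (intro prod.cong) (simp_all add: shear_def ind_def split: if_split)
  show "(\<Prod>i\<in>{1..n}. x i ^ nat (max (- shear (ind (D i)) a b c d) 0)) =
      (\<Prod>i\<in>{1..n}. if D i = {b,c} then x i else 1) * (\<Prod>i\<in>{1..n}. if D i = {d,a} then x i else (1::'a))"
    unfolding prod.distrib[symmetric] using ne
    by (intro prod.cong) (simp_all add: shear_def ind_def split: if_split)
qed

lemma models_edge_value: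
  assumes M: "models t D" and e: "e \<in> D ` {1..n} \<union> boundary N"
  shows "(\<Prod>i\<in>{1..n}. if D i = e then fst (\<Sigma> t) i else 1) * W e = P e"
proof (cases "e \<in> D ` {1..n}")
  case True
  then obtain j where j: "j \<in> {1..n}" "e = D j" by blast
  have "(\<Prod>i\<in>{1..n}. if D i = e then fst (\<Sigma> t) i else 1) = (\<Prod>i\<in>{1..n}. if i = j then fst (\<Sigma> t) j else 1)"
    using M j unfolding models_def by (intro prod.cong) (auto dest: inj_onD)
  also have "\<dots> = fst (\<Sigma> t) j" using j by simp
  finally show ?thesis using M j unfolding models_def by simp
next
  case False
  then have "(\<Prod>i\<in>{1..n}. if D i = e then fst (\<Sigma> t) i else 1) = 1"
    by (intro prod.neutral) auto
  then show ?thesis using False e P_boundary unfolding W_def by simp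
qed

lemma split_range: "(\<Prod>i\<in>{1..m}. f i) = (\<Prod>i\<in>{1..n}. f i) * (\<Prod>r\<in>{n+1..m}. f r)" for f :: "nat \<Rightarrow> 'a"
proof -
  have "{1..m} = {1..n} \<union> {n+1..m}" using le by auto
  then show ?thesis by (simp add: prod.union_disjoint)
qed

text \<open>Multiplied by \<open>W {a,c} * W {b,d}\<close>, the two monomials of the exchange
  relation become the products of lambda lengths of opposite sides. The Ptolemy relation then
  applies and \<open>P {a,c}\<close> is cancelled.\<close>

lemma models_exchange:
  assumes M: "models t D" and k: "k \<in> {1..n}" and Dk: "D k = {a,c}"
    and q: "quad (D ` {1..n} \<union> boundary N) a b c d" and x: "fst (\<Sigma> t) k \<noteq> 0"
  shows "exchanged_variable m k (\<Sigma> t) * W {b,d} = P {b,d}"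
proof -
  let ?E = "D ` {1..n} \<union> boundary N"
  let ?x = "fst (\<Sigma> t)"
  let ?X = "\<lambda>e. \<Prod>i\<in>{1..n}. if D i = e then ?x i else 1"
  interpret triangulation N ?E using M by (simp add: models_def)
  have col: "snd (\<Sigma> t) r k = shear (row n D w r) a b c d" if "r \<in> {1..m}" for r
    using M k Dk q that unfolding models_def by blast
  have bd: "a \<le> N" "b \<le> N" "c \<le> N" "d \<le> N" using edge[OF quadD(3)[OF q]] edge[OF quadD(5)[OF q]] by simp_all
  note fc = frozen_coefficient[OF quadD(1,2)[OF q] bd]
  have fz: "(\<Prod>r\<in>{n+1..m}. ?x r ^ nat (max (f (snd (\<Sigma> t) r k)) 0)) = (\<Prod>r\<in>{n+1..m}. fr r ^ nat (max (f (shear (w r) a b c d)) 0))" for f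
    using M col unfolding models_def by (intro prod.cong) (auto simp: row_def)
  have mu: "(\<Prod>i\<in>{1..n}. ?x i ^ nat (max (f (snd (\<Sigma> t) i k)) 0)) = (\<Prod>i\<in>{1..n}. ?x i ^ nat (max (f (shear (ind (D i)) a b c d)) 0))" for f
    using col le by (intro prod.cong) (auto simp: row_def)
  have pos: "(\<Prod>i\<in>{1..m}. ?x i ^ nat (max (snd (\<Sigma> t) i k) 0)) * (W {a,c} * W {b,d}) = P {a,b} * P {c,d}"
    unfolding split_range fz[of "\<lambda>z. z"] mu[of "\<lambda>z. z"] mutable_part(1)[OF q] mult.assoc fc(1)
    using models_edge_value[OF M quadD(3)[OF q]] models_edge_value[OF M quadD(5)[OF q]] by (simp add: mult_ac)
  have neg: "(\<Prod>i\<in>{1..m}. ?x i ^ nat (max (- snd (\<Sigma> t) i k) 0)) * (W {a,c} * W {b,d}) = P {b,c} * P {d,a}"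
    unfolding split_range fz[of uminus] mu[of uminus] mutable_part(2)[OF q] mult.assoc fc(2)
    using models_edge_value[OF M quadD(4)[OF q]] models_edge_value[OF M quadD(6)[OF q]] by (simp add: mult_ac)
  have xk: "?x k * W {a,c} = P {a,c}" using M k Dk unfolding models_def by metis
  have "exchanged_variable m k (\<Sigma> t) * ?x k =
     (\<Prod>i\<in>{1..m}. ?x i ^ nat (max (snd (\<Sigma> t) i k) 0)) + (\<Prod>i\<in>{1..m}. ?x i ^ nat (max (- snd (\<Sigma> t) i k) 0))"
    using x by (simp add: exchanged_variable_def split_beta)
  then have "exchanged_variable m k (\<Sigma> t) * ?x k * (W {a,c} * W {b,d}) = P {a,c} * P {b,d}"
    using pos neg ptolemy[OF quadD(1,2)[OF q] bd] by (simp add: distrib_right)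
  then have "(exchanged_variable m k (\<Sigma> t) * W {b,d}) * P {a,c} = P {b,d} * P {a,c}"
    by (simp add: xk[symmetric] mult_ac)
  moreover have "P {a,c} \<noteq> 0" using xk x W_nonzero by (metis mult_eq_0_iff)
  ultimately show ?thesis by simp
qed

lemma models_flip:
  assumes M: "models t D" and k: "k \<in> {1..n}" and Dk: "D k = {a,c}"
    and q: "quad (D ` {1..n} \<union> boundary N) a b c d" and x: "fst (\<Sigma> t) k \<noteq> 0"
    and mut: "seed_mutation n m k (\<Sigma> t) (\<Sigma> t')"
  shows "models t' (D(k := {b,d}))"
proof -
  let ?E = "D ` {1..n} \<union> boundary N"
  let ?D = "D(k := {b,d})"
  let ?B = "snd (\<Sigma> t)" and ?B' = "snd (\<Sigma> t')"
  interpret triangulation N ?E using M by (simp add: models_def)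
  have inj: "inj_on D {1..n}" and disj: "D ` {1..n} \<inter> boundary N = {}" using M by (auto simp: models_def)
  have "sep a c b d" using quadD(1,2)[OF q] by (simp add: sep_def)
  then have bdE: "{b,d} \<notin> ?E" using not_sep quadD(7)[OF q] by blast
  have "D k \<in> D ` {1..n}" using k by blast
  then have ac: "{a,c} \<notin> boundary N" using disj unfolding Dk disjoint_iff by blast
  have img: "?D ` {1..n} = insert {b,d} (D ` {1..n} - {{a,c}})"
    using fun_upd_image_inj[OF inj k] Dk by simp
  have E': "?D ` {1..n} \<union> boundary N = insert {b,d} (?E - {{a,c}})"
    unfolding img using ac by auto
  have B': "?B' i j = mutate_matrix k ?B i j" if "i \<in> {1..m}" "j \<in> {1..n}" for i j
    using mut that unfolding seed_mutation_def matrix_agree_def by blast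
  have col: "?B r j = shear (row n D w r) u s v t" if "r \<in> {1..m}" "j \<in> {1..n}" "D j = {u,v}" "quad ?E u s v t" for r j u s v t
    using M that unfolding models_def by blast
  have Bk: "?B r k = shear (row n D w r) a b c d" if "r \<in> {1..m}" for r
    using col[OF that k Dk q] .
  have row': "row n ?D w r = row n D w r" if "r \<noteq> k" for r
    using that by (auto simp: row_def)
  have rowk: "row n ?D w k = ind {b,d}" "row n D w k = ind {a,c}"
    using k Dk by (auto simp: row_def)
  \<comment> \<open>Row \<open>k\<close> is exempt: its function passes from the indicator of
    \<open>{a,c}\<close> to that of \<open>{b,d}\<close>, and neither satisfies the
    relation.\<close>
  have tr: "tropical_ptolemy (row n D w r) a b c d" if r: "r \<in> {1..m}" "r \<noteq> k" for r
  proof (cases "r \<le> n")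
    case True
    have rn: "r \<in> {1..n}" using r True by simp
    have "D r \<noteq> {a,c}" using inj_onD[OF inj _ rn k] r(2) Dk by metis
    moreover have "D r \<in> ?E" using rn by blast
    then have "D r \<noteq> {b,d}" using bdE by metis
    ultimately show ?thesis using tropical_ptolemy_ind[OF q] True by (simp add: row_def)
  next
    case False
    have "a \<le> N" "b \<le> N" "c \<le> N" "d \<le> N" using edge[OF quadD(3)[OF q]] edge[OF quadD(5)[OF q]] by simp_all
    then show ?thesis using trop[of r] quadD(1,2)[OF q] False r by (simp add: row_def)
  qed
  have km: "k \<in> {1..m}" using k le by auto
  have shears: "?B' r j = shear (row n ?D w r) u s v t"
    if j: "j \<in> {1..n}" "?D j = {u,v}" and q': "quad (insert {b,d} (?E - {{a,c}})) u s v t" and r: "r \<in> {1..m}" for j u s v t r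
  proof (cases "j = k")
    case True
    then have uv: "{u,v} = {b,d}" using j by simp
    interpret E': triangulation N "insert {b,d} (?E - {{a,c}})" by (rule flip[OF q])
    \<comment> \<open>The quadrilateral of the new diagonal is a quarter turn of the old one. This
      reverses the sign of the shear, as mutation does in column \<open>k\<close>.\<close>
    have "shear g u s v t = shear g b c d a" for g
      using E'.quad_unique[OF flip_quad[OF q] q'] uv shear_rotate[of g d a b c] by metis
    moreover have "shear g b c d a = - shear g a b c d" for g
      by (simp add: shear_def)
    ultimately have 1: "shear (row n ?D w r) u s v t = - shear (row n ?D w r) a b c d" by simp
    have "?B' r j = - shear (row n D w r) a b c d"
      using B'[OF r] j True Bk[OF r] by (simp add: mutate_matrix_def)
    moreover have "shear (row n ?D w k) a b c d = shear (row n D w k) a b c d"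
    proof -
      have "{a,b} \<noteq> {a,c}" "{b,c} \<noteq> {a,c}" "{c,d} \<noteq> {a,c}" "{d,a} \<noteq> {a,c}"
        "{a,b} \<noteq> {b,d}" "{b,c} \<noteq> {b,d}" "{c,d} \<noteq> {b,d}" "{d,a} \<noteq> {b,d}"
        using quad_distinct[OF q] by (simp_all add: doubleton_eq_iff)
      from this[THEN not_sym] show ?thesis unfolding rowk shear_def ind_def by simp
    qed
    ultimately show ?thesis using 1 row' by (cases "r = k") simp_all
  next
    case False
    then have Dj: "D j = {u,v}" using j(2) by simp
    have "D j \<in> ?E" using j(1) by blast
    then have ne: "{u,v} \<noteq> {b,d}" using bdE Dj by metis
    obtain u' s' v' t' \<sigma> where st: "quad ?E u' s' v' t'" "{u',v'} = {u,v}"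
      "shear (ind {a,c}) u' s' v' t' = \<sigma>" "shear (ind {b,d}) u s v t = - \<sigma>"
      and tw: "\<And>g. tropical_ptolemy g a b c d \<Longrightarrow> shear g u s v t = shear g u' s' v' t' +
        sgn (shear g a b c d) * max (shear g a b c d * \<sigma>) 0"
      using shear_transfer[OF q q' ne] unfolding shear_transfer_def by blast
    have Bj: "?B i j = shear (row n D w i) u' s' v' t'" if "i \<in> {1..m}" for i
      using col[OF that j(1) _ st(1)] Dj st(2) by simp
    have sig: "?B k j = \<sigma>" using Bj[OF km] rowk(2) st(3) by simp
    show ?thesis
    proof (cases "r = k")
      case True
      then have "?B' r j = - \<sigma>" using B'[OF r j(1)] sig by (simp add: mutate_matrix_def)
      then show ?thesis using True rowk st(4) by simp
    next
      case rk: False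
      have "?B' r j = ?B r j + sgn (?B r k) * max (?B r k * ?B k j) 0"
        using B'[OF r j(1)] rk False by (simp add: mutate_matrix_def)
      then show ?thesis using tw[OF tr[OF r rk]] Bj[OF r] Bk[OF r] sig row'[OF rk] by simp
    qed
  qed
  have xs: "fst (\<Sigma> t') i = (if i = k then exchanged_variable m k (\<Sigma> t) else fst (\<Sigma> t) i)" if "i \<in> {1..m}" for i
    using mut that unfolding seed_mutation_def by blast
  show ?thesis unfolding models_def E'
  proof (intro conjI ballI allI impI)
    show "inj_on ?D {1..n}"
      using bdE by (intro inj_on_fun_updI[OF inj]) simp
    show "?D ` {1..n} \<inter> boundary N = {}"
      unfolding img using bdE by (intro insert_Diff_disjoint[OF disj]) simp
    show "triangulation N (insert {b,d} (?E - {{a,c}}))" by (rule flip[OF q])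
    fix j assume j: "j \<in> {1..n}"
    show "snd (\<Sigma> t') r j = shear (row n ?D w r) u s v t''"
      if "quad (insert {b,d} (?E - {{a,c}})) u s v t'' \<and> ?D j = {u,v}" "r \<in> {1..m}" for u s v t'' r
      using shears[OF j] that by blast
    show "fst (\<Sigma> t') j * W (?D j) = P (?D j)"
    proof (cases "j = k")
      case True
      then show ?thesis using models_exchange[OF M k Dk q x] xs[OF km] by simp
    next
      case False
      then show ?thesis using xs[of j] j le M unfolding models_def by auto
    qed
  next
    fix r assume "r \<in> {n+1..m}"
    then show "fst (\<Sigma> t') r = fr r" using xs[of r] k M unfolding models_def by auto
  qed
qed

end

section \<open>Walking in the tree and undoing mutations\<close>

lemma tree_edge_sym: "tree_edge n k t t' \<Longrightarrow> tree_edge n k t' t"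
  by (auto simp: tree_edge_def)

lemma neighbour_exists:
  assumes "t \<in> tree_verts n" "k \<in> {1..n}"
  obtains t' where "tree_edge n k t t'" "t' \<in> tree_verts n"
proof (cases "\<exists>s. t = k # s")
  case True
  then obtain s where s: "t = k # s" by blast
  then have "s \<in> tree_verts n" using assms by (auto simp: tree_verts_def distinct_adj_Cons)
  then show ?thesis using that[of s] s assms by (simp add: tree_edge_def)
next
  case False
  then have "k # t \<in> tree_verts n" using assms by (cases t) (auto simp: tree_verts_def)
  then show ?thesis using that[of "k # t"] assms by (simp add: tree_edge_def)
qed

lemma mutate_matrix_involutive: "mutate_matrix k (mutate_matrix k B) = B"
  by (intro ext) (auto simp: mutate_matrix_def sgn_if)

lemma mutate_matrix_agree:
  assumes "matrix_agree n n B B'" "k \<in> {1..n}"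
  shows "matrix_agree n n (mutate_matrix k B) (mutate_matrix k B')"
  using assms unfolding matrix_agree_def mutate_matrix_def by simp

lemma matrix_agree_mono: "n \<le> m \<Longrightarrow> matrix_agree m n B B' \<Longrightarrow> matrix_agree n n B B'"
  unfolding matrix_agree_def by auto

lemma matrix_agree_trans: "matrix_agree m n A B \<Longrightarrow> matrix_agree m n B C \<Longrightarrow> matrix_agree m n A C"
  unfolding matrix_agree_def by simp

lemma pattern_le: "cluster_pattern F n m \<Sigma> \<Longrightarrow> n \<le> m"
proof -
  assume "cluster_pattern F n m \<Sigma>"
  moreover have "[] \<in> tree_verts n" by (simp add: tree_verts_def)
  ultimately show ?thesis unfolding cluster_pattern_def labeled_seed_def by blast
qed

text \<open>The last mutation of the sequence is the first to be undone, hence the induction from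
  the end of the list.\<close>

lemma reach_matrix:
  assumes pat: "cluster_pattern F n m \<Sigma>"
  shows "set ks \<subseteq> {1..n} \<Longrightarrow> t \<in> tree_verts n \<Longrightarrow> matrix_agree n n (snd (\<Sigma> t)) (fold mutate_matrix ks M) \<Longrightarrow>
    \<exists>t'\<in>tree_verts n. matrix_agree n n (snd (\<Sigma> t')) M"
proof (induction ks arbitrary: t rule: rev_induct)
  case Nil
  then show ?case by auto
next
  case (snoc k ks)
  then have k: "k \<in> {1..n}" by simp
  obtain t' where t': "tree_edge n k t t'" "t' \<in> tree_verts n"
    using neighbour_exists snoc(3) k by metis
  then have "matrix_agree m n (snd (\<Sigma> t')) (mutate_matrix k (snd (\<Sigma> t)))"
    using pat unfolding cluster_pattern_def seed_mutation_def by blast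
  then have "matrix_agree n n (snd (\<Sigma> t')) (mutate_matrix k (snd (\<Sigma> t)))"
    using pattern_le[OF pat] matrix_agree_mono by blast
  moreover have "matrix_agree n n (mutate_matrix k (snd (\<Sigma> t))) (fold mutate_matrix ks M)"
    using mutate_matrix_agree[OF snoc(4) k] by (simp add: mutate_matrix_involutive)
  ultimately have "matrix_agree n n (snd (\<Sigma> t')) (fold mutate_matrix ks M)"
    by (rule matrix_agree_trans)
  then show ?case using snoc t' by auto
qed

section \<open>The fan triangulation and its solutions of the Ptolemy relations\<close>

lemma cyc_wlog:
  assumes sorted: "\<And>a b c d. a < b \<Longrightarrow> b < c \<Longrightarrow> c < d \<Longrightarrow> d \<le> N \<Longrightarrow> Q a b c d"
    and rot: "\<And>a b c d. Q a b c d \<Longrightarrow> Q b c d a"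
    and c: "cyc a b c" "cyc c d a" and N: "a \<le> N" "b \<le> N" "c \<le> N" "d \<le> N"
  shows "Q a b c d"
proof -
  consider "a < b \<and> b < c \<and> c < d" | "b < c \<and> c < d \<and> d < a" | "c < d \<and> d < a \<and> a < b" | "d < a \<and> a < b \<and> b < c"
    using c unfolding cyc_def by linarith
  then show ?thesis
  proof cases
    case 1 then show ?thesis using sorted N by blast
  next
    case 2 then have "Q b c d a" using sorted N by blast
    then show ?thesis using rot by blast
  next
    case 3 then have "Q c d a b" using sorted N by blast
    then show ?thesis using rot by blast
  next
    case 4 then have "Q d a b c" using sorted N by blast
    then show ?thesis using rot by blast
  qed
qed

text \<open>The shift skips the side \<open>{0,1}\<close>: the labels 1 to n stand for the diagonals
  \<open>{0,2}\<close> to \<open>{0,n+1}\<close>.\<close>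

definition fan :: "nat \<Rightarrow> nat set" where
  "fan k = {0, k + 1}"

lemma fan_all_sides:
  assumes "0 < q" "q \<le> n + 2"
  shows "{0,q} \<in> fan ` {1..n} \<union> boundary (n + 2)"
proof -
  have "q = 1 \<or> q = n + 2 \<or> 1 \<le> q - 1 \<and> q - 1 \<le> n" using assms by arith
  then consider "q = 1" | "q = n + 2" | "q - 1 \<in> {1..n}" by auto
  then show ?thesis
  proof cases
    case 1 then show ?thesis unfolding boundary_def by auto
  next
    case 2 then show ?thesis unfolding boundary_def by auto
  next
    case 3 have "{0,q} = fan (q - 1)" using assms by (simp add: fan_def)
    then show ?thesis using 3 by blast
  qed
qed

lemma fan_triangulation: "triangulation (n + 2) (fan ` {1..n} \<union> boundary (n + 2))"
proof -
  define E where "E = fan ` {1..n} \<union> boundary (n + 2)"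
  have iff: "{p,q} \<in> E \<longleftrightarrow> (p = 0 \<and> 0 < q \<and> q \<le> n + 2 \<or> q = 0 \<and> 0 < p \<and> p \<le> n + 2 \<or>
      q = Suc p \<and> q \<le> n + 2 \<or> p = Suc q \<and> p \<le> n + 2)" (is "_ \<longleftrightarrow> ?R p q") for p q
  proof
    assume "{p,q} \<in> E"
    then show "?R p q" unfolding E_def fan_def boundary_def by (auto simp: doubleton_eq_iff)
  next
    have f: "{0,q} \<in> E" if "0 < q" "q \<le> n + 2" for q
      unfolding E_def using that by (rule fan_all_sides)
    have s: "{p, Suc p} \<in> E" if "Suc p \<le> n + 2" for p
      using that unfolding E_def boundary_def by auto
    assume "?R p q"
    then show "{p,q} \<in> E" using f[of q] f[of p] s[of p] s[of q] by (auto simp: insert_commute)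
  qed
  have dbl: "\<exists>p q. e = {p,q}" if "e \<in> E" for e
    using that unfolding E_def fan_def boundary_def by blast
  have "triangulation (n + 2) E"
  proof (rule triangulation.intro)
    fix p q assume "{p,q} \<in> E"
    then show "p \<noteq> q \<and> p \<le> n + 2 \<and> q \<le> n + 2" unfolding iff by auto
  next
    fix e assume "e \<in> E" then show "\<exists>p q. e = {p,q}" by (rule dbl)
  next
    fix p q a b assume "{p,q} \<in> E" "{a,b} \<in> E"
    then show "\<not> sep p q a b" unfolding iff sep_def cyc_def by auto
  next
    fix p q assume pq: "p \<noteq> q" "p \<le> n + 2" "q \<le> n + 2" and H: "\<And>a b. {a,b} \<in> E \<Longrightarrow> \<not> sep p q a b"
    \<comment> \<open>A chord avoiding 0 whose ends are not consecutive is crossed by the fan edge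
      to the successor of its smaller end.\<close>
    have "{0, Suc (min p q)} \<in> E" unfolding iff using pq by (auto simp: min_def)
    then have "\<not> sep p q 0 (Suc (min p q))" by (rule H)
    then show "{p,q} \<in> E" using pq unfolding iff sep_def cyc_def by (auto simp: min_def split: if_splits)
  qed
  then show ?thesis unfolding E_def .
qed

lemma fan_inj: "inj_on fan A"
  by (auto simp: inj_on_def fan_def doubleton_eq_iff)

lemma fan_not_boundary: "k \<in> {1..n} \<Longrightarrow> fan k \<notin> boundary (n + 2)"
  unfolding fan_def boundary_def by (auto simp: doubleton_eq_iff)

text \<open>Solutions of the Ptolemy relations with prescribed values \<open>y k\<close> on \<open>{0,k}\<close> and \<open>u k\<close> on
  \<open>{k,k+1}\<close>. In the tropical solution the values on \<open>{0,k}\<close> are normalized to \<open>0\<close>.\<close>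

definition fan_lambda :: "(nat \<Rightarrow> 'a::field) \<Rightarrow> (nat \<Rightarrow> 'a) \<Rightarrow> nat set \<Rightarrow> 'a" where
  "fan_lambda y u e = (if Min e = 0 then y (Max e)
     else y (Min e) * y (Max e) * (\<Sum>l\<in>{Min e..<Max e}. u l / (y l * y (l + 1))))"

definition fan_tropical :: "(nat \<Rightarrow> int) \<Rightarrow> nat set \<Rightarrow> int" where
  "fan_tropical u e = (if Min e = 0 then 0 else Min (u ` {Min e..<Max e}))"

lemma fan_lambda_simps:
  "0 < b \<Longrightarrow> fan_lambda y u {0,b} = y b"
  "0 < a \<Longrightarrow> a < b \<Longrightarrow> fan_lambda y u {a,b} = y a * y b * (\<Sum>l\<in>{a..<b}. u l / (y l * y (l + 1)))"
  by (simp_all add: fan_lambda_def)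

lemma fan_tropical_simps:
  "0 < b \<Longrightarrow> fan_tropical u {0,b} = 0"
  "0 < a \<Longrightarrow> a < b \<Longrightarrow> fan_tropical u {a,b} = Min (u ` {a..<b})"
  by (simp_all add: fan_tropical_def)

text \<open>Divided by the \<open>y\<close> values of its ends, the solution is a sum
  \<open>S\<close> over an interval. For \<open>a = 0\<close> the relation is additivity of
  \<open>S\<close>; otherwise, with r, s, t the sums over the three gaps, it is (r + s)(s + t) = r t
  + s (r + s + t).\<close>

lemma fan_lambda_ptolemy:
  assumes "cyc a b c" "cyc c d a" "a \<le> N" "b \<le> N" "c \<le> N" "d \<le> N"
  shows "fan_lambda y u {a,c} * fan_lambda y u {b,d} =
     fan_lambda y u {a,b} * fan_lambda y u {c,d} + fan_lambda y u {b,c} * fan_lambda y u {d,a}"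
proof (rule cyc_wlog[where Q = "\<lambda>a b c d. fan_lambda y u {a,c} * fan_lambda y u {b,d} =
     fan_lambda y u {a,b} * fan_lambda y u {c,d} + fan_lambda y u {b,c} * fan_lambda y u {d,a}", OF _ _ assms])
  fix a b c d :: nat assume o: "a < b" "b < c" "c < d"
  define S where "S i j = (\<Sum>l\<in>{i..<j}. u l / (y l * y (l + 1)))" for i j
  have S: "S b d = S b c + S c d" "S a c = S a b + S b c" "S a d = S a b + S b c + S c d"
    using o unfolding S_def by (simp_all add: sum.atLeastLessThan_concat)
  have v: "fan_lambda y u {i,j} = y i * y j * S i j" if "0 < i" "i < j" for i j
    using fan_lambda_simps(2)[OF that] by (simp add: S_def)
  have ins: "{d,a} = {a,d}" by blast
  show "fan_lambda y u {a,c} * fan_lambda y u {b,d} =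
     fan_lambda y u {a,b} * fan_lambda y u {c,d} + fan_lambda y u {b,c} * fan_lambda y u {d,a}"
  proof (cases "a = 0")
    case True
    then show ?thesis unfolding ins using o by (simp add: v fan_lambda_simps(1) S algebra_simps)
  next
    case False
    then show ?thesis unfolding ins using o by (simp add: v S algebra_simps)
  qed
next
  fix a b c d
  assume "fan_lambda y u {a,c} * fan_lambda y u {b,d} =
     fan_lambda y u {a,b} * fan_lambda y u {c,d} + fan_lambda y u {b,c} * fan_lambda y u {d,a}"
  then show "fan_lambda y u {b,d} * fan_lambda y u {c,a} =
     fan_lambda y u {b,c} * fan_lambda y u {d,a} + fan_lambda y u {c,d} * fan_lambda y u {a,b}"
    by (simp add: insert_commute mult.commute add.commute)
qed

lemma Min_image_concat:
  fixes u :: "nat \<Rightarrow> int"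
  assumes "i < j" "j < k"
  shows "Min (u ` {i..<k}) = min (Min (u ` {i..<j})) (Min (u ` {j..<k}))"
proof -
  have "u ` {i..<k} = u ` {i..<j} \<union> u ` {j..<k}"
    using assms by (simp flip: image_Un add: ivl_disj_un_two)
  then show ?thesis using assms by (simp add: Min_Un)
qed

text \<open>Minima over intervals replace sums: with r, s, t the minima over the three gaps,
  min(r,s) + min(s,t) = min(r + t, s + min(r,s,t)) when \<open>a\<close> is positive.\<close>

lemma fan_tropical_ptolemy:
  assumes "cyc a b c" "cyc c d a" "a \<le> N" "b \<le> N" "c \<le> N" "d \<le> N"
  shows "tropical_ptolemy (fan_tropical u) a b c d"
proof (rule cyc_wlog[where Q = "tropical_ptolemy (fan_tropical u)", OF _ _ assms])
  fix a b c d :: nat assume o: "a < b" "b < c" "c < d"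
  define S where "S i j = Min (u ` {i..<j})" for i j
  have S: "S b d = min (S b c) (S c d)" "S a c = min (S a b) (S b c)" "S a d = min (S a b) (S b d)"
    unfolding S_def by (rule Min_image_concat; use o in simp)+
  have v: "fan_tropical u {i,j} = S i j" if "0 < i" "i < j" for i j
    using fan_tropical_simps(2)[OF that] by (simp add: S_def)
  have ins: "{d,a} = {a,d}" by blast
  show "tropical_ptolemy (fan_tropical u) a b c d"
  proof (cases "a = 0")
    case True
    then show ?thesis unfolding tropical_ptolemy_def ins using o by (simp add: v fan_tropical_simps(1) S)
  next
    case False
    then show ?thesis unfolding tropical_ptolemy_def ins using o by (simp add: v S min_def)
  qed
next
  fix a b c d
  assume "tropical_ptolemy (fan_tropical u) a b c d"
  then show "tropical_ptolemy (fan_tropical u) b c d a"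
    unfolding tropical_ptolemy_def by (simp add: insert_commute min.commute add.commute)
qed

lemma pattern_free_variables:
  assumes "cluster_pattern F n m \<Sigma>" "t \<in> tree_verts n"
  shows "free_variables n m (fst (\<Sigma> t))"
proof
  have "labeled_seed F n m (\<Sigma> t)" using assms unfolding cluster_pattern_def by blast
  then show "n \<le> m" "algebraically_independent m (fst (\<Sigma> t))"
    unfolding labeled_seed_def free_generating_set_def by blast+
qed

section \<open>Every diagonal of the polygon carries a cluster variable\<close>

context polygon_model
begin

lemma seed_nonzero: "t \<in> tree_verts n \<Longrightarrow> i \<in> {1..m} \<Longrightarrow> fst (\<Sigma> t) i \<noteq> 0"
  using free_variables.x_nonzero[OF pattern_free_variables[OF pattern]] by blast

lemma models_neighbour:
  assumes M: "models t D" and e: "tree_edge n k t t'" and k: "k \<in> {1..n}"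
    and Dk: "D k = {a,c}" and q: "quad (D ` {1..n} \<union> boundary N) a b c d"
  shows "models t' (D(k := {b,d}))"
proof (rule models_flip[OF M k Dk q])
  show "fst (\<Sigma> t) k \<noteq> 0" using seed_nonzero e k le unfolding tree_edge_def by auto
  show "seed_mutation n m k (\<Sigma> t) (\<Sigma> t')" using pattern e unfolding cluster_pattern_def by blast
qed

lemma models_neighbour_ex:
  assumes M: "models t D" and e: "tree_edge n k t t'" and k: "k \<in> {1..n}"
  shows "\<exists>D'. models t' D'"
proof -
  let ?E = "D ` {1..n} \<union> boundary N"
  have "D k \<in> ?E" "D k \<notin> boundary N" using M k unfolding models_def by blast+
  moreover have "triangulation N ?E" using M by (simp add: models_def)
  ultimately obtain a b c d where "D k = {a,c}" "quad ?E a b c d"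
    using triangulation.quad_exists by metis
  then show ?thesis using models_neighbour[OF M e k] by blast
qed

lemma models_root: "t \<in> tree_verts n \<Longrightarrow> (\<exists>D. models t D) \<longleftrightarrow> (\<exists>D. models [] D)"
proof (induction t)
  case (Cons k t)
  then have t: "t \<in> tree_verts n" "k \<in> {1..n}" by (auto simp: tree_verts_def distinct_adj_Cons)
  then have e: "tree_edge n k t (k # t)" using Cons(2) by (simp add: tree_edge_def)
  have "(\<exists>D. models (k # t) D) \<longleftrightarrow> (\<exists>D. models t D)"
    using models_neighbour_ex[OF _ e t(2)] models_neighbour_ex[OF _ tree_edge_sym[OF e] t(2)] by blast
  then show ?case using Cons(1) t(1) by simp
qed simp

lemma models_all: "models t D \<Longrightarrow> t \<in> tree_verts n \<Longrightarrow> t' \<in> tree_verts n \<Longrightarrow> \<exists>D'. models t' D'"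
  using models_root by blast

text \<open>From the fan, the diagonals \<open>{0,a+1}\<close>, \<open>{0,a+2}\<close>, ... are
  flipped in turn. Flipping \<open>{0,b}\<close> in the quadrilateral \<open>0, a, b, b+1\<close>
  replaces it by \<open>{a,b+1}\<close>, and the edges needed later, \<open>{0,a}\<close> and those
  beyond \<open>b\<close>, survive.\<close>

lemma diagonal_reached:
  assumes t: "t \<in> tree_verts n" "models t D" and fan: "\<And>k. 0 < k \<Longrightarrow> k \<le> N \<Longrightarrow> {0,k} \<in> D ` {1..n} \<union> boundary N"
    and a: "0 < a"
  shows "Suc a \<le> b \<Longrightarrow> b \<le> N \<Longrightarrow> \<exists>t'\<in>tree_verts n. \<exists>D'. models t' D' \<and> {a,b} \<in> D' ` {1..n} \<union> boundary N \<and>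
     {0,a} \<in> D' ` {1..n} \<union> boundary N \<and> (\<forall>k. b \<le> k \<and> k \<le> N \<longrightarrow> {0,k} \<in> D' ` {1..n} \<union> boundary N)"
proof (induction b rule: dec_induct)
  case base
  have "{a, Suc a} \<in> boundary N" using base by (auto simp: boundary_def)
  then show ?case using t fan a base by (intro bexI[of _ t] exI[of _ D]) auto
next
  case (step b)
  then obtain t' D' where t': "t' \<in> tree_verts n" "models t' D'"
    and E: "{a,b} \<in> D' ` {1..n} \<union> boundary N" "{0,a} \<in> D' ` {1..n} \<union> boundary N"
      "\<And>k. b \<le> k \<Longrightarrow> k \<le> N \<Longrightarrow> {0,k} \<in> D' ` {1..n} \<union> boundary N" by auto
  have o: "0 < a" "a < b" "b < N" using step a by auto
  let ?E = "D' ` {1..n} \<union> boundary N"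
  interpret triangulation N ?E using t'(2) by (simp add: models_def)
  have "{b, Suc b} \<in> ?E" using o by (auto simp: boundary_def)
  then have q: "quad ?E 0 a b (Suc b)"
    using E(1,2) E(3)[of b] edge_sym[OF E(3)[of "Suc b"]] o unfolding quad_def by (simp add: cyc_def)
  have "{0,b} \<notin> boundary N" using o by (auto simp: boundary_def doubleton_eq_iff)
  then obtain k where k: "k \<in> {1..n}" "D' k = {0,b}" using E(3)[of b] o by auto
  obtain t'' where t'': "tree_edge n k t' t''" "t'' \<in> tree_verts n"
    using neighbour_exists[OF t'(1) k(1)] by metis
  have M: "models t'' (D'(k := {a, Suc b}))"
    using models_neighbour[OF t'(2) t''(1) k q] .
  have inj: "inj_on D' {1..n}" using t'(2) by (simp add: models_def)
  have img: "D'(k := {a, Suc b}) ` {1..n} = insert {a, Suc b} (D' ` {1..n} - {{0,b}})"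
    using fun_upd_image_inj[OF inj k(1)] k(2) by simp
  have keep: "e \<in> D'(k := {a, Suc b}) ` {1..n} \<union> boundary N" if "e \<in> ?E" "e \<noteq> {0,b}" for e
    using that unfolding img by blast
  show ?case
  proof (intro bexI[OF _ t''(2)] exI conjI allI impI)
    show "models t'' (D'(k := {a, Suc b}))" by (rule M)
    show "{a, Suc b} \<in> D'(k := {a, Suc b}) ` {1..n} \<union> boundary N" unfolding img by blast
    show "{0,a} \<in> D'(k := {a, Suc b}) ` {1..n} \<union> boundary N"
      using keep[OF E(2)] o by (simp add: doubleton_eq_iff)
    fix l assume l: "Suc b \<le> l \<and> l \<le> N"
    show "{0,l} \<in> D'(k := {a, Suc b}) ` {1..n} \<union> boundary N"
      using keep[OF E(3)[of l]] o l by (simp add: doubleton_eq_iff)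
  qed
qed

definition X :: "nat set \<Rightarrow> 'a" where
  "X e = P e / W e"

lemma models_variable: "models t D \<Longrightarrow> j \<in> {1..n} \<Longrightarrow> fst (\<Sigma> t) j = X (D j)"
  using W_nonzero unfolding X_def models_def by (simp add: eq_divide_eq)

lemma cluster_eq:
  assumes "models t D"
  shows "cluster_at n \<Sigma> t = X ` D ` {1..n}"
proof -
  have "cluster_at n \<Sigma> t = fst (\<Sigma> t) ` {1..n}" unfolding cluster_at_def by auto
  also have "\<dots> = (\<lambda>j. X (D j)) ` {1..n}" using models_variable[OF assms] by (rule image_cong[OF refl])
  finally show ?thesis by (simp add: image_image)
qed

lemma cluster_variables_eq:
  assumes t: "t \<in> tree_verts n" "models t D" and fan: "\<And>k. 0 < k \<Longrightarrow> k \<le> N \<Longrightarrow> {0,k} \<in> D ` {1..n} \<union> boundary N"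
  shows "cluster_variables n \<Sigma> = X ` (edges N - boundary N)"
proof (intro equalityI subsetI)
  fix z assume "z \<in> cluster_variables n \<Sigma>"
  then obtain t' where t': "t' \<in> tree_verts n" "z \<in> cluster_at n \<Sigma> t'" unfolding cluster_variables_def by blast
  obtain D' where M: "models t' D'" using models_all[OF t(2,1) t'(1)] by blast
  have "D' ` {1..n} \<subseteq> edges N" using triangulation.edges_subset M unfolding models_def by blast
  moreover have "D' ` {1..n} \<inter> boundary N = {}" using M unfolding models_def by blast
  ultimately show "z \<in> X ` (edges N - boundary N)"
    using t'(2) unfolding cluster_eq[OF M] by blast
next
  fix z assume "z \<in> X ` (edges N - boundary N)"
  then obtain e where e: "z = X e" "e \<in> edges N" "e \<notin> boundary N" by blast
  obtain p q where pq: "e = {p,q}" "p < q" "q \<le> N"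
  proof -
    obtain p q where "e = {p,q}" "p \<noteq> q" "p \<le> N" "q \<le> N" using e(2) unfolding edges_def by blast
    then show thesis using that[of p q] that[of q p] by (cases "p < q") (auto simp: insert_commute)
  qed
  have "\<exists>t'\<in>tree_verts n. \<exists>D'. models t' D' \<and> e \<in> D' ` {1..n} \<union> boundary N"
  proof (cases "p = 0")
    case True
    then show ?thesis using t fan[of q] pq by blast
  next
    case False
    then show ?thesis using diagonal_reached[OF t fan, of p q] pq by auto
  qed
  then obtain t' D' where "t' \<in> tree_verts n" "models t' D'" "e \<in> D' ` {1..n}" using e(3) by blast
  then show "z \<in> cluster_variables n \<Sigma>"
    unfolding cluster_variables_def e(1) using cluster_eq by blast
qed

end

section \<open>Denominators and crossings\<close>

text \<open>The value -1 accounts for the initial variables: \<open>x l\<close> is 1 divided by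
  \<open>x l\<close> to the power -1.\<close>

definition isect :: "nat set \<Rightarrow> nat set \<Rightarrow> int" where
  "isect e f = (if e = f then - 1 else if crossing e f then 1 else 0)"

lemma ord_crossed_side: "sep a b p q \<Longrightarrow> sep u v a p \<Longrightarrow> \<not> sep u v a b \<Longrightarrow> sep u v p q"
  unfolding sep_def cyc_real eq_real by (smt (verit))

lemma ord_crossed_some: "sep a b p q \<Longrightarrow> sep u v p q \<Longrightarrow> \<not> sep u v a b \<Longrightarrow>
    u = a \<and> v = b \<or> u = b \<and> v = a \<or> sep u v a p \<or> sep u v b q \<or> sep u v a q \<or> sep u v b p"
  unfolding sep_def cyc_real eq_real by (smt (verit))

lemma ord_crossed_opposite: "sep a b p q \<Longrightarrow> \<not> sep u v a b \<Longrightarrow> sep u v a p \<Longrightarrow> \<not> sep u v b q"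
  unfolding sep_def cyc_real eq_real by (smt (verit))

lemma isect_doubleton: "isect {u,v} {x,y} = (if {u,v} = {x,y} then - 1 else if sep u v x y then 1 else 0)"
  by (simp add: isect_def)

lemma sep_irrefl: "\<not> sep x y x z" "\<not> sep x y z x" "\<not> sep x y y z" "\<not> sep x y z y"
  using sep_distinct by blast+

lemma isect_shared:
  assumes "b \<noteq> c"
  shows "isect {a,b} {a,c} = 0"
  using assms sep_irrefl(1) by (simp add: isect_doubleton doubleton_eq_iff)

lemma max_of_bool1: "A \<or> B \<or> C \<or> D \<Longrightarrow> \<not> (A \<and> B) \<Longrightarrow> \<not> (C \<and> D) \<Longrightarrow>
    max ((if A then 1 else 0) + (if B then 1 else 0)) ((if C then 1 else 0) + (if D then 1 else 0)) = (1 :: int)"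
  by (cases A; cases B; cases C; cases D) simp_all

lemma max_of_bool2: "\<not> (A \<and> C) \<Longrightarrow> \<not> (A \<and> D) \<Longrightarrow> \<not> (B \<and> C) \<Longrightarrow> \<not> (B \<and> D) \<Longrightarrow>
    max ((if A then - 1 else 0) + (if B then - 1 else 0)) ((if C then - 1 else 0) + (if D then - 1 else 0)) = (0 :: int)"
  by (cases A; cases B; cases C; cases D) simp_all

text \<open>The max-tropical Ptolemy relation, with an extra 1 at \<open>{a,b}\<close> for the
  division by its variable. A chord crossing \<open>{p,q}\<close> but not \<open>{a,b}\<close>
  crosses some side and at most one of each opposite pair, so the maximum is 1. A chord other than
  \<open>{a,b}\<close> that crosses neither crosses no side; it may be a side, but then the opposite
  pairs not containing it give 0.\<close>

lemma isect_ptolemy: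
  assumes s: "sep a b p q" and ns: "\<not> sep u v a b"
  shows "max (isect {u,v} {a,p} + isect {u,v} {b,q}) (isect {u,v} {a,q} + isect {u,v} {b,p}) +
      (if {u,v} = {a,b} then 1 else 0) = isect {u,v} {p,q}"
proof -
  have dist: "a \<noteq> b" "a \<noteq> p" "a \<noteq> q" "b \<noteq> p" "b \<noteq> q" "p \<noteq> q" using sep_distinct[OF s] by blast+
  have s': "sep a b q p" "sep b a p q" "sep b a q p" using s sep_flip sep_flip' by blast+
  have ns': "\<not> sep u v b a" using ns sep_flip by blast
  have pq: "{u,v} \<noteq> {p,q}" using ns s sep_cong[of u v p q a b] sep_sym[of p q a b] by blast
  show ?thesis
  proof (cases "{u,v} = {a,b}")
    case True
    have "isect {a,b} {a,p} = 0" "isect {a,b} {a,q} = 0" using isect_shared dist by blast+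
    moreover have "isect {a,b} {b,p} = 0" "isect {a,b} {b,q} = 0"
      using isect_shared[of a p b] isect_shared[of a q b] dist by (simp_all add: insert_commute)
    moreover have "isect {a,b} {p,q} = 1"
      using s pq True by (simp add: isect_doubleton)
    ultimately show ?thesis using True by simp
  next
    case ab: False
    show ?thesis
    proof (cases "sep u v p q")
      case True
      have ne: "{u,v} \<noteq> {a,p}" "{u,v} \<noteq> {b,q}" "{u,v} \<noteq> {a,q}" "{u,v} \<noteq> {b,p}"
        using True sep_irrefl sep_cong by metis+
      have "sep u v a p \<or> sep u v b q \<or> sep u v a q \<or> sep u v b p"
        using ord_crossed_some[OF s True ns] ab by blast
      moreover have "\<not> (sep u v a p \<and> sep u v b q)" "\<not> (sep u v a q \<and> sep u v b p)"
        using ord_crossed_opposite[OF s ns] ord_crossed_opposite[OF s'(1) ns] by blast+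
      ultimately show ?thesis
        unfolding isect_doubleton if_not_P[OF ne(1)] if_not_P[OF ne(2)] if_not_P[OF ne(3)] if_not_P[OF ne(4)]
          if_not_P[OF ab] if_not_P[OF pq] if_P[OF True] add_0_right
        by (rule max_of_bool1)
    next
      case False
      then have "\<not> sep u v q p" using sep_flip by blast
      then have ns4: "\<not> sep u v a p" "\<not> sep u v b q" "\<not> sep u v a q" "\<not> sep u v b p"
        using False ord_crossed_side s s' ns ns' by blast+
      have ne: "{a,p} \<noteq> {a,q}" "{a,p} \<noteq> {b,p}" "{b,q} \<noteq> {a,q}" "{b,q} \<noteq> {b,p}"
        using dist by (simp_all add: doubleton_eq_iff)
      then have "\<not> ({u,v} = {a,p} \<and> {u,v} = {a,q})" "\<not> ({u,v} = {a,p} \<and> {u,v} = {b,p})"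
        "\<not> ({u,v} = {b,q} \<and> {u,v} = {a,q})" "\<not> ({u,v} = {b,q} \<and> {u,v} = {b,p})"
        by metis+
      then show ?thesis
        unfolding isect_doubleton if_not_P[OF ns4(1)] if_not_P[OF ns4(2)] if_not_P[OF ns4(3)] if_not_P[OF ns4(4)]
          if_not_P[OF ab] if_not_P[OF pq] if_not_P[OF False] add_0_right
        by (rule max_of_bool2)
    qed
  qed
qed

context triangulation
begin

lemma boundary_not_crossed:
  assumes e: "e \<in> boundary N" "p \<le> N" "q \<le> N"
  shows "\<not> crossing e {p,q}"
proof -
  consider "e = {0,N}" | i where "i < N" "e = {i, Suc i}" using e(1) unfolding boundary_def by blast
  then show ?thesis
  proof cases
    case 1 then show ?thesis using e(2,3) by (auto simp: sep_def cyc_def)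
  next
    case 2 then show ?thesis using e(2,3) by (auto simp: sep_def cyc_def)
  qed
qed

text \<open>Makes the Ptolemy expansion at a crossed diagonal terminate: \<open>{a,b}\<close> shares
  an endpoint with each of the four sides and is no longer crossed.\<close>

lemma crossed_side_psubset:
  assumes ab: "{a,b} \<in> crossed p q"
  shows "crossed a p \<subset> crossed p q"
proof -
  have s: "sep a b p q" and E: "{a,b} \<in> E" using ab crossed_iff by blast+
  have "e \<in> crossed p q" if e: "e \<in> crossed a p" for e
  proof -
    have "e \<in> E" using e by (simp add: crossed_def)
    then obtain u v where uv: "e = {u,v}" using doubleton by blast
    with e have "{u,v} \<in> E" "sep u v a p" using crossed_iff by blast+
    then show ?thesis using ord_crossed_side[OF s] not_sep E unfolding uv crossed_iff by blast
  qed
  moreover have "{a,b} \<notin> crossed a p" unfolding crossed_iff using sep_distinct by blast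
  ultimately show ?thesis using ab by blast
qed

lemma crossed_empty:
  assumes "p \<noteq> q" "p \<le> N" "q \<le> N" "crossed p q = {}"
  shows "{p,q} \<in> E"
proof (rule maximal[OF assms(1-3)])
  fix a b assume "{a,b} \<in> E"
  then show "\<not> sep p q a b" using assms(4) crossed_iff sep_sym by blast
qed

lemma crossed_not_edge: "crossed p q \<noteq> {} \<Longrightarrow> {p,q} \<notin> E"
proof
  assume "crossed p q \<noteq> {}" and pq: "{p,q} \<in> E"
  then obtain e where e: "e \<in> E" "crossing e {p,q}" unfolding crossed_def by blast
  then obtain u v where "e = {u,v}" using doubleton by blast
  then show False using e pq not_sep by simp
qed

lemma dpath_bound: "dpath p q vs \<Longrightarrow> p \<le> N \<and> q \<le> N"
proof (induction rule: dpath.induct)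
  case (base a b p q)
  then show ?case unfolding wings_def using edge[of p b] edge[of b q] by blast
next
  case (step a q b c es p)
  then show ?case unfolding wings_def using edge[of p b] by blast
qed

lemma adj_quad:
  assumes q: "quad E a b c d"
  shows "adj e {a,c} \<longleftrightarrow> e = {a,b} \<or> e = {b,c} \<or> e = {c,d} \<or> e = {d,a}"
proof
  assume "adj e {a,c}"
  then have "{a,c} \<in> E" "\<exists>x y z. e = {x,y} \<and> {a,c} = {y,z} \<and> {x,z} \<in> E" and eE: "e \<in> E"
    unfolding adj_def by simp_all
  then obtain x y z where xyz: "e = {x,y}" "{a,c} = {y,z}" "{x,z} \<in> E" by (elim exE conjE)
  from xyz(2) consider "y = a" "z = c" | "y = c" "z = a" by (auto simp: doubleton_eq_iff)
  then have ax: "{a,x} \<in> E \<and> {x,c} \<in> E"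
  proof cases
    case 1 then show ?thesis using xyz(1,3) eE edge_sym by simp
  next
    case 2 then show ?thesis using xyz(1,3) eE edge_sym by simp
  qed
  then have "x = b \<or> x = d" using wings_apex[OF quad_wings[OF q]] by blast
  moreover from xyz(1,2) have "e = {a,x} \<or> e = {x,c}" by (auto simp: doubleton_eq_iff)
  ultimately show "e = {a,b} \<or> e = {b,c} \<or> e = {c,d} \<or> e = {d,a}" by (auto simp: insert_commute)
next
  have A: "adj {x,y} {y,z}" if "{x,y} \<in> E" "{y,z} \<in> E" "{x,z} \<in> E" for x y z
    unfolding adj_def using that by blast
  note E = quadD(3-7)[OF q]
  assume "e = {a,b} \<or> e = {b,c} \<or> e = {c,d} \<or> e = {d,a}"
  then show "adj e {a,c}"
    using A[of b a c] A[of b c a] A[of d c a] A[of d a c] E E[THEN edge_sym]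
    by (elim disjE) (simp_all add: insert_commute[of c a] insert_commute[of b a] insert_commute[of d c])
qed

end

lemma shear_ind_quad:
  assumes q: "quad E a b c d"
  shows "\<bar>shear (ind e) a b c d\<bar> \<le> 1"
    and "shear (ind e) a b c d \<noteq> 0 \<longleftrightarrow> e = {a,b} \<or> e = {b,c} \<or> e = {c,d} \<or> e = {d,a}"
proof -
  have "{a,b} \<noteq> {b,c}" "{a,b} \<noteq> {c,d}" "{a,b} \<noteq> {d,a}" "{b,c} \<noteq> {c,d}" "{b,c} \<noteq> {d,a}" "{c,d} \<noteq> {d,a}"
    using quad_distinct[OF q] by (simp_all add: doubleton_eq_iff)
  then show "\<bar>shear (ind e) a b c d\<bar> \<le> 1"
    and "shear (ind e) a b c d \<noteq> 0 \<longleftrightarrow> e = {a,b} \<or> e = {b,c} \<or> e = {c,d} \<or> e = {d,a}"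
    unfolding shear_def ind_def by (simp_all split: if_split)
qed

text \<open>Small entries of opposite sign leave at most one arrow between two vertices, both
  directions together, and exactly one if the entry is nonzero. On the diagonal the sign condition
  forces 0.\<close>

lemma is_chain_quiver:
  assumes C: "C \<subseteq> {1..n}" and le1: "\<And>i j. i \<in> C \<Longrightarrow> j \<in> C \<Longrightarrow> \<bar>B i j\<bar> \<le> 1"
    and skew: "\<And>i j. i \<in> C \<Longrightarrow> j \<in> C \<Longrightarrow> sgn (B i j) = - sgn (B j i)"
  shows "is_chain (induce_subgraph (quiver_of n B) C) \<longleftrightarrow>
    (\<exists>vs. vs \<noteq> [] \<and> set vs = C \<and> chain_list (\<lambda>i j. B i j \<noteq> 0) vs)"
proof -
  let ?G = "induce_subgraph (quiver_of n B) C"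
  have arcs: "arcs ?G = {(i, j, l). i \<in> C \<and> j \<in> C \<and> B i j < 0 \<and> l = 0}"
    using C le1 by (fastforce simp: quiver_of_def)
  have fin: "finite (arcs ?G)"
  proof (rule finite_subset)
    show "arcs ?G \<subseteq> C \<times> C \<times> {0}" unfolding arcs by auto
    show "finite (C \<times> C \<times> {0::nat})" using C finite_subset by blast
  qed
  have card: "card (edges_between ?G u v) = (if B u v \<noteq> 0 then 1 else 0)" if uv: "u \<in> C" "v \<in> C" for u v
  proof -
    have eb: "edges_between ?G u v = {(i, j, l). (i = u \<and> j = v \<or> i = v \<and> j = u) \<and> B i j < 0 \<and> l = 0}"
      unfolding edges_between_def arcs using uv by (auto simp: quiver_of_def doubleton_eq_iff)
    have sk: "sgn (B u v) = - sgn (B v u)" using skew uv by blast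
    consider "B u v < 0" | "B v u < 0" | "B u v = 0" "B v u = 0"
      using sk by (cases "B u v" "0::int" rule: linorder_cases) (auto simp: sgn_if split: if_splits)
    then show ?thesis
    proof cases
      case 1
      then have "\<not> B v u < 0" using sk by (auto simp: sgn_if split: if_splits)
      then have "edges_between ?G u v = {(u, v, 0)}" unfolding eb using 1 by auto
      then show ?thesis using 1 by simp
    next
      case 2
      then have "\<not> B u v < 0" "B u v \<noteq> 0" using sk by (auto simp: sgn_if split: if_splits)
      then have "edges_between ?G u v = {(v, u, 0)}" unfolding eb using 2 by auto
      then show ?thesis using \<open>B u v \<noteq> 0\<close> by simp
    next
      case 3
      then have "edges_between ?G u v = {}" unfolding eb by auto
      then show ?thesis using 3 by simp
    qed
  qed
  have "(distinct vs \<and> set vs = C \<and> (\<forall>a<length vs. \<forall>b<length vs.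
      card (edges_between ?G (vs ! a) (vs ! b)) = (if b = a + 1 \<or> a = b + 1 then 1 else 0))) \<longleftrightarrow>
      (set vs = C \<and> chain_list (\<lambda>i j. B i j \<noteq> 0) vs)" for vs
  proof (cases "set vs = C")
    case True
    have "card (edges_between ?G (vs ! a) (vs ! b)) = (if b = a + 1 \<or> a = b + 1 then 1 else 0) \<longleftrightarrow>
        (B (vs ! a) (vs ! b) \<noteq> 0 \<longleftrightarrow> b = a + 1 \<or> a = b + 1)" if "a < length vs" "b < length vs" for a b
      using card[of "vs ! a" "vs ! b"] True that nth_mem by (auto split: if_splits)
    then show ?thesis unfolding chain_list_def by blast
  qed simp
  then show ?thesis unfolding is_chain_def using fin by (simp only: induce_subgraph_verts) blast
qed

lemma chain_list_map:
  assumes "inj_on f (set vs)" "\<And>i j. i \<in> set vs \<Longrightarrow> j \<in> set vs \<Longrightarrow> A i j \<longleftrightarrow> A' (f i) (f j)"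
  shows "chain_list A' (map f vs) \<longleftrightarrow> chain_list A vs"
  unfolding chain_list_def using assms by (simp add: distinct_map)

section \<open>Denominators with respect to an arbitrary seed\<close>

context polygon_model
begin

lemma ptolemy_sep:
  assumes s: "sep a b p q" and N: "a \<le> N" "b \<le> N" "p \<le> N" "q \<le> N"
  shows "P {p,q} * P {a,b} = P {a,p} * P {b,q} + P {a,q} * P {b,p}"
  using s unfolding sep_def
proof (elim disjE conjE)
  assume "cyc a p b" "cyc b q a"
  from ptolemy[OF this] N show ?thesis by (simp add: insert_commute mult.commute add.commute)
next
  assume "cyc a q b" "cyc b p a"
  from ptolemy[OF this] N show ?thesis by (simp add: insert_commute mult.commute add.commute)
qed

text \<open>Induction on the number of crossed diagonals. An uncrossed arc is an edge, hence a
  frozen monomial, possibly times a cluster variable. A crossed one is expanded by the Ptolemy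
  relation at one of its diagonals.\<close>

lemma lambda_denominator:
  assumes t: "t \<in> tree_verts n" and M: "models t D" and pq: "p \<noteq> q" "p \<le> N" "q \<le> N"
  shows "free_variables.positive_denominator n m (fst (\<Sigma> t)) (P {p,q}) (\<lambda>i. isect (D i) {p,q})"
proof -
  let ?E = "D ` {1..n} \<union> boundary N"
  let ?x = "fst (\<Sigma> t)"
  interpret fv: free_variables n m ?x by (rule pattern_free_variables[OF pattern t])
  interpret triangulation N ?E using M by (simp add: models_def)
  have fr: "r \<in> {n+1..m} \<Longrightarrow> ?x r = fr r" for r using M by (simp add: models_def)
  have fw: "fv.positive_denominator (\<Prod>r\<in>{n+1..m}. fr r powi g r) (\<lambda>_. 0)" for g
  proof -
    have "(\<Prod>r\<in>{n+1..m}. fr r powi g r) = (\<Prod>r\<in>{n+1..m}. ?x r powi g r)"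
      using fr by (intro prod.cong) auto
    then show ?thesis using fv.positive_denominator_frozen[of g] by simp
  qed
  have winv: "inverse (W e) = (\<Prod>r\<in>{n+1..m}. fr r powi (- w r e))" for e
    unfolding W_def by (simp add: prod_inversef[symmetric] power_int_minus comp_def)
  have DE: "i \<in> {1..n} \<Longrightarrow> D i \<in> ?E" for i by blast
  have nocross: "\<not> crossing e f" if e: "e \<in> ?E" and f: "f \<in> ?E" for e f
  proof -
    obtain u v where "e = {u,v}" using doubleton[OF e] by blast
    moreover obtain p q where "f = {p,q}" using doubleton[OF f] by blast
    ultimately show ?thesis using not_sep e f by simp
  qed
  have D_or: "e \<in> boundary N \<or> (\<exists>l\<in>{1..n}. e = D l)" if "e \<in> ?E" for e using that by blast
  show ?thesis using pq
  proof (induction "card (crossed p q)" arbitrary: p q rule: less_induct)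
    case less
    show ?case
    proof (cases "crossed p q = {}")
      case True
      then have E: "{p,q} \<in> ?E" using crossed_empty less by blast
      from D_or[OF E] show ?thesis
      proof (elim disjE bexE)
        assume b: "{p,q} \<in> boundary N"
        have "D i \<noteq> {p,q}" if "i \<in> {1..n}" for i
          using M b that unfolding models_def by (metis IntI empty_iff imageI)
        then have "isect (D i) {p,q} = 0" if "i \<in> {1..n}" for i
          using that nocross[OF DE E] by (simp add: isect_def)
        then show ?thesis unfolding P_boundary[OF b]
          by (intro fv.positive_denominator_cong[OF fw]) simp
      next
        fix l assume l: "l \<in> {1..n}" "{p,q} = D l"
        have P: "P {p,q} = ?x l * W (D l)" using M l unfolding models_def by simp
        have ev: "isect (D i) {p,q} = (if i = l then - 1 else 0) + 0" if i: "i \<in> {1..n}" for i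
        proof (cases "i = l")
          case True then show ?thesis using l by (simp add: isect_def)
        next
          case False
          then have "D i \<noteq> D l" using M i l unfolding models_def by (metis inj_on_contraD)
          then show ?thesis using False nocross[OF DE[OF i] E] l(2) by (simp add: isect_def)
        qed
        show ?thesis unfolding P W_def
          by (rule fv.positive_denominator_cong[OF fv.positive_denominator_mult[OF fv.positive_denominator_x[OF l(1)] fw]])
            (simp only: ev)
      qed
    next
      case False
      then obtain e where e: "e \<in> ?E" "crossing e {p,q}" unfolding crossed_def by blast
      have "e \<notin> boundary N" using boundary_not_crossed[of e p q] e(2) less(3,4) by blast
      then obtain l where l: "l \<in> {1..n}" "e = D l" using D_or[OF e(1)] by blast
      obtain a b where ab: "e = {a,b}" using doubleton[OF e(1)] by blast
      with e have E: "{a,b} \<in> ?E" and s: "sep a b p q" by simp_all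
      note N' = edge[OF E] less(3,4) and dist = sep_distinct[OF s]
      have cr: "{a,b} \<in> crossed p q" "{a,b} \<in> crossed q p" "{b,a} \<in> crossed p q" "{b,a} \<in> crossed q p"
        using E s edge_sym[OF E] sep_flip sep_flip' unfolding crossed_iff by blast+
      have IH: "fv.positive_denominator (P {a',p'}) (\<lambda>i. isect (D i) {a',p'})"
        if "{a',b'} \<in> crossed p' q'" "crossed p' q' = crossed p q" "a' \<noteq> p'" "a' \<le> N" "p' \<le> N" for a' b' p' q'
      proof (rule less(1))
        show "card (crossed a' p') < card (crossed p q)"
          using crossed_side_psubset[OF that(1)] finite_crossed that(2) psubset_card_mono by metis
      qed (use that in blast)+
      note 1 = IH[OF cr(1)] and 2 = IH[OF cr(4)] and 3 = IH[OF cr(2)] and 4 = IH[OF cr(3)]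
      have PD: "fv.positive_denominator (P {a,p} * P {b,q} + P {a,q} * P {b,p})
        (\<lambda>i. max (isect (D i) {a,p} + isect (D i) {b,q}) (isect (D i) {a,q} + isect (D i) {b,p}))"
        by (intro fv.positive_denominator_add fv.positive_denominator_mult 1 2 3 4)
          (use N' dist crossed_sym in auto)
      have Pab: "P {a,b} = ?x l * W (D l)" using M l ab unfolding models_def by simp
      have x0: "?x l \<noteq> 0" using fv.x_nonzero l le by simp
      have "P {p,q} * (?x l * W (D l)) = P {a,p} * P {b,q} + P {a,q} * P {b,p}"
        using ptolemy_sep[OF s] N' unfolding Pab by simp
      then have Ppq: "P {p,q} = (P {a,p} * P {b,q} + P {a,q} * P {b,p}) / ?x l * inverse (W (D l))"
        using x0 W_nonzero[of "D l"] by (simp add: field_simps)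
      have ev: "max (isect (D i) {a,p} + isect (D i) {b,q}) (isect (D i) {a,q} + isect (D i) {b,p}) +
          (if i = l then 1 else 0) + 0 = isect (D i) {p,q}" if i: "i \<in> {1..n}" for i
      proof -
        obtain u v where uv: "D i = {u,v}" using doubleton[OF DE[OF i]] by blast
        have "\<not> sep u v a b" using nocross[OF DE[OF i] E] uv by simp
        moreover have "i = l \<longleftrightarrow> {u,v} = {a,b}"
          using M i l ab uv unfolding models_def by (metis inj_on_contraD)
        ultimately show ?thesis using isect_ptolemy[OF s] uv by simp
      qed
      show ?thesis unfolding Ppq winv
        by (rule fv.positive_denominator_cong[OF fv.positive_denominator_mult[OF fv.positive_denominator_divide_x[OF l(1) PD] fw]])
          (rule ev)
    qed
  qed
qed

lemma variable_denominator:
  assumes t: "t \<in> tree_verts n" and M: "models t D" and e: "e \<in> edges N"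
  shows "free_variables.positive_denominator n m (fst (\<Sigma> t)) (X e) (\<lambda>i. isect (D i) e)"
proof -
  interpret fv: free_variables n m "fst (\<Sigma> t)" by (rule pattern_free_variables[OF pattern t])
  obtain p q where pq: "e = {p,q}" "p \<noteq> q" "p \<le> N" "q \<le> N" using e unfolding edges_def by blast
  have fr: "r \<in> {n+1..m} \<Longrightarrow> fst (\<Sigma> t) r = fr r" for r using M by (simp add: models_def)
  have "inverse (W e) = (\<Prod>r\<in>{n+1..m}. fr r powi (- w r e))"
    unfolding W_def by (simp add: prod_inversef[symmetric] power_int_minus comp_def)
  also have "\<dots> = (\<Prod>r\<in>{n+1..m}. fst (\<Sigma> t) r powi (- w r e))"
    using fr by (intro prod.cong) auto
  finally have "fv.positive_denominator (inverse (W e)) (\<lambda>_. 0)"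
    using fv.positive_denominator_frozen by simp
  from fv.positive_denominator_mult[OF lambda_denominator[OF t M pq(2-4)] this]
  show ?thesis unfolding X_def pq(1) divide_inverse by simp
qed

end

section \<open>Chains of the quiver as sets of crossed diagonals\<close>

context polygon_model
begin

definition crossed_labels :: "(nat \<Rightarrow> nat set) \<Rightarrow> nat set \<Rightarrow> nat set" where
  "crossed_labels D e = {i \<in> {1..n}. crossing (D i) e}"

context
  fixes t :: "nat list" and D :: "nat \<Rightarrow> nat set"
  assumes t: "t \<in> tree_verts n" and M: "models t D"
begin

interpretation T: triangulation N "D ` {1..n} \<union> boundary N"
  using M by (simp add: models_def)

interpretation fv: free_variables n m "fst (\<Sigma> t)"
  by (rule pattern_free_variables[OF pattern t])

lemma D_inj: "inj_on D {1..n}"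
  using M by (simp add: models_def)

lemma D_not_boundary: "i \<in> {1..n} \<Longrightarrow> D i \<notin> boundary N"
  using M unfolding models_def by blast

lemma D_edges: "D ` {1..n} \<union> boundary N \<subseteq> edges N"
  by (rule T.edges_subset)

lemma image_crossed_labels:
  assumes "p \<le> N" "q \<le> N"
  shows "D ` crossed_labels D {p,q} = T.crossed p q"
proof
  show "D ` crossed_labels D {p,q} \<subseteq> T.crossed p q"
    unfolding crossed_labels_def T.crossed_def by blast
  show "T.crossed p q \<subseteq> D ` crossed_labels D {p,q}"
  proof
    fix e assume e: "e \<in> T.crossed p q"
    then have c: "e \<in> D ` {1..n} \<union> boundary N" "crossing e {p,q}" unfolding T.crossed_def by blast+
    have "e \<notin> boundary N" using T.boundary_not_crossed[OF _ assms] c(2) by blast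
    with c show "e \<in> D ` crossed_labels D {p,q}" unfolding crossed_labels_def by blast
  qed
qed

lemma crossed_labels_inj:
  assumes e: "e \<in> edges N - boundary N - D ` {1..n}" and f: "f \<in> edges N - boundary N - D ` {1..n}"
    and eq: "crossed_labels D e = crossed_labels D f"
  shows "e = f"
proof -
  obtain p q where pq: "e = {p,q}" "p \<noteq> q" "p \<le> N" "q \<le> N" using e unfolding edges_def by blast
  obtain p' q' where pq': "f = {p',q'}" "p' \<le> N" "q' \<le> N" using f unfolding edges_def by blast
  have "T.crossed p q = T.crossed p' q'"
    using image_crossed_labels[OF pq(3,4)] image_crossed_labels[OF pq'(2,3)] eq pq(1) pq'(1) by simp
  moreover have "T.crossed p q \<noteq> {}"
    using T.crossed_empty[OF pq(2-4)] e pq(1) by blast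
  ultimately show ?thesis using T.crossed_inj pq pq' by blast
qed

text \<open>Equal variables have equal exponents by uniqueness. An entry -1 identifies an initial
  diagonal; without such an entry the exponents give the crossed diagonals, which determine the
  arc.\<close>

lemma X_inj: "inj_on X (edges N - boundary N)"
proof (rule inj_onI)
  fix e f assume e: "e \<in> edges N - boundary N" and f: "f \<in> edges N - boundary N" and eq: "X e = X f"
  have "fv.positive_denominator (X e) (\<lambda>i. isect (D i) e)" "fv.positive_denominator (X e) (\<lambda>i. isect (D i) f)"
    using variable_denominator[OF t M, of e] variable_denominator[OF t M, of f] e f eq by simp_all
  then have is_eq: "isect (D i) e = isect (D i) f" if "i \<in> {1..n}" for i
    using fv.positive_denominator_unique that by blast
  have cross: "crossing (D i) e \<longleftrightarrow> crossing (D i) f" if "i \<in> {1..n}" "D i \<noteq> e" "D i \<noteq> f" for i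
    using is_eq[OF that(1)] that(2,3) by (auto simp: isect_def split: if_splits)
  have same: "D i = e \<longleftrightarrow> D i = f" if "i \<in> {1..n}" for i
    using is_eq[OF that] by (auto simp: isect_def split: if_splits)
  show "e = f"
  proof (cases "e \<in> D ` {1..n}")
    case True
    then show ?thesis using same by blast
  next
    case False
    then have "f \<notin> D ` {1..n}" using same by blast
    moreover from this False have "crossed_labels D e = crossed_labels D f"
      unfolding crossed_labels_def using cross by blast
    ultimately show ?thesis using crossed_labels_inj e f False by blast
  qed
qed

lemma bij_crossed_labels:
  assumes B0: "matrix_agree n n (snd (\<Sigma> t)) B0"
  shows "bij_betw (crossed_labels D) (edges N - boundary N - D ` {1..n}) (Phi_plus n B0)"
proof -
  let ?E = "D ` {1..n} \<union> boundary N"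
  have entry: "\<bar>B0 i j\<bar> \<le> 1 \<and> (B0 i j \<noteq> 0 \<longleftrightarrow> T.adj (D i) (D j))" if ij: "i \<in> {1..n}" "j \<in> {1..n}" for i j
  proof -
    have "D j \<in> ?E" using ij by blast
    then obtain a b c d where q: "D j = {a,c}" "quad ?E a b c d"
      using T.quad_exists D_not_boundary[OF ij(2)] by metis
    have "snd (\<Sigma> t) i j = shear (row n D w i) a b c d"
      using M ij q le unfolding models_def by auto
    then have "B0 i j = shear (ind (D i)) a b c d"
      using B0 ij unfolding matrix_agree_def row_def by simp
    then show ?thesis using shear_ind_quad[OF q(2), of "D i"] T.adj_quad[OF q(2), of "D i"] q(1) by simp
  qed
  have "labeled_seed F n m (\<Sigma> t)"
    using pattern t unfolding cluster_pattern_def by blast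
  then have "skew_symmetrizable n (snd (\<Sigma> t))"
    by (simp add: labeled_seed_def)
  then obtain g :: "nat \<Rightarrow> int" where g: "\<forall>i\<in>{1..n}. g i > 0"
    "\<forall>i\<in>{1..n}. \<forall>j\<in>{1..n}. g i * snd (\<Sigma> t) i j = - (g j * snd (\<Sigma> t) j i)"
    unfolding skew_symmetrizable_def by (elim exE conjE)
  \<comment> \<open>The symmetrizing factors are positive and disappear under \<open>sgn\<close>,
    which is all that the comparison with the quiver requires.\<close>
  have skew: "sgn (B0 i j) = - sgn (B0 j i)" if ij: "i \<in> {1..n}" "j \<in> {1..n}" for i j
  proof -
    have "g i * B0 i j = - (g j * B0 j i)"
      using bspec[OF bspec[OF g(2) ij(1)] ij(2)]
      unfolding bspec[OF bspec[OF B0[unfolded matrix_agree_def] ij(1)] ij(2)]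
        bspec[OF bspec[OF B0[unfolded matrix_agree_def] ij(2)] ij(1)] .
    moreover have "sgn (- k) = - sgn k" for k :: int by (simp add: sgn_if)
    ultimately have "sgn (g i * B0 i j) = - sgn (g j * B0 j i)" by (simp only:)
    then show ?thesis
      using bspec[OF g(1) ij(1)] bspec[OF g(1) ij(2)] by (simp only: sgn_mult sgn_pos mult_1_left)
  qed
  have chain: "is_chain (induce_subgraph (quiver_of n B0) C) \<longleftrightarrow>
      (\<exists>vs. vs \<noteq> [] \<and> set vs = C \<and> chain_list T.adj (map D vs))" if C: "C \<subseteq> {1..n}" for C
  proof -
    have "chain_list T.adj (map D vs) \<longleftrightarrow> chain_list (\<lambda>i j. B0 i j \<noteq> 0) vs" if vs: "set vs = C" for vs
    proof (rule chain_list_map)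
      show "inj_on D (set vs)" using inj_on_subset[OF D_inj C] vs by simp
      show "B0 i j \<noteq> 0 \<longleftrightarrow> T.adj (D i) (D j)" if "i \<in> set vs" "j \<in> set vs" for i j
        using entry C vs that by blast
    qed
    moreover have "is_chain (induce_subgraph (quiver_of n B0) C) \<longleftrightarrow>
        (\<exists>vs. vs \<noteq> [] \<and> set vs = C \<and> chain_list (\<lambda>i j. B0 i j \<noteq> 0) vs)"
      using C entry skew by (intro is_chain_quiver) blast+
    ultimately show ?thesis by blast
  qed
  show ?thesis unfolding bij_betw_def
  proof (intro conjI inj_onI)
    fix e f
    assume "e \<in> edges N - boundary N - D ` {1..n}" "f \<in> edges N - boundary N - D ` {1..n}"
      "crossed_labels D e = crossed_labels D f"
    then show "e = f" by (rule crossed_labels_inj)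
  next
    show "crossed_labels D ` (edges N - boundary N - D ` {1..n}) = Phi_plus n B0"
    proof (intro equalityI subsetI)
      fix C assume "C \<in> crossed_labels D ` (edges N - boundary N - D ` {1..n})"
      then obtain e where e: "e \<in> edges N" "e \<notin> ?E" and C: "C = crossed_labels D e" by blast
      obtain p q where pq: "e = {p,q}" "p \<noteq> q" "p \<le> N" "q \<le> N" using e(1) unfolding edges_def by blast
      obtain es where es: "T.dpath p q es" using T.dpath_exists[OF pq(2-4)] e(2) pq(1) by blast
      have img: "set es = D ` C" using T.dpath_crossed[OF es] image_crossed_labels[OF pq(3,4)] C pq(1) by simp
      have sub: "C \<subseteq> {1..n}" unfolding C crossed_labels_def by blast
      define vs where "vs = map (the_inv_into {1..n} D) es"
      have vs: "map D vs = es"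
        unfolding vs_def map_map using img sub f_the_inv_into_f[OF D_inj] by (intro map_idI) auto
      have im: "D ` set vs = D ` C" using vs img by (metis set_map)
      have svn: "set vs \<subseteq> {1..n}"
        unfolding vs_def using img sub the_inv_into_into[OF D_inj _ subset_refl] by auto
      have sv: "set vs = C" using inj_on_image_eq_iff[OF D_inj svn sub] im by (rule iffD1)
      have "es \<noteq> []" using T.dpath_Cons[OF es] by blast
      then have ne: "vs \<noteq> []" using vs by auto
      then have "C \<noteq> {}" using sv by auto
      moreover have "is_chain (induce_subgraph (quiver_of n B0) C)"
        unfolding chain[OF sub] using ne sv T.dpath_chain[OF es] vs by blast
      ultimately show "C \<in> Phi_plus n B0" using sub unfolding Phi_plus_def by blast
    next
      fix C assume "C \<in> Phi_plus n B0"
      then have C: "C \<subseteq> {1..n}" "C \<noteq> {}" "is_chain (induce_subgraph (quiver_of n B0) C)"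
        unfolding Phi_plus_def by blast+
      then obtain vs where vs: "vs \<noteq> []" "set vs = C" "chain_list T.adj (map D vs)"
        using chain by blast
      have "set (map D vs) \<subseteq> ?E - boundary N" using C(1) vs(2) D_not_boundary by auto
      then obtain p q where d: "T.dpath p q (map D vs)" using T.dpath_of_chain[OF vs(3)] vs(1) by auto
      have N': "p \<le> N" "q \<le> N" using T.dpath_bound[OF d] by blast+
      have cr: "T.crossed p q = D ` C" using T.dpath_crossed[OF d] vs(2) by simp
      then have "T.crossed p q \<noteq> {}" using C(2) by blast
      then have nE: "{p,q} \<notin> ?E" by (rule T.crossed_not_edge)
      have "p \<noteq> q" using T.dpath_Cons[OF d] sep_distinct by blast
      then have "{p,q} \<in> edges N - boundary N - D ` {1..n}" using N' nE by simp
      moreover have "crossed_labels D {p,q} = C"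
      proof -
        have "D ` crossed_labels D {p,q} = D ` C" using image_crossed_labels[OF N'] cr by simp
        moreover have "crossed_labels D {p,q} \<subseteq> {1..n}" unfolding crossed_labels_def by blast
        ultimately show ?thesis using inj_on_image_eq_iff[OF D_inj _ C(1)] by metis
      qed
      ultimately show "C \<in> crossed_labels D ` (edges N - boundary N - D ` {1..n})" by blast
    qed
  qed
qed

lemma denominator_bijection:
  assumes B0: "matrix_agree n n (snd (\<Sigma> t)) B0"
    and CV: "cluster_variables n \<Sigma> = X ` (edges N - boundary N)"
  shows "\<exists>\<phi>. bij_betw \<phi> (cluster_variables n \<Sigma> - cluster_at n \<Sigma> t) (Phi_plus n B0) \<and>
    (\<forall>z \<in> cluster_variables n \<Sigma> - cluster_at n \<Sigma> t.
       has_denominator_vector n m (fst (\<Sigma> t)) z (\<lambda>j. \<Sum>i\<in>\<phi> z. basis_vector i j))"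
proof -
  let ?G = "edges N - boundary N - D ` {1..n}"
  have D_sub: "D ` {1..n} \<subseteq> edges N - boundary N" using D_edges D_not_boundary by blast
  have V: "cluster_variables n \<Sigma> - cluster_at n \<Sigma> t = X ` ?G"
    unfolding CV cluster_eq[OF M] using inj_on_image_set_diff[OF X_inj _ D_sub] by blast
  have inj: "inj_on X ?G" using X_inj by (rule inj_on_subset) blast
  then have "bij_betw (the_inv_into ?G X) (X ` ?G) ?G"
    by (intro bij_betw_the_inv_into) (simp add: bij_betw_def)
  then have bij: "bij_betw (crossed_labels D \<circ> the_inv_into ?G X) (X ` ?G) (Phi_plus n B0)"
    using bij_crossed_labels[OF B0] by (rule bij_betw_trans)
  moreover have "has_denominator_vector n m (fst (\<Sigma> t)) z
      (\<lambda>j. \<Sum>i\<in>(crossed_labels D \<circ> the_inv_into ?G X) z. basis_vector i j)" if z: "z \<in> X ` ?G" for z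
  proof -
    obtain e where e: "e \<in> ?G" "z = X e" using z by (elim imageE)
    have phi: "(crossed_labels D \<circ> the_inv_into ?G X) z = crossed_labels D e"
      using e the_inv_into_f_f[OF inj e(1)] by simp
    have fin: "finite (crossed_labels D e)" unfolding crossed_labels_def by simp
    have "isect (D j) e = (\<Sum>i\<in>crossed_labels D e. basis_vector i j)" if "j \<in> {1..n}" for j
    proof -
      have "D j \<noteq> e" using e(1) that by blast
      then have "isect (D j) e = (if j \<in> crossed_labels D e then 1 else 0)"
        using that by (simp add: isect_def crossed_labels_def)
      also have "\<dots> = (\<Sum>i\<in>crossed_labels D e. basis_vector i j)"
        using fin by (simp add: basis_vector_def)
      finally show ?thesis .
    qed
    note vec = this
    have "fv.positive_denominator z (\<lambda>j. isect (D j) e)"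
      using variable_denominator[OF t M, of e] e by simp
    from fv.positive_denominator_cong[OF this vec]
    have "fv.positive_denominator z (\<lambda>j. \<Sum>i\<in>crossed_labels D e. basis_vector i j)" .
    then show ?thesis unfolding phi by (rule fv.positive_denominator_has_denominator_vector)
  qed
  ultimately show ?thesis unfolding V by blast
qed

end

end

lemma fan_model:
  assumes pat: "cluster_pattern F n m \<Sigma>" and t: "t \<in> tree_verts n"
    and B: "matrix_agree n n (snd (\<Sigma> t)) linear_A_matrix"
  obtains w P where "polygon_model n m (n + 2) F \<Sigma> w P (fst (\<Sigma> t))"
    "polygon_model.models n m (n + 2) \<Sigma> w P (fst (\<Sigma> t)) t fan"
proof -
  let ?x = "fst (\<Sigma> t)" and ?B = "snd (\<Sigma> t)"
  interpret fv: free_variables n m ?x by (rule pattern_free_variables[OF pat t])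
  \<comment> \<open>Lambda lengths of \<open>{0,k}\<close>: initial variables on the fan diagonals,
    and 1 on the two sides at 0, where the tropical solution is 0.\<close>
  define y where "y k = (if k = 1 \<or> k = n + 2 then 1 else ?x (k - 1))" for k
  \<comment> \<open>Partial sums of row \<open>r\<close>: the tropical values at vertex 0 vanish, so
    the shear at the j-th fan diagonal is \<open>u r (j + 1) - u r j\<close>, which must equal
    \<open>?B r j\<close>.\<close>
  define u where "u r l = (\<Sum>k\<in>{1..<l}. ?B r k)" for r l
  \<comment> \<open>The length of the side from l to l + 1 is forced by the requirement that
    \<open>P\<close> equal its frozen monomial on sides.\<close>
  define U where "U l = (\<Prod>r\<in>{n+1..m}. ?x r powi u r l)" for l
  define w where "w r = fan_tropical (u r)" for r
  define P where "P = fan_lambda y U"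
  have y0: "y k \<noteq> 0" if "0 < k" "k \<le> n + 2" for k
  proof -
    have "k = 1 \<or> k = n + 2 \<or> k - 1 \<in> {1..m}" using that fv.le by auto
    then show ?thesis unfolding y_def using fv.x_nonzero by auto
  qed
  have w_side: "w r {0,k} = 0" if "0 < k" for r k
    unfolding w_def by (rule fan_tropical_simps(1)[OF that])
  have w_bd: "w r {i, Suc i} = u r i" if "0 < i" for r i
    using that unfolding w_def by (subst fan_tropical_simps(2)) simp_all
  have bd_val: "P e = (\<Prod>r\<in>{n+1..m}. ?x r powi w r e)" if e: "e \<in> boundary (n + 2)" for e
  proof -
    consider "e = {0, n + 2}" | "e = {0, 1}" | i where "0 < i" "i < n + 2" "e = {i, Suc i}"
      using e unfolding boundary_def by auto (metis One_nat_def bot_nat_0.not_eq_extremum)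
    then show ?thesis
    proof cases
      case 1
      then show ?thesis using w_side[of "n + 2"] fan_lambda_simps(1)[of "n + 2" y U] by (simp add: P_def y_def)
    next
      case 2
      then show ?thesis using w_side[of 1] fan_lambda_simps(1)[of 1 y U] by (simp add: P_def y_def)
    next
      case 3
      have "P e = U i"
        using fan_lambda_simps(2)[of i "Suc i" y U] y0[of i] y0[of "Suc i"] 3 by (simp add: P_def)
      then show ?thesis using w_bd[OF 3(1)] 3(3) by (simp add: U_def)
    qed
  qed
  have pm: "polygon_model n m (n + 2) F \<Sigma> w P ?x"
  proof
    show "n \<le> m" by (rule fv.le)
    show "cluster_pattern F n m \<Sigma>" by (rule pat)
    show "tropical_ptolemy (w r) a b c d"
      if "r \<in> {n+1..m}" "cyc a b c" "cyc c d a" "a \<le> n + 2" "b \<le> n + 2" "c \<le> n + 2" "d \<le> n + 2" for r a b c d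
      unfolding w_def using that(2-) by (rule fan_tropical_ptolemy)
    show "P {a,c} * P {b,d} = P {a,b} * P {c,d} + P {b,c} * P {d,a}"
      if "cyc a b c" "cyc c d a" "a \<le> n + 2" "b \<le> n + 2" "c \<le> n + 2" "d \<le> n + 2" for a b c d
      unfolding P_def using that by (rule fan_lambda_ptolemy)
    show "?x r \<noteq> 0" if "r \<in> {n+1..m}" for r using fv.x_nonzero[of r] that by simp
  qed (simp, rule bd_val)
  interpret polygon_model n m "n + 2" F \<Sigma> w P ?x by (rule pm)
  have T: "triangulation (n + 2) (fan ` {1..n} \<union> boundary (n + 2))" by (rule fan_triangulation)
  interpret T: triangulation "n + 2" "fan ` {1..n} \<union> boundary (n + 2)" by (rule T)
  have fan_edge: "{0,k} \<in> fan ` {1..n} \<union> boundary (n + 2)" if "0 < k" "k \<le> n + 2" for k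
    using that fan_all_sides by blast
  have "models t fan" unfolding models_def
  proof (intro conjI ballI allI impI)
    show "inj_on fan {1..n}" by (rule fan_inj)
    show "fan ` {1..n} \<inter> boundary (n + 2) = {}" using fan_not_boundary by blast
    show "triangulation (n + 2) (fan ` {1..n} \<union> boundary (n + 2))" by (rule T)
    fix j assume j: "j \<in> {1..n}"
    have wf: "w r {0, j + 1} = 0" for r using w_side by simp
    show "?x j * W (fan j) = P (fan j)"
      using fan_lambda_simps(1)[of "j + 1" y U] j wf by (simp add: W_def P_def fan_def y_def)
    have q0: "quad (fan ` {1..n} \<union> boundary (n + 2)) 0 j (j + 1) (j + 2)"
      unfolding quad_def using fan_edge[of j] fan_edge[of "j + 1"] T.edge_sym[OF fan_edge[of "j + 2"]] j
      by (simp add: cyc_def) (auto simp: boundary_def)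
    fix a b c d r assume q: "quad (fan ` {1..n} \<union> boundary (n + 2)) a b c d \<and> fan j = {a,c}" and r: "r \<in> {1..m}"
    have sh: "shear h a b c d = shear h 0 j (j + 1) (j + 2)" for h
      using T.quad_unique[OF q0, of a b c d] q shear_rotate unfolding fan_def by metis
    show "?B r j = shear (row n fan w r) a b c d"
    proof (cases "r \<le> n")
      case True
      then have "?B r j = linear_A_matrix r j" using B r j unfolding matrix_agree_def by simp
      also have "\<dots> = shear (ind (fan r)) 0 j (j + 1) (j + 2)"
        using r j by (auto simp: shear_def ind_def fan_def linear_A_matrix_def doubleton_eq_iff)
      finally show ?thesis using True sh by (simp add: row_def)
    next
      case False
      have "shear (w r) 0 j (j + 1) (j + 2) = u r (j + 1) - u r j"
        using w_side[of j r] w_side[of "j + 2" r] w_bd[of j r] w_bd[of "j + 1" r] j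
        by (simp add: shear_def insert_commute)
      also have "\<dots> = ?B r j" using j by (simp add: u_def)
      finally show ?thesis using False sh by (simp add: row_def)
    qed
  next
    fix r assume "r \<in> {n+1..m}"
    show "?x r = ?x r" by simp
  qed
  with pm show thesis by (rule that)
qed

theorem proposition7p7:
  fixes F :: "'a::field_char_0 set"
    and n m :: nat
    and B0 :: int_matrix
    and \<Sigma> :: "nat list \<Rightarrow> 'a seed"
    and t0 :: "nat list"
  assumes "exchange_matrix_type_A n B0"
    and "cluster_pattern F n m \<Sigma>"
    and "t0 \<in> tree_verts n"
    and "matrix_agree n n (snd (\<Sigma> t0)) B0"
  shows "\<exists>\<phi>. bij_betw \<phi> (cluster_variables n \<Sigma> - cluster_at n \<Sigma> t0) (Phi_plus n B0) \<and>
           (\<forall>z \<in> cluster_variables n \<Sigma> - cluster_at n \<Sigma> t0.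
              has_denominator_vector n m (fst (\<Sigma> t0)) z (\<lambda>j. \<Sum>i\<in>\<phi> z. basis_vector i j))"
proof -
  obtain ks where ks: "set ks \<subseteq> {1..n}" "matrix_agree n n B0 (fold mutate_matrix ks linear_A_matrix)"
    using assms(1) unfolding exchange_matrix_type_A_def by blast
  obtain t where t: "t \<in> tree_verts n" "matrix_agree n n (snd (\<Sigma> t)) linear_A_matrix"
    using reach_matrix[OF assms(2) ks(1) assms(3) matrix_agree_trans[OF assms(4) ks(2)]] by blast
  obtain w P where pm: "polygon_model n m (n + 2) F \<Sigma> w P (fst (\<Sigma> t))"
    and M: "polygon_model.models n m (n + 2) \<Sigma> w P (fst (\<Sigma> t)) t fan"
    using fan_model[OF assms(2) t] by metis
  interpret polygon_model n m "n + 2" F \<Sigma> w P "fst (\<Sigma> t)" by (rule pm)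
  obtain D where D: "models t0 D" using models_all[OF M t(1) assms(3)] by blast
  show ?thesis
    using denominator_bijection[OF assms(3) D assms(4) cluster_variables_eq[OF t(1) M fan_all_sides]] .
qed

end
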